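(* Let $l,m,k$ be positive integers, $n=l+m+k$, and let $\lambda,\mu\in\mathbb{C}$ be such that $\lambda,\mu,0$ are pairwise distinct. Let $E$ and $B$ be the reflection equation matrices whose entries generate the algebras $\mathcal{A}_h(O_{[l,m,k;\lambda,\mu,0]})$ and $\mathcal{A}_h(O_{[l+m,k;-\lambda\mu,0]})$, respectively. The matrix correspondence $$\pi(B)=E^2-(\lambda+\mu)E$$ is extended to a $\mathcal{U}_h(gl(l+m+k))$-equivariant algebra morphism $$\mathcal{A}_h\bigl(O_{[l+m,k;-\lambda\mu,0]}\bigr)\longrightarrow\mathcal{A}_h\bigl(O_{[l,m,k;\lambda,\mu,0]}\bigr).$$
   Context: Quantum group and RE algebra. $\mathcal{U}_h(gl(n,\mathbb{C}))$ is the standard (Drinfeld–Jimbo) quantization of $\mathcal{U}(gl(n,\mathbb{C}))$, with coproduct $\Delta(x)=x_{(1)}\otimes x_{(2)}$ and antipode $\gamma$. With matrix units $e^i_j$ ($e^i_je^l_k=\delta^l_je^i_k$) and $q=e^h$, the image of its universal R-matrix in $\mathrm{End}(\mathbb{C}^n)^{\otimes2}[[h]]$ is $$R=q\sum_ie^i_i\otimes e^i_i+\sum_{i\ne j}e^i_i\otimes e^j_j+(q-q^{-1})\sum_{i<k}e^k_i\otimes e^i_k,$$ and $S=PR$, $P=\sum_{i,j}e^i_j\otimes e^j_i$. $\mathcal{L}_R$ is the associative $\mathbb{C}[[h]]$-algebra ($h$-adically completed) generated by $L^i_j$, $i,j=1,\dots,n$, subject to $SL_2SL_2=L_2SL_2S$,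 where $L=\sum_{i,j}L^i_je^j_i$, $L_2=1\otimes L$. It is a left $\mathcal{U}_h(gl(n,\mathbb{C}))$-module algebra via $x\triangleright L=\rho(\gamma(x_{(1)}))L\rho(x_{(2)})$, $\rho$ being the representation on $\mathbb{C}^n$. Quantum trace: $\mathrm{Tr}_q(A)=\sum_{i=1}^nq^{-2i+2}A^i_i$. Quantum integer: $\hat p=\frac{1-q^{-2p}}{1-q^{-2}}$ for $p\in\mathbb{N}$. The algebras. $\mathcal{A}_h(O_{[l,m,k;\lambda,\mu,0]})$ is the quotient of $\mathcal{L}_R$ (matrix of generators denoted $E$) by the relations $E(E-\lambda)(E-\mu)=0$, $\mathrm{Tr}_q(E)=\lambda\hat l+\mu\hat m$, $\mathrm{Tr}_q(E^2)=(\lambda+\mu)(\lambda\hat l+\mu\hat m)-\lambda\mu\,\widehat{l+m}$; it is a $\mathcal{U}_h(gl(n,\mathbb{C}))$-equivariant quantization of the conjugation orbit of diagonal matrices with eigenvalues $\lambda,\mu,0$ of multiplicities $l,m,k$. $\mathcal{A}_h(O_{[l+m,k;-\lambda\mu,0]})$ is the quotient of $\mathcal{L}_R$ (matrix of generators denoted $B$) by the relations $B(B+\lambda\mu)=0$, $\mathrm{Tr}_q(B)=-\lambda\mu\,\widehat{l+m}$; it quantizes the orbit with eigenvalues $-\lambda\mu,0$ of multiplicities $l+m,k$. No ordering of the pairs (multiplicity, eigenvalue) is assumed. The matrix correspondence means that the $(i,j)$ entry of $B$ is sent to the $(i,j)$ entry of $E^2-(\lambda+\mu)E$. *)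

theory Defs
  imports
    "HOL-Analysis.Analysis"
    "HOL-Library.Poly_Mapping"
    "HOL-Library.Product_Plus"
    "HOL-Computational_Algebra.Formal_Power_Series"
    "HOL-Algebra.QuotRing"
begin

section \<open>Completed free algebras over \<open>\<complex>[[h]]\<close>\<close>

text \<open>
  The ground ring \<open>\<complex>[[h]]\<close> is \<^typ>\<open>complex fps\<close>, the variable of the power series being \<open>h\<close>.
  Words over an alphabet form the free monoid, written additively because
  \<^typ>\<open>'m \<Rightarrow>\<^sub>0 complex\<close> is the monoid algebra \<open>\<complex>[M]\<close> of an additively written,
  possibly non-commutative monoid \<open>M\<close>.
\<close>

datatype 'x word = Word (letters: "'x list")

instantiation word :: (type) monoid_add
begin
definition zero_word :: "'x word" where "zero_word = Word []"
definition plus_word :: "'x word \<Rightarrow> 'x word \<Rightarrow> 'x word"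
  where "plus_word v w = Word (letters v @ letters w)"
instance by standard (simp_all add: zero_word_def plus_word_def)
end

text \<open>
  \<open>\<complex>[M][[h]]\<close> is the \<open>h\<close>-adic completion of \<open>\<complex>[[h]][M]\<close>. For \<open>M\<close> the words over an alphabet it is the
  completed free algebra, and for \<open>M = M\<^sub>1 \<times> M\<^sub>2\<close> it is the completed tensor product of
  \<open>\<complex>[M\<^sub>1][[h]]\<close> and \<open>\<complex>[M\<^sub>2][[h]]\<close>. The library metric on formal power series induces the
  \<open>h\<close>-adic topology on it.
\<close>

type_synonym 'm hser = "('m \<Rightarrow>\<^sub>0 complex) fps"

definition hscal :: "complex fps \<Rightarrow> ('m :: monoid_add) hser"
  where "hscal c = Abs_fps (\<lambda>N. Poly_Mapping.single 0 (fps_nth c N))"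

definition hmon :: "'m \<Rightarrow> ('m :: monoid_add) hser"
  where "hmon w = fps_const (Poly_Mapping.single w 1)"

text \<open>
  The \<open>\<complex>[[h]]\<close>-linear \<open>h\<close>-adically continuous map \<open>\<complex>[M][[h]] \<rightarrow> A[[h]]\<close> with value \<open>f w\<close> at
  the basis element \<open>w\<close> of \<open>M\<close>, where \<open>sc\<close> is the structure map \<open>\<complex> \<rightarrow> A\<close>: it sends
  \<open>\<Sum>\<^sub>i \<Sum>\<^sub>w h\<^sup>i u\<^sub>i\<^sub>w w\<close> to \<open>\<Sum>\<^sub>i \<Sum>\<^sub>w h\<^sup>i u\<^sub>i\<^sub>w f(w)\<close>.
\<close>

definition lin_ext :: "(complex \<Rightarrow> 'a) \<Rightarrow> ('m \<Rightarrow> 'a fps) \<Rightarrow> 'm hser \<Rightarrow> ('a :: ring_1) fps"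
  where "lin_ext sc f u = Abs_fps (\<lambda>N. \<Sum>i\<le>N. \<Sum>w\<in>Poly_Mapping.keys (fps_nth u i).
           sc (Poly_Mapping.lookup (fps_nth u i) w) * fps_nth (f w) (N - i))"

abbreviation hext :: "('m \<Rightarrow> ('k :: monoid_add) hser) \<Rightarrow> 'm hser \<Rightarrow> 'k hser"
  where "hext \<equiv> lin_ext (Poly_Mapping.single 0)"

abbreviation cext :: "('m \<Rightarrow> complex fps) \<Rightarrow> 'm hser \<Rightarrow> complex fps"
  where "cext \<equiv> lin_ext (\<lambda>z. z)"

definition tensor :: "('m :: monoid_add) hser \<Rightarrow> ('k :: monoid_add) hser \<Rightarrow> ('m \<times> 'k) hser"
    (infixl \<open>\<otimes>\<^sub>h\<close> 75)
  where "u \<otimes>\<^sub>h v = hext (\<lambda>w. hmon (w, 0)) u * hext (\<lambda>w. hmon (0, w)) v"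

text \<open>\<open>e\<^sup>h\<^sup>p\<close> for \<open>p\<close> in \<open>\<complex>[M]\<close>.\<close>

definition hexp :: "(('m :: monoid_add) \<Rightarrow>\<^sub>0 complex) \<Rightarrow> 'm hser"
  where "hexp p = Abs_fps (\<lambda>N. Poly_Mapping.single 0 (1 / fact N) * p ^ N)"

definition gen :: "'x \<Rightarrow> 'x word hser"
  where "gen x = hmon (Word [x])"

definition free_alg :: "'x set \<Rightarrow> 'x word hser ring"
  where "free_alg X = \<lparr>carrier = {u. \<forall>N. \<forall>w\<in>Poly_Mapping.keys (fps_nth u N). set (letters w) \<subseteq> X},
           mult = (*), one = 1, zero = 0, add = (+)\<rparr>"

text \<open>
  The \<open>h\<close>-adically completed \<open>\<complex>[[h]]\<close>-algebra with generators \<open>X\<close> and relations \<open>r = 0\<close> for \<open>r\<close> in \<open>S\<close>: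
  the quotient of the completed free algebra by the \<open>h\<close>-adic closure of the two-sided ideal
  generated by \<open>S\<close>.
\<close>

definition closed_ideal :: "'x set \<Rightarrow> 'x word hser set \<Rightarrow> 'x word hser set"
  where "closed_ideal X S = closure (Idl\<^bsub>free_alg X\<^esub> S)"

definition presented_alg :: "'x set \<Rightarrow> 'x word hser set \<Rightarrow> 'x word hser set ring"
  where "presented_alg X S = free_alg X Quot closed_ideal X S"

definition cls :: "'x set \<Rightarrow> 'x word hser set \<Rightarrow> 'x word hser \<Rightarrow> 'x word hser set"
  where "cls X S a = closed_ideal X S +>\<^bsub>free_alg X\<^esub> a"


section \<open>Matrices\<close>

text \<open>Matrices are functions of a row and a column index, used on a finite index set \<open>I\<close>.\<close>

type_synonym ('i, 'a) matr = "'i \<Rightarrow> 'i \<Rightarrow> 'a"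

definition mmul :: "'i set \<Rightarrow> ('i, 'a :: semiring_0) matr \<Rightarrow> ('i, 'a) matr \<Rightarrow> ('i, 'a) matr"
  where "mmul I A B = (\<lambda>r c. \<Sum>s\<in>I. A r s * B s c)"

definition idm :: "('i, 'a :: zero_neq_one) matr"
  where "idm = (\<lambda>r c. if r = c then 1 else 0)"

text \<open>The matrix unit \<open>e\<^sup>i\<^sub>j\<close> has its entry 1 in row \<open>i\<close> and column \<open>j\<close>.\<close>

definition munit :: "'i \<Rightarrow> 'i \<Rightarrow> ('i, 'a :: zero_neq_one) matr"
  where "munit i j = (\<lambda>r c. if r = i \<and> c = j then 1 else 0)"

definition kron :: "('i, 'a :: times) matr \<Rightarrow> ('j, 'a) matr \<Rightarrow> ('i \<times> 'j, 'a) matr"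
  where "kron A B = (\<lambda>(r1, r2) (c1, c2). A r1 c1 * B r2 c2)"

definition hscalm :: "('i, complex fps) matr \<Rightarrow> ('i, ('m :: monoid_add) hser) matr"
  where "hscalm A = (\<lambda>r c. hscal (A r c))"


section \<open>Quantum parameters\<close>

text \<open>\<open>q\<^sup>s\<close> for \<open>q = e\<^sup>h\<close>.\<close>

definition qpow :: "int \<Rightarrow> complex fps"
  where "qpow s = fps_exp (of_int s)"

text \<open>Numerator and denominator are divisible by \<open>h\<close>; fps division cancels this factor.\<close>

definition qint :: "nat \<Rightarrow> complex fps"
  where "qint p = (1 - qpow (- 2 * int p)) / (1 - qpow (- 2))"


section \<open>The quantum group \<open>U\<^sub>h(gl(n))\<close>\<close>

text \<open>
  \<open>UH i\<close>, \<open>UE i\<close>, \<open>UF i\<close> correspond to the classical \<open>e\<^sup>i\<^sub>i\<close>, \<open>e\<^sup>i\<^sub>i\<^sub>+\<^sub>1\<close>, \<open>e\<^sup>i\<^sup>+\<^sup>1\<^sub>i\<close>. The coproduct below is the one for which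
  the given \<open>R\<close> satisfies \<open>R \<Delta>(x) = \<Delta>\<^sup>o\<^sup>p(x) R\<close> on \<open>\<complex>\<^sup>n \<otimes> \<complex>\<^sup>n\<close> and
  \<open>\<gamma>\<^sup>2(x) = D\<^sup>-\<^sup>1 x D\<close> on \<open>\<complex>\<^sup>n\<close> for the weight matrix \<open>D\<close> of the quantum trace.
\<close>

datatype ugen = UH nat | UE nat | UF nat

definition ugens :: "nat \<Rightarrow> ugen set"
  where "ugens n = UH ` {1..n} \<union> UE ` {1..<n} \<union> UF ` {1..<n}"

text \<open>\<open>K\<^sub>i\<^sup>s = q\<^bsup>s (H\<^sub>i - H\<^sub>i\<^sub>+\<^sub>1)\<^esup>\<close>\<close>

definition uK :: "int \<Rightarrow> nat \<Rightarrow> ugen word hser"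
  where "uK s i = hexp (Poly_Mapping.single (Word [UH i]) (of_int s)
                        - Poly_Mapping.single (Word [UH (Suc i)]) (of_int s))"

text \<open>
  \<open>(K\<^sub>i - K\<^sub>i\<^sup>-\<^sup>1) / (q - q\<^sup>-\<^sup>1)\<close>: both differences have zero constant term, and
  \<open>(q - q\<^sup>-\<^sup>1) / h\<close> is invertible.
\<close>

definition uKquot :: "nat \<Rightarrow> ugen word hser"
  where "uKquot i = fps_shift 1 (uK 1 i - uK (- 1) i)
                    * hscal (inverse (fps_shift 1 (qpow 1 - qpow (- 1))))"

definition serre :: "(nat \<Rightarrow> ugen) \<Rightarrow> nat \<Rightarrow> nat \<Rightarrow> ugen word hser"
  where "serre g i j = (gen (g i))\<^sup>2 * gen (g j)
           - hscal (qpow 1 + qpow (- 1)) * (gen (g i) * gen (g j) * gen (g i))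
           + gen (g j) * (gen (g i))\<^sup>2"

definition urels :: "nat \<Rightarrow> ugen word hser set"
  where "urels n =
    {gen (UH i) * gen (UH j) - gen (UH j) * gen (UH i) | i j. i \<in> {1..n} \<and> j \<in> {1..n}}
  \<union> {gen (UH i) * gen (UE j) - gen (UE j) * gen (UH i)
       - (of_bool (i = j) - of_bool (i = Suc j)) * gen (UE j) | i j. i \<in> {1..n} \<and> j \<in> {1..<n}}
  \<union> {gen (UH i) * gen (UF j) - gen (UF j) * gen (UH i)
       + (of_bool (i = j) - of_bool (i = Suc j)) * gen (UF j) | i j. i \<in> {1..n} \<and> j \<in> {1..<n}}
  \<union> {gen (UE i) * gen (UF j) - gen (UF j) * gen (UE i) - of_bool (i = j) * uKquot i
       | i j. i \<in> {1..<n} \<and> j \<in> {1..<n}}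
  \<union> {gen (g i) * gen (g j) - gen (g j) * gen (g i) | g i j.
       g \<in> {UE, UF} \<and> i \<in> {1..<n} \<and> j \<in> {1..<n} \<and> Suc i < j}
  \<union> {serre g i j | g i j.
       g \<in> {UE, UF} \<and> i \<in> {1..<n} \<and> j \<in> {1..<n} \<and> (j = Suc i \<or> i = Suc j)}"

definition Uh :: "nat \<Rightarrow> ugen word hser set ring"
  where "Uh n = presented_alg (ugens n) (urels n)"

text \<open>
  The coproduct, the counit, the antipode and the representation \<open>\<rho>\<close> on \<open>\<complex>\<^sup>n\<close>, given on elements of
  the completed free algebra that represent elements of \<open>U\<^sub>h(gl(n))\<close>.
\<close>

fun coprod_gen :: "ugen \<Rightarrow> (ugen word \<times> ugen word) hser"
  where
    "coprod_gen (UH i) = gen (UH i) \<otimes>\<^sub>h 1 + 1 \<otimes>\<^sub>h gen (UH i)"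
  | "coprod_gen (UE i) = gen (UE i) \<otimes>\<^sub>h 1 + uK 1 i \<otimes>\<^sub>h gen (UE i)"
  | "coprod_gen (UF i) = gen (UF i) \<otimes>\<^sub>h uK (- 1) i + 1 \<otimes>\<^sub>h gen (UF i)"

definition coprod :: "ugen word hser \<Rightarrow> (ugen word \<times> ugen word) hser"
  where "coprod = hext (\<lambda>w. prod_list (map coprod_gen (letters w)))"

definition counit :: "ugen word hser \<Rightarrow> complex fps"
  where "counit = cext (\<lambda>w. prod_list (map (\<lambda>g. 0) (letters w)))"

fun antipode_gen :: "ugen \<Rightarrow> ugen word hser"
  where
    "antipode_gen (UH i) = - gen (UH i)"
  | "antipode_gen (UE i) = - (uK (- 1) i * gen (UE i))"
  | "antipode_gen (UF i) = - (gen (UF i) * uK 1 i)"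

definition antipode :: "ugen word hser \<Rightarrow> ugen word hser"
  where "antipode = hext (\<lambda>w. prod_list (rev (map antipode_gen (letters w))))"

fun rho_gen :: "ugen \<Rightarrow> (nat, complex fps) matr"
  where
    "rho_gen (UH i) = munit i i"
  | "rho_gen (UE i) = munit i (Suc i)"
  | "rho_gen (UF i) = munit (Suc i) i"

definition rho :: "nat \<Rightarrow> ugen word hser \<Rightarrow> (nat, complex fps) matr"
  where "rho n x = (\<lambda>r c. cext (\<lambda>w. foldr (\<lambda>g A. mmul {1..n} (rho_gen g) A) (letters w) idm r c) x)"


section \<open>The reflection equation algebra and its \<open>U\<^sub>h(gl(n))\<close>-action\<close>

text \<open>
  A generator is named by its (row, column) position in the matrix of generators; in
  \<open>L = \<Sum> L\<^sup>i\<^sub>j e\<^sup>j\<^sub>i\<close> the generator \<open>L\<^sup>i\<^sub>j\<close> stands in row \<open>j\<close> and column \<open>i\<close>.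
\<close>

type_synonym lgen = "nat \<times> nat"

definition lgens :: "nat \<Rightarrow> lgen set"
  where "lgens n = {1..n} \<times> {1..n}"

definition Lmat :: "(nat, lgen word hser) matr"
  where "Lmat = (\<lambda>r c. gen (r, c))"

definition Rmat :: "nat \<Rightarrow> (nat \<times> nat, complex fps) matr"
  where "Rmat n = (\<lambda>r c.
      qpow 1 * (\<Sum>i\<in>{1..n}. kron (munit i i) (munit i i) r c)
    + (\<Sum>i\<in>{1..n}. \<Sum>j\<in>{1..n} - {i}. kron (munit i i) (munit j j) r c)
    + (qpow 1 - qpow (- 1)) * (\<Sum>i\<in>{1..n}. \<Sum>k\<in>{i<..n}. kron (munit k i) (munit i k) r c))"

definition Pmat :: "nat \<Rightarrow> (nat \<times> nat, complex fps) matr"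
  where "Pmat n = (\<lambda>r c. \<Sum>i\<in>{1..n}. \<Sum>j\<in>{1..n}. kron (munit i j) (munit j i) r c)"

definition Smat :: "nat \<Rightarrow> (nat \<times> nat, complex fps) matr"
  where "Smat n = mmul ({1..n} \<times> {1..n}) (Pmat n) (Rmat n)"

definition re_rels :: "nat \<Rightarrow> lgen word hser set"
  where "re_rels n =
    (let I = {1..n} \<times> {1..n}; S = hscalm (Smat n); L2 = kron idm Lmat;
         SL = mmul I S L2; LS = mmul I L2 S
     in {mmul I SL SL r c - mmul I LS LS r c | r c. r \<in> I \<and> c \<in> I})"

text \<open>\<open>x \<triangleright> L = \<rho>(\<gamma>(x\<^sub>(\<^sub>1\<^sub>))) L \<rho>(x\<^sub>(\<^sub>2\<^sub>))\<close>, for the entry of \<open>L\<close> in row \<open>r\<close> and column \<open>c\<close>.\<close>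

definition act_gen :: "nat \<Rightarrow> ugen word hser \<Rightarrow> lgen \<Rightarrow> lgen word hser"
  where "act_gen n x = (\<lambda>(r, c). hext (\<lambda>(u, v).
           mmul {1..n} (mmul {1..n} (hscalm (rho n (antipode (hmon u)))) Lmat)
             (hscalm (rho n (hmon v))) r c) (coprod x))"

text \<open>The module algebra rules \<open>x \<triangleright> 1 = \<epsilon>(x) 1\<close> and \<open>x \<triangleright> ab = (x\<^sub>(\<^sub>1\<^sub>) \<triangleright> a) (x\<^sub>(\<^sub>2\<^sub>) \<triangleright> b)\<close>.\<close>

primrec act_word :: "nat \<Rightarrow> lgen list \<Rightarrow> ugen word hser \<Rightarrow> lgen word hser"
  where
    "act_word n [] x = hscal (counit x)"
  | "act_word n (g # gs) x = hext (\<lambda>(u, v). act_gen n (hmon u) g * act_word n gs (hmon v)) (coprod x)"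

definition act_free :: "nat \<Rightarrow> ugen word hser \<Rightarrow> lgen word hser \<Rightarrow> lgen word hser"
  where "act_free n x = hext (\<lambda>w. act_word n (letters w) x)"

text \<open>
  The induced action \<open>X \<triangleright> C\<close> of \<open>U\<^sub>h(gl(n))\<close> on the quotient of the reflection equation algebra by
  further invariant relations: the class of \<open>x \<triangleright> a\<close> for representatives \<open>x\<close> of \<open>X\<close> and \<open>a\<close> of \<open>C\<close>.
\<close>

definition uh_act :: "nat \<Rightarrow> lgen word hser set \<Rightarrow> ugen word hser set \<Rightarrow> lgen word hser set
    \<Rightarrow> lgen word hser set"
  where "uh_act n S X C = cls (lgens n) S (act_free n (SOME x. x \<in> X) (SOME a. a \<in> C))"


section \<open>The quantized orbits\<close>

definition qtrace :: "nat \<Rightarrow> (nat, ('m :: monoid_add) hser) matr \<Rightarrow> 'm hser"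
  where "qtrace n A = (\<Sum>i\<in>{1..n}. hscal (qpow (- 2 * int i + 2)) * A i i)"

text \<open>\<open>A - z\<close> for a square matrix \<open>A\<close> and a complex number \<open>z\<close>.\<close>

definition shiftm :: "(nat, ('m :: monoid_add) hser) matr \<Rightarrow> complex \<Rightarrow> (nat, 'm hser) matr"
  where "shiftm A z = (\<lambda>r c. A r c - hscal (fps_const z) * idm r c)"

definition orbit3_rels :: "nat \<Rightarrow> nat \<Rightarrow> nat \<Rightarrow> complex \<Rightarrow> complex \<Rightarrow> lgen word hser set"
  where "orbit3_rels l m k lam mu =
    (let n = l + m + k; E = Lmat;
         E3 = mmul {1..n} (mmul {1..n} E (shiftm E lam)) (shiftm E mu);
         t = fps_const lam * qint l + fps_const mu * qint m
     in re_rels n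
        \<union> {E3 r c | r c. r \<in> {1..n} \<and> c \<in> {1..n}}
        \<union> {qtrace n E - hscal t}
        \<union> {qtrace n (mmul {1..n} E E)
             - hscal (fps_const (lam + mu) * t - fps_const (lam * mu) * qint (l + m))})"

definition orbit2_rels :: "nat \<Rightarrow> nat \<Rightarrow> complex \<Rightarrow> lgen word hser set"
  where "orbit2_rels l k nu =
    (let n = l + k; B = Lmat; B2 = mmul {1..n} B (shiftm B nu)
     in re_rels n
        \<union> {B2 r c | r c. r \<in> {1..n} \<and> c \<in> {1..n}}
        \<union> {qtrace n B - hscal (fps_const nu * qint l)})"

abbreviation quot_alg :: "nat \<Rightarrow> lgen word hser set \<Rightarrow> lgen word hser set ring"
  where "quot_alg n S \<equiv> presented_alg (lgens n) S"

text \<open>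
  \<open>U\<^sub>h(gl(n))\<close>-equivariant morphisms of unital \<open>\<complex>[[h]]\<close>-algebras. A ring homomorphism
  is \<open>\<complex>[[h]]\<close>-linear if and only if it respects the structure maps from \<open>\<complex>[[h]]\<close>.
\<close>

definition equivariant_morphism ::
    "nat \<Rightarrow> lgen word hser set \<Rightarrow> lgen word hser set \<Rightarrow> (lgen word hser set \<Rightarrow> lgen word hser set) \<Rightarrow> bool"
  where "equivariant_morphism n S T \<pi> \<longleftrightarrow>
    \<pi> \<in> ring_hom (quot_alg n S) (quot_alg n T)
    \<and> (\<forall>z. \<pi> (cls (lgens n) S (hscal z)) = cls (lgens n) T (hscal z))
    \<and> (\<forall>X\<in>carrier (Uh n). \<forall>C\<in>carrier (quot_alg n S).
         \<pi> (uh_act n S X C) = uh_act n T X (\<pi> C))"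

end

theory Submission
  imports Defs
begin

text \<open>
  Put \<open>F = E\<^sup>2 - (\<lambda> + \<mu>) E\<close>. The cubic relation gives \<open>E F = F E = -\<lambda>\<mu> E\<close>, hence \<open>F (F + \<lambda>\<mu>) = 0\<close>, and
  the trace condition on \<open>F\<close> is a linear combination of the two trace relations for \<open>E\<close>. With
  \<open>E F = F E = -\<lambda>\<mu> E\<close> and the Hecke relation \<open>S\<^sup>2 = 1 + (q - q\<^sup>-\<^sup>1) S\<close>, the reflection equation for \<open>E\<close>
  implies the one for \<open>F\<close>. So substituting \<open>F\<close> for the generators descends to the quotients.

  Equivariance holds already on the completed free algebras: the matrices \<open>A\<close> that transform as
  \<open>x \<triangleright> A = \<rho>(\<gamma>(x\<^sub>(\<^sub>1\<^sub>))) A \<rho>(x\<^sub>(\<^sub>2\<^sub>))\<close> are closed under matrix products and linear combinations, so that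
  \<open>F\<close> transforms as \<open>E\<close> does. The same closure property shows that the defining relations span
  \<open>U\<^sub>h\<close>-stable spaces, which makes the action on the quotients independent of representatives. All
  this is checked on the generators \<open>H\<^sub>i, E\<^sub>i, F\<^sub>i\<close> and the group-like elements \<open>K\<^sub>i\<^sup>s\<close>, since
  \<open>\<Delta>(g) = g \<otimes> K\<^sub>r + K\<^sub>l \<otimes> g\<close> for each generator \<open>g\<close>.
\<close>

text \<open>The choice of \<open>F\<close> comes from the eigenvalues:
  \<open>x^2 - (\<lambda> + \<mu>) x\<close> equals \<open>-\<lambda>\<mu>\<close> at both
  \<open>\<lambda>\<close> and \<open>\<mu>\<close> and vanishes at 0, so it merges the first two
  eigenvalues. Equivalently \<open>(E - \<lambda>)(E - \<mu>) = F + \<lambda>\<mu>\<close>, so the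
  cubic relation is linear in \<open>F\<close>. The topological obstacle is that elements are
  infinite series and ideals have to be closed. Every map that occurs is linear over the power
  series ring, hence \<open>h\<close>-adically continuous, so identities are tested on words and
  closedness is approximation modulo each \<open>h^k\<close>. In the equivariance identity both
  sides pick the same representative of a class in \<open>U_h\<close>, but they pick unrelated
  representatives in the target algebra. So two facts are combined: substitution commutes with the
  action on the free algebra, and the closed ideal of the target is stable under the action.\<close>

section \<open>Linear maps of completed monoid algebras\<close>

lemma sum_single: "Poly_Mapping.single k (sum f A) = (\<Sum>a\<in>A. Poly_Mapping.single k (f a))"
  by (induction A rule: infinite_finite_induct) (simp_all add: single_add)

lemma poly_mapping_expand:
  fixes p :: "'m \<Rightarrow>\<^sub>0 'a :: comm_monoid_add"
  assumes "finite W" "Poly_Mapping.keys p \<subseteq> W"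
  shows "p = (\<Sum>w\<in>W. Poly_Mapping.single w (Poly_Mapping.lookup p w))"
proof (rule poly_mapping_eqI)
  fix v
  have "(\<Sum>w\<in>W. if w = v then Poly_Mapping.lookup p w else 0)
      = (if v \<in> W then Poly_Mapping.lookup p v else 0)"
    using assms(1) by simp
  also have "\<dots> = Poly_Mapping.lookup p v"
    using assms(2) by (auto simp: in_keys_iff)
  finally show "Poly_Mapping.lookup p v
      = Poly_Mapping.lookup (\<Sum>w\<in>W. Poly_Mapping.single w (Poly_Mapping.lookup p w)) v"
    by (simp add: lookup_sum lookup_single when_def)
qed

text \<open>Words do not commute, so the centrality of scalars is read off from the expansion in
  basis elements.\<close>

lemma single_0_commute:
  fixes p :: "('m :: monoid_add) \<Rightarrow>\<^sub>0 complex"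
  shows "Poly_Mapping.single 0 z * p = p * Poly_Mapping.single 0 z"
proof -
  let ?S = "\<lambda>w. Poly_Mapping.single w (Poly_Mapping.lookup p w)"
  have p: "p = sum ?S (Poly_Mapping.keys p)"
    by (rule poly_mapping_expand) auto
  have "Poly_Mapping.single 0 z * sum ?S (Poly_Mapping.keys p)
      = sum ?S (Poly_Mapping.keys p) * Poly_Mapping.single 0 z"
    by (simp add: sum_distrib_left sum_distrib_right mult_single mult.commute)
  then show ?thesis
    using p by simp
qed

section \<open>Power series scalars as central elements\<close>

lemma hscal_nth [simp]: "fps_nth (hscal c) N = Poly_Mapping.single 0 (fps_nth c N)"
  by (simp add: hscal_def)

lemma hscal_0 [simp]: "hscal 0 = 0"
  by (simp add: fps_eq_iff)

lemma hscal_1 [simp]: "hscal 1 = 1"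
  by (simp add: fps_eq_iff)

lemma hscal_add: "hscal (a + b) = hscal a + hscal b"
  by (simp add: fps_eq_iff single_add)

lemma hscal_diff: "hscal (a - b) = hscal a - hscal b"
  by (simp add: fps_eq_iff single_diff)

lemma hscal_uminus: "hscal (- a) = - hscal a"
  by (simp add: fps_eq_iff single_uminus)

lemma hscal_sum: "hscal (sum f A) = (\<Sum>x\<in>A. hscal (f x))"
  by (induction A rule: infinite_finite_induct) (simp_all add: hscal_add)

lemma hscal_mult: "hscal (a * b) = hscal a * hscal b"
  by (simp add: fps_eq_iff fps_mult_nth mult_single sum_single)

lemma hscal_power: "hscal (a ^ k) = hscal a ^ k"
  by (induction k) (simp_all add: hscal_mult)

lemma hscal_inject: "hscal a = hscal b \<longleftrightarrow> a = b"
  by (auto simp: fps_eq_iff inj_eq[OF inj_single])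

lemma hscal_commute: "u * hscal c = hscal c * u"
proof (rule fps_ext)
  fix N
  have "fps_nth (u * hscal c) N = (\<Sum>i=0..N. fps_nth u i * Poly_Mapping.single 0 (fps_nth c (N - i)))"
    by (simp add: fps_mult_nth)
  also have "\<dots> = (\<Sum>i=0..N. Poly_Mapping.single 0 (fps_nth c (N - i)) * fps_nth u i)"
    by (simp add: single_0_commute)
  also have "\<dots> = (\<Sum>i=0..N. Poly_Mapping.single 0 (fps_nth c i) * fps_nth u (N - i))"
    by (rule sum.reindex_bij_witness[where i = "\<lambda>i. N - i" and j = "\<lambda>i. N - i"]) auto
  also have "\<dots> = fps_nth (hscal c * u) N"
    by (simp add: fps_mult_nth)
  finally show "fps_nth (u * hscal c) N = fps_nth (hscal c * u) N" .
qed

lemma hscal_left_commute: "u * (hscal c * v) = hscal c * (u * v)"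
  using hscal_commute[of u c] by (simp flip: mult.assoc)

lemma hscal_fps_X: "hscal fps_X = fps_X"
  by (simp add: fps_eq_iff)

lemma hscal_fps_const: "hscal (fps_const z) = fps_const (Poly_Mapping.single 0 z)"
  by (simp add: fps_eq_iff)

lemma hmon_0 [simp]: "hmon 0 = 1"
  by (simp add: hmon_def)

lemma hmon_add: "hmon (v + w) = hmon v * hmon w"
  by (simp add: hmon_def mult_single fps_const_mult)

section \<open>Linear maps over the power series ring\<close>

definition hlin :: "('m :: monoid_add hser \<Rightarrow> 'k :: monoid_add hser) \<Rightarrow> bool"
  where "hlin \<phi> \<longleftrightarrow> (\<forall>u v. \<phi> (u + v) = \<phi> u + \<phi> v) \<and> (\<forall>c u. \<phi> (hscal c * u) = hscal c * \<phi> u)"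

lemma hlinI:
  assumes "\<And>u v. \<phi> (u + v) = \<phi> u + \<phi> v" "\<And>c u. \<phi> (hscal c * u) = hscal c * \<phi> u"
  shows "hlin \<phi>"
  using assms by (simp add: hlin_def)

lemma hlin_add: "hlin \<phi> \<Longrightarrow> \<phi> (u + v) = \<phi> u + \<phi> v"
  by (simp add: hlin_def)

lemma hlin_scal: "hlin \<phi> \<Longrightarrow> \<phi> (hscal c * u) = hscal c * \<phi> u"
  by (simp add: hlin_def)

lemma hlin_0: "hlin \<phi> \<Longrightarrow> \<phi> 0 = 0"
  using hlin_scal[of \<phi> 0 0] by simp

lemma hlin_uminus: "hlin \<phi> \<Longrightarrow> \<phi> (- u) = - \<phi> u"
  using hlin_scal[of \<phi> "- 1" u] by (simp add: hscal_uminus)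

lemma hlin_diff: "hlin \<phi> \<Longrightarrow> \<phi> (u - v) = \<phi> u - \<phi> v"
  using hlin_add[of \<phi> u "- v"] by (simp add: hlin_uminus)

lemma hlin_sum: "hlin \<phi> \<Longrightarrow> \<phi> (sum f A) = (\<Sum>x\<in>A. \<phi> (f x))"
  by (induction A rule: infinite_finite_induct) (simp_all add: hlin_0 hlin_add)

lemma hlin_hscal: "hlin \<phi> \<Longrightarrow> \<phi> (hscal c) = hscal c * \<phi> 1"
  using hlin_scal[of \<phi> c 1] by simp

lemma hlin_id: "hlin (\<lambda>u. u)"
  by (simp add: hlin_def)

lemma hlin_comp: "hlin \<phi> \<Longrightarrow> hlin \<psi> \<Longrightarrow> hlin (\<lambda>u. \<phi> (\<psi> u))"
  by (simp add: hlin_def)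

lemma hlin_plus: "hlin \<phi> \<Longrightarrow> hlin \<psi> \<Longrightarrow> hlin (\<lambda>u. \<phi> u + \<psi> u)"
  by (simp add: hlin_def algebra_simps)

lemma hlin_minus: "hlin \<phi> \<Longrightarrow> hlin \<psi> \<Longrightarrow> hlin (\<lambda>u. \<phi> u - \<psi> u)"
  by (simp add: hlin_def algebra_simps)

lemma hlin_lmult: "hlin \<phi> \<Longrightarrow> hlin (\<lambda>u. a * \<phi> u)"
  by (simp add: hlin_def distrib_left hscal_left_commute)

lemma hlin_rmult: "hlin \<phi> \<Longrightarrow> hlin (\<lambda>u. \<phi> u * a)"
  by (simp add: hlin_def distrib_right mult.assoc)

lemma hlin_sumf: "(\<And>x. x \<in> A \<Longrightarrow> hlin (\<phi> x)) \<Longrightarrow> hlin (\<lambda>u. \<Sum>x\<in>A. \<phi> x u)"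
  by (auto simp: hlin_def sum.distrib sum_distrib_left)

text \<open>\<open>h\<close>-adic closedness, phrased by approximation modulo each
  \<open>h^k\<close> instead of the metric: a linear map can be applied directly to such an
  approximation.\<close>

definition hclosed :: "'m :: monoid_add hser set \<Rightarrow> bool"
  where "hclosed J \<longleftrightarrow> (\<forall>x. (\<forall>k. \<exists>j\<in>J. \<exists>v. x = j + hscal (fps_X ^ k) * v) \<longrightarrow> x \<in> J)"

lemma hscal_X_power_nth:
  "fps_nth (hscal (fps_X ^ k) * v) N = (if N < k then 0 else fps_nth v (N - k))"
proof -
  have "hscal (fps_X ^ k) * v = fps_X ^ k * v"
    by (simp add: hscal_power hscal_fps_X)
  then show ?thesis
    by (simp add: fps_X_power_mult_nth)
qed

text \<open>Bridge between congruence modulo \<open>h^k\<close>, which linear maps respect, and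
  coefficients, which can be computed.\<close>

lemma eq_add_hscal_X_power_iff:
  "(\<exists>v. x = j + hscal (fps_X ^ k) * v) \<longleftrightarrow> (\<forall>i<k. fps_nth x i = fps_nth j i)"
proof
  assume "\<forall>i<k. fps_nth x i = fps_nth j i"
  then have "x = j + hscal (fps_X ^ k) * fps_shift k (x - j)"
    by (simp add: fps_eq_iff hscal_X_power_nth)
  then show "\<exists>v. x = j + hscal (fps_X ^ k) * v" ..
qed (auto simp: hscal_X_power_nth)

text \<open>For distinct series the distance is \<open>inverse (2 ^ d)\<close> with \<open>d\<close>
  the subdegree of the difference, so balls are residue classes modulo powers of
  \<open>h\<close>.\<close>

lemma closure_hser_iff:
  fixes A :: "'m :: monoid_add hser set"
  shows "x \<in> closure A \<longleftrightarrow> (\<forall>k. \<exists>j\<in>A. \<exists>v. x = j + hscal (fps_X ^ k) * v)"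
    (is "_ \<longleftrightarrow> ?R")
proof
  assume x: "x \<in> closure A"
  show ?R
  proof
    fix k
    obtain j where j: "j \<in> A" "dist j x < inverse (2 ^ k)"
      using x[unfolded closure_approachable, rule_format, of "inverse (2 ^ k)"] by auto
    have "\<forall>i<k. fps_nth x i = fps_nth j i"
    proof (cases "j = x")
      case False
      with j(2) have "(2::real) ^ k < 2 ^ subdegree (j - x)"
        by (simp add: dist_fps_def field_simps)
      then have "k < subdegree (j - x)"
        by simp
      then show ?thesis
        using nth_less_subdegree_zero[of _ "j - x"] by auto
    qed auto
    with j(1) show "\<exists>j\<in>A. \<exists>v. x = j + hscal (fps_X ^ k) * v"
      by (auto simp: eq_add_hscal_X_power_iff)
  qed
next
  assume R: ?R
  show "x \<in> closure A"
    unfolding closure_approachable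
  proof (intro allI impI)
    fix e :: real
    assume "0 < e"
    then obtain k where "(1 / 2 :: real) ^ k < e"
      using real_arch_pow_inv[of e "1 / 2"] by auto
    then have k: "inverse (2 ^ k) < e"
      by (simp add: power_one_over inverse_eq_divide)
    from R obtain j where j: "j \<in> A" "\<forall>i<k. fps_nth x i = fps_nth j i"
      unfolding eq_add_hscal_X_power_iff by blast
    have "dist j x \<le> inverse (2 ^ k)"
    proof (cases "j = x")
      case False
      then have "k \<le> subdegree (j - x)"
        using j(2) by (intro subdegree_geI) auto
      then show ?thesis
        by (simp add: dist_fps_def field_simps)
    qed simp
    with j(1) k show "\<exists>y\<in>A. dist y x < e"
      by force
  qed
qed

lemma closure_hclosed:
  assumes "hclosed J" "A \<subseteq> J"
  shows "closure A \<subseteq> J"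
proof
  fix x
  assume "x \<in> closure A"
  then have "\<forall>k. \<exists>j\<in>J. \<exists>v. x = j + hscal (fps_X ^ k) * v"
    using assms(2) unfolding closure_hser_iff subset_iff Bex_def by meson
  then show "x \<in> J"
    using assms(1) by (simp add: hclosed_def)
qed

lemma hclosed_closure: "hclosed (closure A)"
  unfolding hclosed_def
proof (intro allI impI)
  fix x
  assume *: "\<forall>k. \<exists>j\<in>closure A. \<exists>v. x = j + hscal (fps_X ^ k) * v"
  have "\<exists>j\<in>A. \<forall>i<k. fps_nth x i = fps_nth j i" for k
  proof -
    obtain j where j: "j \<in> closure A" "\<forall>i<k. fps_nth x i = fps_nth j i"
      using * unfolding eq_add_hscal_X_power_iff by auto
    then obtain j' where "j' \<in> A" "\<forall>i<k. fps_nth j i = fps_nth j' i"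
      unfolding closure_hser_iff eq_add_hscal_X_power_iff by meson
    then show ?thesis
      using j(2) by (intro bexI[of _ j']) simp_all
  qed
  then show "x \<in> closure A"
    by (simp add: closure_hser_iff eq_add_hscal_X_power_iff)
qed

text \<open>The \<open>h\<close>-adic topology is Hausdorff. Equality of two linear maps thereby
  becomes membership of their difference in a closed set.\<close>

lemma hclosed_singleton_0: "hclosed {0}"
  unfolding hclosed_def eq_add_hscal_X_power_iff by simp (metis fps_ext fps_zero_nth lessI)

lemma fps_const_sum_expand:
  fixes p :: "'m :: monoid_add \<Rightarrow>\<^sub>0 complex"
  shows "fps_const p = (\<Sum>w\<in>Poly_Mapping.keys p. hscal (fps_const (Poly_Mapping.lookup p w)) * hmon w)"
proof -
  have "fps_const (\<Sum>w\<in>W. Poly_Mapping.single w (Poly_Mapping.lookup p w))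
      = (\<Sum>w\<in>W. hscal (fps_const (Poly_Mapping.lookup p w)) * hmon w)" for W
    by (induction W rule: infinite_finite_induct)
      (simp_all add: hscal_fps_const hmon_def fps_const_mult mult_single flip: fps_const_add)
  then show ?thesis
    using poly_mapping_expand[of "Poly_Mapping.keys p" p] by (metis finite_keys order_refl)
qed

text \<open>\<open>\<complex>[[h]]\<close>-linearity alone implies \<open>h\<close>-adic continuity, because \<open>\<phi> (h\<^sup>k u) = h\<^sup>k \<phi> u\<close>.\<close>

lemma hlin_mem:
  assumes \<phi>: "hlin \<phi>" and J: "hclosed J" "0 \<in> J"
    "\<And>a b. a \<in> J \<Longrightarrow> b \<in> J \<Longrightarrow> a + b \<in> J" "\<And>c a. a \<in> J \<Longrightarrow> hscal c * a \<in> J"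
    and mon: "\<And>N w. w \<in> Poly_Mapping.keys (fps_nth u N) \<Longrightarrow> \<phi> (hmon w) \<in> J"
  shows "\<phi> u \<in> J"
proof -
  have sumJ: "sum f A \<in> J" if "\<And>a. a \<in> A \<Longrightarrow> f a \<in> J" for f and A :: "'a set"
    using that by (induction A rule: infinite_finite_induct) (auto intro: J)
  have "\<exists>j\<in>J. \<exists>v. \<phi> u = j + hscal (fps_X ^ k) * v" for k
    using mon
  proof (induction k arbitrary: u)
    case 0
    then show ?case
      using J(2) by (intro bexI[of _ 0]) auto
  next
    case (Suc k)
    \<comment> \<open>The tail is known modulo \<open>h^k\<close> by induction, hence modulo
      \<open>h^(k+1)\<close> after multiplication by \<open>h\<close>; the constant term is a finite
      combination of basis elements.\<close>
    have "\<exists>j\<in>J. \<exists>v. \<phi> (fps_shift 1 u) = j + hscal (fps_X ^ k) * v"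
      using Suc.prems by (intro Suc.IH) auto
    then obtain j v where jv: "j \<in> J" "\<phi> (fps_shift 1 u) = j + hscal (fps_X ^ k) * v"
      by blast
    let ?p = "fps_nth u 0"
    have "\<phi> (fps_const ?p)
        = (\<Sum>w\<in>Poly_Mapping.keys ?p. hscal (fps_const (Poly_Mapping.lookup ?p w)) * \<phi> (hmon w))"
      by (subst fps_const_sum_expand) (simp add: hlin_sum[OF \<phi>] hlin_scal[OF \<phi>])
    also have "\<dots> \<in> J"
      using Suc.prems by (intro sumJ J) auto
    finally have p: "\<phi> (fps_const ?p) \<in> J" .
    have "u = fps_const ?p + hscal fps_X * fps_shift 1 u"
      by (simp add: fps_eq_iff hscal_fps_X)
    then have "\<phi> u = \<phi> (fps_const ?p) + hscal fps_X * \<phi> (fps_shift 1 u)"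
      using hlin_add[OF \<phi>, of "fps_const ?p" "hscal fps_X * fps_shift 1 u"]
      by (simp add: hlin_scal[OF \<phi>])
    also have "\<dots> = (\<phi> (fps_const ?p) + hscal fps_X * j) + hscal (fps_X ^ Suc k) * v"
      using jv(2) by (simp add: distrib_left hscal_mult mult.assoc add.assoc)
    finally show ?case
      using p jv(1) J by blast
  qed
  then show ?thesis
    using J(1) by (simp add: hclosed_def)
qed

text \<open>The restriction to words occurring in \<open>u\<close> serves identities that hold only
  for words over a given alphabet.\<close>

lemma hlin_eqI_supp:
  assumes "hlin \<phi>" "hlin \<psi>"
    and "\<And>N w. w \<in> Poly_Mapping.keys (fps_nth u N) \<Longrightarrow> \<phi> (hmon w) = \<psi> (hmon w)"
  shows "\<phi> u = \<psi> u"
  using hlin_mem[OF hlin_minus[OF assms(1,2)] hclosed_singleton_0, of u] assms(3) by simp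

lemma hlin_eqI:
  assumes "hlin \<phi>" "hlin \<psi>" "\<And>w. \<phi> (hmon w) = \<psi> (hmon w)"
  shows "\<phi> u = \<psi> u"
  using assms by (rule hlin_eqI_supp)

section \<open>Linear extension from the monoid basis\<close>

lemma hlin_hext: "hlin (hext f)"
proof -
  \<comment> \<open>\<open>Q p k\<close> is the coefficient of \<open>h^k\<close> in the value at
    the constant series \<open>p\<close>.\<close>
  define Q where "Q p k = (\<Sum>w\<in>Poly_Mapping.keys p.
    Poly_Mapping.single 0 (Poly_Mapping.lookup p w) * fps_nth (f w) k)" for p k
  \<comment> \<open>Keys can cancel in a sum, so sums over the keys of different arguments are
    compared on a common finite superset.\<close>
  have Q_eq: "Q p k = (\<Sum>w\<in>W. Poly_Mapping.single 0 (Poly_Mapping.lookup p w) * fps_nth (f w) k)"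
    if "finite W" "Poly_Mapping.keys p \<subseteq> W" for p k W
    unfolding Q_def using that by (intro sum.mono_neutral_left) (auto simp: in_keys_iff)
  have Q_add: "Q (p + r) k = Q p k + Q r k" for p r k
  proof -
    let ?W = "Poly_Mapping.keys p \<union> Poly_Mapping.keys r"
    have "finite ?W" "Poly_Mapping.keys (p + r) \<subseteq> ?W"
      by (auto simp: Poly_Mapping.keys_add)
    then show ?thesis
      by (simp add: Q_eq[of ?W] lookup_add single_add distrib_right sum.distrib)
  qed
  have Q_0: "Q 0 k = 0" for k
    by (simp add: Q_def)
  have Q_sum: "Q (sum g A) k = (\<Sum>a\<in>A. Q (g a) k)" for g :: "nat \<Rightarrow> _" and A k
    by (induction A rule: infinite_finite_induct) (simp_all add: Q_add Q_0)
  have Q_scal: "Q (Poly_Mapping.single 0 z * p) k = Poly_Mapping.single 0 z * Q p k" for z p k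
  proof -
    have look: "Poly_Mapping.lookup (Poly_Mapping.single 0 z * p) w = z * Poly_Mapping.lookup p w" for w
      by (simp flip: mult_map_scale_conv_mult add: Poly_Mapping.map.rep_eq when_def)
    then have "Poly_Mapping.keys (Poly_Mapping.single 0 z * p) \<subseteq> Poly_Mapping.keys p"
      by (auto simp: in_keys_iff)
    then show ?thesis
      by (simp add: Q_eq[of "Poly_Mapping.keys p"] look sum_distrib_left mult.assoc[symmetric] mult_single)
  qed
  have ext: "fps_nth (hext f u) N = (\<Sum>i=0..N. Q (fps_nth u i) (N - i))" for u N
    by (simp add: lin_ext_def Q_def atLeast0AtMost)
  show ?thesis
  proof (rule hlinI)
    show "hext f (u + v) = hext f u + hext f v" for u v
      by (simp add: fps_eq_iff ext Q_add sum.distrib)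
    show "hext f (hscal c * u) = hscal c * hext f u" for c u
    proof (rule fps_ext)
      fix N
      have "fps_nth (hext f (hscal c * u)) N
          = (\<Sum>j=0..N. \<Sum>i=0..j. Poly_Mapping.single 0 (fps_nth c i) * Q (fps_nth u (j - i)) (N - j))"
        by (simp add: ext fps_mult_nth Q_sum Q_scal)
      \<comment> \<open>The same regrouping of three indices with fixed sum as in the associativity
        of the Cauchy product.\<close>
      also have "\<dots> = (\<Sum>j=0..N. \<Sum>i=0..N - j. Poly_Mapping.single 0 (fps_nth c j) * Q (fps_nth u i) (N - j - i))"
        by (rule fps_mult_assoc_lemma)
      also have "\<dots> = fps_nth (hscal c * hext f u) N"
        by (simp add: ext fps_mult_nth sum_distrib_left)
      finally show "fps_nth (hext f (hscal c * u)) N = fps_nth (hscal c * hext f u) N" .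
    qed
  qed
qed

lemma hext_hmon [simp]: "hext f (hmon w) = f w"
proof (rule fps_ext)
  fix N
  have "(\<Sum>v\<in>Poly_Mapping.keys (fps_nth (hmon w) i).
        Poly_Mapping.single 0 (Poly_Mapping.lookup (fps_nth (hmon w) i) v) * fps_nth (f v) (N - i))
      = (if i = 0 then fps_nth (f w) N else 0)" for i
    by (simp add: hmon_def)
  then show "fps_nth (hext f (hmon w)) N = fps_nth (f w) N"
    by (simp add: lin_ext_def)
qed

lemma hext_1 [simp]:
  fixes f :: "'m :: monoid_add \<Rightarrow> 'k :: monoid_add hser"
  shows "hext f 1 = f 0"
  using hext_hmon[of f 0] by simp

lemma hscal_cext: "hscal (cext f u) = hext (\<lambda>w. hscal (f w)) u"
  by (simp add: fps_eq_iff lin_ext_def sum_single mult_single)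

text \<open>Linearity carries the hypothesis from basis elements to series, first in the right
  factor and then in the left one.\<close>

lemma hext_mult:
  assumes "\<And>v w. f (v + w) = f v * f w"
  shows "hext f (a * b) = hext f a * hext f b"
proof -
  have *: "hext f (hmon v * b) = f v * hext f b" for v b
  proof (rule hlin_eqI[of "\<lambda>b. hext f (hmon v * b)" "\<lambda>b. f v * hext f b"])
    show "hlin (\<lambda>b. hext f (hmon v * b))"
      by (rule hlin_comp[OF hlin_hext hlin_lmult[OF hlin_id]])
    show "hlin (\<lambda>b. f v * hext f b)"
      by (rule hlin_lmult[OF hlin_hext])
    show "hext f (hmon v * hmon w) = f v * hext f (hmon w)" for w
      by (simp add: assms flip: hmon_add)
  qed
  show ?thesis
  proof (rule hlin_eqI[of "\<lambda>a. hext f (a * b)" "\<lambda>a. hext f a * hext f b"])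
    show "hlin (\<lambda>a. hext f (a * b))"
      by (rule hlin_comp[OF hlin_hext hlin_rmult[OF hlin_id]])
    show "hlin (\<lambda>a. hext f a * hext f b)"
      by (rule hlin_rmult[OF hlin_hext])
  qed (simp add: *)
qed

text \<open>Makes the action linear in the acting element, which enters only through the values on
  words.\<close>

lemma hlin_hext_param:
  fixes f :: "'m :: monoid_add \<Rightarrow> 'j :: monoid_add hser \<Rightarrow> 'k :: monoid_add hser"
  assumes "\<And>w. hlin (\<lambda>x. f w x)"
  shows "hlin (\<lambda>x. hext (\<lambda>w. f w x) a)"
proof (rule hlinI)
  show "hext (\<lambda>w. f w (u + v)) a = hext (\<lambda>w. f w u) a + hext (\<lambda>w. f w v) a" for u v
    by (rule hlin_eqI[where u = a]) (auto intro!: hlin_plus hlin_hext simp: hlin_add[OF assms])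
  show "hext (\<lambda>w. f w (hscal c * u)) a = hscal c * hext (\<lambda>w. f w u) a" for c u
    by (rule hlin_eqI[where u = a]) (auto intro!: hlin_lmult hlin_hext simp: hlin_scal[OF assms])
qed

section \<open>The Hopf structure on the generators\<close>

text \<open>As simplification rules these turn \<open>single 0 (of_int s)\<close> into
  \<open>of_int s\<close>, a form on which \<open>mult_single\<close> no longer fires.\<close>

declare single_of_int [simp del] single_of_nat [simp del]

lemma letters_0 [simp]: "letters 0 = []"
  by (simp add: zero_word_def)

lemma letters_add [simp]: "letters (v + w) = letters v @ letters w"
  by (simp add: plus_word_def)

lemma hmon_Nil [simp]: "hmon (Word []) = 1"
  by (metis hmon_0 zero_word_def)

lemma hmon_Cons: "hmon (Word (x # xs)) = gen x * hmon (Word xs)"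
  by (simp add: gen_def plus_word_def flip: hmon_add)

lemma hext_mult_words:
  "hext (\<lambda>w. prod_list (map g (letters w))) (a * b)
    = hext (\<lambda>w. prod_list (map g (letters w))) a * hext (\<lambda>w. prod_list (map g (letters w))) b"
  by (rule hext_mult) simp

lemma hext_gen [simp]: "hext f (gen x) = f (Word [x])"
  by (simp add: gen_def)

lemma hext_mult_anti:
  assumes "\<And>v w. f (v + w) = f w * f v"
  shows "hext f (a * b) = hext f b * hext f a"
proof -
  have *: "hext f (hmon v * b) = hext f b * f v" for v b
  proof (rule hlin_eqI[of "\<lambda>b. hext f (hmon v * b)" "\<lambda>b. hext f b * f v"])
    show "hlin (\<lambda>b. hext f (hmon v * b))"
      by (rule hlin_comp[OF hlin_hext hlin_lmult[OF hlin_id]])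
    show "hlin (\<lambda>b. hext f b * f v)"
      by (rule hlin_rmult[OF hlin_hext])
    show "hext f (hmon v * hmon w) = hext f (hmon w) * f v" for w
      by (simp add: assms flip: hmon_add)
  qed
  show ?thesis
  proof (rule hlin_eqI[of "\<lambda>a. hext f (a * b)" "\<lambda>a. hext f b * hext f a"])
    show "hlin (\<lambda>a. hext f (a * b))"
      by (rule hlin_comp[OF hlin_hext hlin_rmult[OF hlin_id]])
    show "hlin (\<lambda>a. hext f b * hext f a)"
      by (rule hlin_lmult[OF hlin_hext])
  qed (simp add: *)
qed

section \<open>The completed tensor product\<close>

lemma hlin_pair_eqI:
  assumes "hlin \<phi>" "hlin \<psi>" "\<And>u v. \<phi> (hmon (u, v)) = \<psi> (hmon (u, v))"
  shows "\<phi> x = \<psi> x"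
proof (rule hlin_eqI[OF assms(1,2)])
  show "\<phi> (hmon w) = \<psi> (hmon w)" for w
    using assms(3) by (cases w) simp
qed

lemma hlin_tensor_left: "hlin (\<lambda>u. u \<otimes>\<^sub>h v)"
  unfolding tensor_def by (rule hlin_rmult[OF hlin_hext])

lemma hlin_tensor_right: "hlin (\<lambda>v. u \<otimes>\<^sub>h v)"
  unfolding tensor_def by (rule hlin_lmult[OF hlin_hext])

lemma hmon_tensor_hmon: "hmon u \<otimes>\<^sub>h hmon v = hmon (u, v)"
  by (simp add: tensor_def flip: hmon_add)

text \<open>Universal property of the tensor product: a bilinear map is recovered from its values on
  pairs of words. It evaluates expressions in \<open>x_(1)\<close> and \<open>x_(2)\<close> once the
  coproduct is a sum of pure tensors.\<close>

lemma hext_tensor: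
  assumes "\<And>y. hlin (\<lambda>x. B x y)" "\<And>x. hlin (\<lambda>y. B x y)"
  shows "hext (\<lambda>(u, v). B (hmon u) (hmon v)) (x \<otimes>\<^sub>h y) = B x y"
proof -
  have 1: "hext (\<lambda>(u, v). B (hmon u) (hmon v)) (hmon u \<otimes>\<^sub>h y) = B (hmon u) y" for u
    by (rule hlin_eqI[where \<phi> = "\<lambda>y. hext (\<lambda>(u, v). B (hmon u) (hmon v)) (hmon u \<otimes>\<^sub>h y)"
          and \<psi> = "B (hmon u)", OF hlin_comp[OF hlin_hext hlin_tensor_right] assms(2)])
      (simp add: hmon_tensor_hmon)
  show ?thesis
    by (rule hlin_eqI[where \<phi> = "\<lambda>x. hext (\<lambda>(u, v). B (hmon u) (hmon v)) (x \<otimes>\<^sub>h y)"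
          and \<psi> = "\<lambda>x. B x y", OF hlin_comp[OF hlin_hext hlin_tensor_left] assms(1)]) (rule 1)
qed

section \<open>Exponentials\<close>

lemma hexp_truncate:
  "\<exists>v. hexp p = (\<Sum>N<k. hscal (fps_const (1 / fact N) * fps_X ^ N) * fps_const (p ^ N))
    + hscal (fps_X ^ k) * v"
  unfolding eq_add_hscal_X_power_iff
proof (intro allI impI)
  fix i
  assume "i < k"
  have "fps_nth (hscal (fps_const (1 / fact N) * fps_X ^ N) * fps_const (p ^ N)) i
      = (if N = i then Poly_Mapping.single 0 (1 / fact i) * p ^ i else 0)" for N
    by (auto simp: fps_mult_right_const_nth)
  then show "fps_nth (hexp p) i
      = fps_nth (\<Sum>N<k. hscal (fps_const (1 / fact N) * fps_X ^ N) * fps_const (p ^ N)) i"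
    using \<open>i < k\<close> by (simp add: hexp_def fps_sum_nth)
qed

text \<open>The exponential is an infinite sum, so the map is applied to its truncations modulo
  powers of \<open>h\<close>. The factor \<open>a\<close> admits maps that are not multiplicative,
  such as a single matrix entry of a representation.\<close>

lemma hlin_hexp:
  assumes \<phi>: "hlin \<phi>" and p: "\<And>N. \<phi> (fps_const (p ^ N)) = fps_const (r ^ N) * a"
  shows "\<phi> (hexp p) = hexp r * a"
proof (rule fps_ext)
  fix i
  define T where "T N = hscal (fps_const (1 / fact N) * fps_X ^ N)" for N
  obtain v where v: "hexp p = (\<Sum>N<Suc i. hscal (fps_const (1 / fact N) * fps_X ^ N) * fps_const (p ^ N))
      + hscal (fps_X ^ Suc i) * v"
    using hexp_truncate by blast
  obtain v' where v': "hexp r = (\<Sum>N<Suc i. hscal (fps_const (1 / fact N) * fps_X ^ N) * fps_const (r ^ N))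
      + hscal (fps_X ^ Suc i) * v'"
    using hexp_truncate by blast
  have "\<phi> (hexp p) = (\<Sum>N<Suc i. hscal (fps_const (1 / fact N) * fps_X ^ N) * (fps_const (r ^ N) * a))
      + hscal (fps_X ^ Suc i) * \<phi> v"
    unfolding v by (simp only: hlin_add[OF \<phi>] hlin_sum[OF \<phi>] hlin_scal[OF \<phi>] p)
  also have "\<dots> = hexp r * a + hscal (fps_X ^ Suc i) * (\<phi> v - v' * a)"
    unfolding v' by (simp only: distrib_right sum_distrib_right mult.assoc right_diff_distrib) simp
  finally have "\<exists>v. \<phi> (hexp p) = hexp r * a + hscal (fps_X ^ Suc i) * v"
    by blast
  then show "fps_nth (\<phi> (hexp p)) i = fps_nth (hexp r * a) i"
    unfolding eq_add_hscal_X_power_iff by simp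
qed

lemma hexp_nth: "fps_nth (hexp p) N = Poly_Mapping.single 0 (1 / fact N) * p ^ N"
  by (simp add: hexp_def)

lemma single_of_nat_mult_cancel:
  fixes p :: "'m :: monoid_add \<Rightarrow>\<^sub>0 complex"
  shows "Poly_Mapping.single 0 (1 / of_nat (Suc N)) * (of_nat (Suc N) * p) = p"
proof -
  have "Poly_Mapping.single 0 (1 / of_nat (Suc N)) * (Poly_Mapping.single 0 (of_nat (Suc N)) * p) = p"
    unfolding mult.assoc[symmetric] mult_single by (simp del: of_nat_Suc)
  then show ?thesis
    by (simp only: single_of_nat)
qed

lemma hexp_Suc_nth: "of_nat (Suc N) * fps_nth (hexp p) (Suc N) = p * fps_nth (hexp p) N"
proof -
  have "of_nat (Suc N) * fps_nth (hexp p) (Suc N)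
      = Poly_Mapping.single 0 (of_nat (Suc N)) * Poly_Mapping.single 0 (1 / fact (Suc N)) * p ^ Suc N"
    by (simp only: hexp_nth single_of_nat mult.assoc)
  also have "\<dots> = Poly_Mapping.single 0 (1 / fact N) * p ^ Suc N"
    by (simp add: mult_single fact_Suc del: of_nat_Suc power_Suc)
  also have "\<dots> = p * fps_nth (hexp p) N"
    by (simp add: hexp_nth mult.assoc single_0_commute power_commutes)
  finally show ?thesis .
qed

text \<open>The differential equation is a recursion for the coefficients, in which
  \<open>N + 1\<close> can be cancelled because it is an invertible scalar.\<close>

lemma hexp_unique:
  assumes "fps_nth y 0 = 1" "fps_deriv y = fps_const p * y"
  shows "y = hexp p"
proof (rule fps_ext)
  fix N
  show "fps_nth y N = fps_nth (hexp p) N"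
  proof (induction N)
    case 0
    then show ?case
      by (simp add: hexp_nth assms(1))
  next
    case (Suc N)
    have "of_nat (Suc N) * fps_nth y (Suc N) = p * fps_nth y N"
      using arg_cong[OF assms(2), of "\<lambda>f. fps_nth f N"] by simp
    also have "\<dots> = of_nat (Suc N) * fps_nth (hexp p) (Suc N)"
      by (simp only: Suc hexp_Suc_nth)
    finally show ?case
      by (metis single_of_nat_mult_cancel)
  qed
qed

lemma hexp_deriv: "fps_deriv (hexp p) = fps_const p * hexp p"
proof (rule fps_ext)
  fix N
  show "fps_nth (fps_deriv (hexp p)) N = fps_nth (fps_const p * hexp p) N"
    using hexp_Suc_nth[of N p] by simp
qed

lemma hexp_commute:
  assumes "p * q = q * p"
  shows "hexp p * fps_const q = fps_const q * hexp p"
proof (rule fps_ext)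
  fix N
  have "p ^ N * q = q * p ^ N"
    using assms by (simp add: power_commuting_commutes)
  then show "fps_nth (hexp p * fps_const q) N = fps_nth (fps_const q * hexp p) N"
    by (simp add: hexp_nth mult.assoc) (simp add: single_0_commute mult.assoc)
qed

text \<open>Both sides solve \<open>y' = (p + q) y\<close> with constant term 1; commutation moves
  \<open>q\<close> past \<open>hexp p\<close> in the derivative of the product.\<close>

lemma hexp_add:
  assumes "p * q = q * p"
  shows "hexp (p + q) = hexp p * hexp q"
proof (rule hexp_unique[symmetric])
  show "fps_nth (hexp p * hexp q) 0 = 1"
    by (simp add: hexp_nth)
  have "fps_deriv (hexp p * hexp q) = hexp p * fps_const q * hexp q + fps_const p * hexp p * hexp q"
    by (simp add: hexp_deriv mult.assoc)
  then show "fps_deriv (hexp p * hexp q) = fps_const (p + q) * (hexp p * hexp q)"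
    by (simp add: hexp_commute[OF assms] mult.assoc distrib_right add.commute flip: fps_const_add)
qed

lemma hexp_0 [simp]: "hexp 0 = 1"
  by (rule hexp_unique[symmetric]) auto

lemma hexp_single_0: "hexp (Poly_Mapping.single 0 z) = hscal (fps_exp z)"
proof (rule hexp_unique[symmetric])
  show "fps_deriv (hscal (fps_exp z)) = fps_const (Poly_Mapping.single 0 z) * hscal (fps_exp z)"
  proof (rule fps_ext)
    fix N
    have "fps_nth (fps_deriv (hscal (fps_exp z))) N
        = Poly_Mapping.single 0 (of_nat (Suc N)) * Poly_Mapping.single 0 (z ^ Suc N / fact (Suc N))"
      by (simp add: single_of_nat fps_exp_nth del: of_nat_Suc power_Suc fact_Suc)
    also have "\<dots> = fps_nth (fps_const (Poly_Mapping.single 0 z) * hscal (fps_exp z)) N"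
      by (simp add: mult_single field_simps del: of_nat_Suc)
    finally show "fps_nth (fps_deriv (hscal (fps_exp z))) N
      = fps_nth (fps_const (Poly_Mapping.single 0 z) * hscal (fps_exp z)) N" .
  qed
qed simp

lemma hom_hexp:
  assumes "hlin \<phi>" "\<And>a b. \<phi> (a * b) = \<phi> a * \<phi> b" "\<phi> 1 = 1" "\<phi> (fps_const p) = fps_const r"
  shows "\<phi> (hexp p) = hexp r"
proof -
  have "\<phi> (fps_const p ^ N) = fps_const r ^ N" for N
    by (induction N) (simp_all add: assms del: fps_const_power)
  then show ?thesis
    using hlin_hexp[OF assms(1), of p r 1] by simp
qed

section \<open>Coproduct, counit and antipode on generators and on the elements
  \<open>K_i^s\<close>\<close>

definition uKlog :: "int \<Rightarrow> nat \<Rightarrow> ugen word \<Rightarrow>\<^sub>0 complex"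
  where "uKlog s i = Poly_Mapping.single (Word [UH i]) (of_int s)
                     - Poly_Mapping.single (Word [UH (Suc i)]) (of_int s)"

lemma uK_eq: "uK s i = hexp (uKlog s i)"
  by (simp add: uK_def uKlog_def)

lemma hscal_of_int: "hscal (of_int s) = fps_const (Poly_Mapping.single 0 (of_int s))"
  by (simp add: hscal_fps_const flip: fps_of_int)

lemma fps_const_uKlog:
  "fps_const (uKlog s i) = hscal (of_int s) * (gen (UH i) - gen (UH (Suc i)))"
  by (simp add: uKlog_def gen_def hmon_def mult_single right_diff_distrib hscal_of_int flip: fps_const_sub)

lemma uK_0 [simp]: "uK 0 i = 1"
  by (simp add: uK_def)

lemma hlin_coprod: "hlin coprod"
  unfolding coprod_def by (rule hlin_hext)

lemma coprod_1 [simp]: "coprod 1 = 1"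
  by (simp add: coprod_def)

lemma coprod_mult: "coprod (x * y) = coprod x * coprod y"
  unfolding coprod_def by (rule hext_mult_words)

lemma coprod_gen_eq: "coprod (gen g) = coprod_gen g"
  by (simp add: coprod_def)

text \<open>The exponent is primitive: its coproduct is the sum of its copies \<open>p1\<close> and
  \<open>p2\<close> in the two tensor factors. These commute, so the exponential of the sum
  splits.\<close>

lemma coprod_uK: "coprod (uK s i) = uK s i \<otimes>\<^sub>h uK s i"
proof -
  let ?z = "of_int s :: complex"
  define p1 :: "ugen word \<times> ugen word \<Rightarrow>\<^sub>0 complex" where
    "p1 = Poly_Mapping.single (Word [UH i], 0) ?z - Poly_Mapping.single (Word [UH (Suc i)], 0) ?z"
  define p2 :: "ugen word \<times> ugen word \<Rightarrow>\<^sub>0 complex" where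
    "p2 = Poly_Mapping.single (0, Word [UH i]) ?z - Poly_Mapping.single (0, Word [UH (Suc i)]) ?z"
  have i1: "hext (\<lambda>w. hmon (w, 0)) (fps_const (uKlog s i)) = fps_const p1"
    by (simp add: fps_const_uKlog hlin_scal[OF hlin_hext] hlin_diff[OF hlin_hext])
      (simp add: hscal_of_int p1_def hmon_def mult_single right_diff_distrib flip: zero_prod_def fps_const_sub)
  have i2: "hext (\<lambda>w. hmon (0, w)) (fps_const (uKlog s i)) = fps_const p2"
    by (simp add: fps_const_uKlog hlin_scal[OF hlin_hext] hlin_diff[OF hlin_hext])
      (simp add: hscal_of_int p2_def hmon_def mult_single right_diff_distrib flip: zero_prod_def fps_const_sub)
  have t1: "x \<otimes>\<^sub>h 1 = hext (\<lambda>w. hmon (w, 0)) x" for x :: "ugen word hser"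
    by (simp add: tensor_def flip: zero_prod_def)
  have t2: "1 \<otimes>\<^sub>h x = hext (\<lambda>w. hmon (0, w)) x" for x :: "ugen word hser"
    by (simp add: tensor_def flip: zero_prod_def)
  have "coprod (fps_const (uKlog s i)) = fps_const (p1 + p2)"
  proof -
    have "coprod (fps_const (uKlog s i))
        = hext (\<lambda>w. hmon (w, 0)) (fps_const (uKlog s i)) + hext (\<lambda>w. hmon (0, w)) (fps_const (uKlog s i))"
      by (simp add: fps_const_uKlog hlin_scal[OF hlin_coprod] hlin_diff[OF hlin_coprod] coprod_gen_eq
          hlin_scal[OF hlin_hext] hlin_diff[OF hlin_hext] t1 t2 distrib_left right_diff_distrib)
    then show ?thesis
      by (simp add: i1 i2)
  qed
  then have "coprod (uK s i) = hexp (p1 + p2)"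
    unfolding uK_eq by (intro hom_hexp hlin_coprod coprod_mult coprod_1)
  also have "\<dots> = hexp p1 * hexp p2"
    by (rule hexp_add) (simp add: p1_def p2_def left_diff_distrib right_diff_distrib mult_single mult.commute)
  also have "hexp p1 = hext (\<lambda>w. hmon (w, 0)) (uK s i)"
    unfolding uK_eq by (rule sym, intro hom_hexp hlin_hext hext_mult i1) (simp_all flip: hmon_add zero_prod_def)
  also have "hexp p2 = hext (\<lambda>w. hmon (0, w)) (uK s i)"
    unfolding uK_eq by (rule sym, intro hom_hexp hlin_hext hext_mult i2) (simp_all flip: hmon_add zero_prod_def)
  finally show ?thesis
    by (simp add: tensor_def)
qed

text \<open>\<open>\<Delta>(g) = g \<otimes> K\<^sub>i\<^sup>r + K\<^sub>i\<^sup>l \<otimes> g\<close> with \<open>i\<close>, \<open>l\<close>, \<open>r\<close> the three functions below.\<close>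

fun gidx :: "ugen \<Rightarrow> nat"
  where "gidx (UH i) = i" | "gidx (UE i) = i" | "gidx (UF i) = i"

fun lwt :: "ugen \<Rightarrow> int"
  where "lwt (UH i) = 0" | "lwt (UE i) = 1" | "lwt (UF i) = 0"

fun rwt :: "ugen \<Rightarrow> int"
  where "rwt (UH i) = 0" | "rwt (UE i) = 0" | "rwt (UF i) = - 1"

lemma coprod_gen_twisted:
  "coprod (gen g) = gen g \<otimes>\<^sub>h uK (rwt g) (gidx g) + uK (lwt g) (gidx g) \<otimes>\<^sub>h gen g"
  by (cases g) (simp_all add: coprod_gen_eq)

text \<open>
  Primed versions are composed with \<^const>\<open>hscal\<close>, which turns scalar-valued linear maps into
  instances of \<^const>\<open>hlin\<close>; their target monoid is arbitrary.
\<close>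

definition counit' :: "ugen word hser \<Rightarrow> 'k :: monoid_add hser"
  where "counit' x = hscal (counit x)"

lemma hscal_prod_list_0: "hscal (prod_list (map (\<lambda>g. 0) xs)) = prod_list (map (\<lambda>g. 0) xs)"
  by (induction xs) simp_all

lemma counit'_eq: "counit' = hext (\<lambda>w. prod_list (map (\<lambda>g. 0) (letters w)))"
  by (intro ext) (simp add: counit'_def counit_def hscal_cext hscal_prod_list_0)

lemma hlin_counit': "hlin counit'"
  unfolding counit'_eq by (rule hlin_hext)

lemma counit'_mult: "counit' (x * y) = counit' x * counit' y"
  unfolding counit'_eq by (rule hext_mult_words)

lemma counit'_1: "counit' 1 = 1"
  by (simp add: counit'_eq)

lemma counit'_gen: "counit' (gen g) = 0"
  by (simp add: counit'_eq)

lemma counit'_uK: "counit' (uK s i) = 1"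
proof -
  have "counit' (hexp (uKlog s i)) = hexp 0"
    by (intro hom_hexp hlin_counit' counit'_mult counit'_1)
      (simp add: fps_const_uKlog hlin_scal[OF hlin_counit'] hlin_diff[OF hlin_counit'] counit'_gen)
  then show ?thesis
    by (simp add: uK_eq)
qed

lemma hlin_antipode: "hlin antipode"
  unfolding antipode_def by (rule hlin_hext)

lemma antipode_mult: "antipode (x * y) = antipode y * antipode x"
  unfolding antipode_def by (rule hext_mult_anti) simp

lemma antipode_1: "antipode 1 = 1"
  by (simp add: antipode_def)

text \<open>The antipode negates the exponent, and on powers of a single element an antihomomorphism
  acts like a homomorphism.\<close>

lemma antipode_uK: "antipode (uK s i) = uK (- s) i"
proof -
  have gen: "antipode (gen (UH j)) = - gen (UH j)" for j
    by (simp add: antipode_def)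
  have "uKlog (- s) i = - uKlog s i"
    by (simp add: uKlog_def single_uminus)
  then have 1: "antipode (fps_const (uKlog s i)) = fps_const (uKlog (- s) i)"
    by (simp add: fps_const_uKlog hlin_scal[OF hlin_antipode] hlin_diff[OF hlin_antipode] gen
        right_diff_distrib flip: fps_const_neg)
  have "antipode (fps_const (uKlog s i) ^ N) = fps_const (uKlog (- s) i) ^ N" for N
    by (induction N) (simp_all add: antipode_1 antipode_mult 1 power_commutes del: fps_const_power)
  then have "antipode (hexp (uKlog s i)) = hexp (uKlog (- s) i) * 1"
    by (intro hlin_hexp hlin_antipode) simp
  then show ?thesis
    by (simp add: uK_eq)
qed

text \<open>With \<open>l\<close> and \<open>r\<close> the two weights of \<open>g\<close>, this is
  the solution of the antipode axiom \<open>\<gamma>(g) K^r + K^(-l) g = 0\<close>.\<close>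

lemma antipode_gen_twisted:
  "antipode (gen g) = - (uK (- lwt g) (gidx g) * gen g * uK (- rwt g) (gidx g))"
  by (cases g) (simp_all add: antipode_def)

text \<open>The diagonal entries of \<open>\<rho>(K\<^sub>i\<^sup>s)\<close>.\<close>

definition kap :: "int \<Rightarrow> nat \<Rightarrow> nat \<Rightarrow> complex fps"
  where "kap s i r = qpow (s * (of_bool (r = i) - of_bool (r = Suc i)))"

lemma qpow_0 [simp]: "qpow 0 = 1"
  by (simp add: qpow_def)

lemma qpow_add: "qpow (s + t) = qpow s * qpow t"
  by (simp add: qpow_def fps_exp_add_mult)

section \<open>The vector representation\<close>

definition rho' :: "nat \<Rightarrow> nat \<Rightarrow> nat \<Rightarrow> ugen word hser \<Rightarrow> 'k :: monoid_add hser"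
  where "rho' n r c x = hscal (rho n x r c)"

lemma rho'_eq: "rho' n r c
    = hext (\<lambda>w. hscal (foldr (\<lambda>g A. mmul {1..n} (rho_gen g) A) (letters w) idm r c))"
  by (auto simp: rho'_def rho_def hscal_cext)

lemma hlin_rho': "hlin (rho' n r c)"
  unfolding rho'_eq by (rule hlin_hext)

lemma mmul_assoc: "mmul I (mmul I A B) C = mmul I A (mmul I B C)"
  unfolding mmul_def
  by (intro ext) (simp add: sum_distrib_left sum_distrib_right mult.assoc, rule sum.swap)

lemma foldr_mmul_idm:
  fixes A :: "'g \<Rightarrow> ('i, complex fps) matr"
  assumes "finite I" "r \<in> I" "c \<in> I"
  shows "foldr (\<lambda>g. mmul I (A g)) (xs @ ys) idm r c
    = (\<Sum>s\<in>I. foldr (\<lambda>g. mmul I (A g)) xs idm r s * foldr (\<lambda>g. mmul I (A g)) ys idm s c)"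
  using assms(2)
proof (induction xs arbitrary: r)
  case Nil
  then show ?case
    using assms(1) by (simp add: idm_def if_distrib[of "\<lambda>x. x * _"] cong: if_cong)
next
  case (Cons x xs)
  then show ?case
    by (simp add: mmul_def sum_distrib_left sum_distrib_right mult.assoc) (rule sum.swap)
qed

lemma rho'_mult:
  fixes x y :: "ugen word hser"
  assumes "r \<in> {1..n}" "c \<in> {1..n}"
  shows "rho' n r c (x * y) = (\<Sum>s\<in>{1..n}. rho' n r s x * rho' n s c y)"
proof -
  have 1: "rho' n r c (hmon u * hmon v) = (\<Sum>s\<in>{1..n}. rho' n r s (hmon u) * rho' n s c (hmon v))" for u v
    using foldr_mmul_idm[OF _ assms, of rho_gen "letters u" "letters v"]
    by (simp add: rho'_eq hscal_sum hscal_mult flip: hmon_add)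
  have 2: "rho' n r c (hmon u * y) = (\<Sum>s\<in>{1..n}. rho' n r s (hmon u) * rho' n s c y)" for u
    by (rule hlin_eqI[OF hlin_comp[OF hlin_rho' hlin_lmult[OF hlin_id]] hlin_sumf 1])
      (rule hlin_lmult[OF hlin_rho'])
  show ?thesis
    by (rule hlin_eqI[OF hlin_comp[OF hlin_rho' hlin_rmult[OF hlin_id]] hlin_sumf 2])
      (rule hlin_rmult[OF hlin_rho'])
qed

lemma rho'_1: "rho' n r c 1 = hscal (idm r c)"
  by (simp add: rho'_eq)

lemma rho'_gen: "c \<in> {1..n} \<Longrightarrow> rho' n r c (gen g) = hscal (rho_gen g r c)"
  by (simp add: rho'_eq mmul_def idm_def if_distrib[of "\<lambda>x. _ * x"] cong: if_cong)

text \<open>The exponent acts as a diagonal matrix with entries \<open>z r\<close>. So do its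
  powers, and the exponential sum can be taken entry by entry.\<close>

lemma rho'_uK:
  assumes r: "r \<in> {1..n}" and c: "c \<in> {1..n}"
  shows "(rho' n r c (uK s i) :: 'k :: monoid_add hser) = hscal (idm r c * kap s i r)"
proof -
  define z :: "nat \<Rightarrow> complex" where "z r = of_int (s * (of_bool (r = i) - of_bool (r = Suc i)))" for r
  let ?u = "fps_const (uKlog s i)" and ?z = "\<lambda>r. fps_const (Poly_Mapping.single 0 (z r))"
  have 1: "rho' n r t ?u = ?z r * hscal (idm r t)" if "r \<in> {1..n}" "t \<in> {1..n}" for r t
    using that unfolding fps_const_uKlog hlin_scal[OF hlin_rho'] hlin_diff[OF hlin_rho']
    by (auto simp: rho'_gen munit_def idm_def z_def hscal_of_int single_uminus simp flip: fps_const_neg)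
  have "(rho' n r c (?u ^ N) :: 'k hser) = ?z r ^ N * hscal (idm r c)" for N
  proof (induction N)
    case 0
    then show ?case
      by (simp add: rho'_1)
  next
    case (Suc N)
    have "(rho' n r c (?u ^ Suc N) :: 'k hser) = (\<Sum>t\<in>{1..n}. rho' n r t ?u * rho' n t c (?u ^ N))"
      using r c by (simp only: power_Suc rho'_mult)
    also have "\<dots> = (\<Sum>t\<in>{1..n}. if t = r then ?z r * rho' n r c (?u ^ N) else 0)"
      using r by (intro sum.cong) (auto simp: 1 idm_def simp del: fps_const_power)
    also have "\<dots> = ?z r * rho' n r c (?u ^ N)"
      using r by simp
    also have "\<dots> = ?z r ^ Suc N * hscal (idm r c)"
      by (simp only: Suc.IH mult.assoc power_Suc)
    finally show ?case .
  qed
  then have "(rho' n r c (hexp (uKlog s i)) :: 'k hser) = hexp (Poly_Mapping.single 0 (z r)) * hscal (idm r c)"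
    by (intro hlin_hexp hlin_rho') simp
  then show ?thesis
    by (simp add: uK_eq hexp_single_0 kap_def qpow_def z_def mult.commute[of "idm r c"] flip: hscal_mult)
qed

section \<open>The action on the free algebra\<close>

abbreviation fcar :: "'x set \<Rightarrow> 'x word hser set"
  where "fcar X \<equiv> carrier (free_alg X)"

lemma fcar_iff: "u \<in> fcar X \<longleftrightarrow> (\<forall>N. \<forall>w\<in>Poly_Mapping.keys (fps_nth u N). set (letters w) \<subseteq> X)"
  by (simp add: free_alg_def)

lemma fcar_0 [simp]: "0 \<in> fcar X"
  by (simp add: fcar_iff)

lemma fcar_add: "a \<in> fcar X \<Longrightarrow> b \<in> fcar X \<Longrightarrow> a + b \<in> fcar X"
  using Poly_Mapping.keys_add by (fastforce simp: fcar_iff)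

lemma keys_single_0_mult:
  fixes p :: "'m :: monoid_add \<Rightarrow>\<^sub>0 complex"
  shows "Poly_Mapping.keys (Poly_Mapping.single 0 z * p) \<subseteq> Poly_Mapping.keys p"
  using keys_mult[of "Poly_Mapping.single 0 z" p] by (auto split: if_splits)

lemma fcar_scal: "a \<in> fcar X \<Longrightarrow> hscal c * a \<in> fcar X"
  unfolding fcar_iff
proof (intro allI ballI)
  fix N w
  assume a: "\<forall>N. \<forall>w\<in>Poly_Mapping.keys (fps_nth a N). set (letters w) \<subseteq> X"
    and "w \<in> Poly_Mapping.keys (fps_nth (hscal c * a) N)"
  then obtain i where "w \<in> Poly_Mapping.keys (Poly_Mapping.single 0 (fps_nth c i) * fps_nth a (N - i))"
    using Poly_Mapping.keys_sum[of "\<lambda>i. Poly_Mapping.single 0 (fps_nth c i) * fps_nth a (N - i)" "{0..N}"]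
    by (auto simp: fps_mult_nth)
  then show "set (letters w) \<subseteq> X"
    using a keys_single_0_mult by blast
qed

lemma fcar_hmon: "hmon w \<in> fcar X" if "set (letters w) \<subseteq> X"
  using that by (auto simp: fcar_iff hmon_def)

lemma fcar_1 [simp]: "1 \<in> fcar X"
  using fcar_hmon[of 0 X] by simp

lemma fcar_hscal [simp]: "hscal c \<in> fcar X"
  using fcar_scal[of 1 X c] by simp

lemma fcar_gen: "x \<in> X \<Longrightarrow> gen x \<in> fcar X"
  by (auto simp: gen_def intro: fcar_hmon)

lemma fcar_uminus: "a \<in> fcar X \<Longrightarrow> - a \<in> fcar X"
  using fcar_scal[of a X "- 1"] by (simp add: hscal_uminus)

lemma fcar_diff: "a \<in> fcar X \<Longrightarrow> b \<in> fcar X \<Longrightarrow> a - b \<in> fcar X"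
  using fcar_add[of a X "- b"] by (simp add: fcar_uminus)

lemma fcar_sum: "(\<And>i. i \<in> A \<Longrightarrow> f i \<in> fcar X) \<Longrightarrow> sum f A \<in> fcar X"
  by (induction A rule: infinite_finite_induct) (auto intro: fcar_add)

lemma hclosed_fcar: "hclosed (fcar X)"
  unfolding hclosed_def eq_add_hscal_X_power_iff
proof (intro allI impI)
  fix x
  assume *: "\<forall>k. \<exists>j\<in>fcar X. \<forall>i<k. fps_nth x i = fps_nth j i"
  show "x \<in> fcar X"
    unfolding fcar_iff
  proof
    fix N
    obtain j where "j \<in> fcar X" "fps_nth x N = fps_nth j N"
      using * by blast
    then show "\<forall>w\<in>Poly_Mapping.keys (fps_nth x N). set (letters w) \<subseteq> X"
      by (simp add: fcar_iff)
  qed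
qed

lemma hlin_fcar:
  assumes "hlin \<phi>" "a \<in> fcar X" "\<And>w. set (letters w) \<subseteq> X \<Longrightarrow> \<phi> (hmon w) \<in> fcar Y"
  shows "\<phi> a \<in> fcar Y"
proof (rule hlin_mem[OF assms(1) hclosed_fcar fcar_0 fcar_add fcar_scal])
  fix N w
  assume "w \<in> Poly_Mapping.keys (fps_nth a N)"
  then show "\<phi> (hmon w) \<in> fcar Y"
    using assms(2) by (intro assms(3)) (simp add: fcar_iff)
qed

lemma fcar_mult:
  assumes "a \<in> fcar X" "b \<in> fcar X"
  shows "a * b \<in> fcar X"
proof (rule hlin_fcar[OF hlin_rmult[OF hlin_id] assms(1)])
  fix v :: "'a word"
  assume "set (letters v) \<subseteq> X"
  then have "hmon v * hmon w \<in> fcar X" if "set (letters w) \<subseteq> X" for w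
    using that fcar_hmon[of "v + w" X] by (simp add: hmon_add)
  then show "hmon v * b \<in> fcar X"
    using hlin_fcar[OF hlin_lmult[OF hlin_id] assms(2)] by blast
qed

lemmas fcar_intros = fcar_0 fcar_1 fcar_hscal fcar_gen fcar_add fcar_diff fcar_uminus fcar_mult fcar_sum

lemma hlin_eqI_fcar:
  assumes "a \<in> fcar X" "hlin \<phi>" "hlin \<psi>" "\<phi> 1 = \<psi> 1"
    and "\<And>x w. x \<in> X \<Longrightarrow> set (letters w) \<subseteq> X \<Longrightarrow> \<phi> (hmon w) = \<psi> (hmon w)
      \<Longrightarrow> \<phi> (gen x * hmon w) = \<psi> (gen x * hmon w)"
  shows "\<phi> a = \<psi> a"
proof (rule hlin_eqI_supp[OF assms(2,3)])
  fix N w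
  assume "w \<in> Poly_Mapping.keys (fps_nth a N)"
  then have "set (letters w) \<subseteq> X"
    using assms(1) by (auto simp: fcar_iff)
  moreover have "\<phi> (hmon (Word xs)) = \<psi> (hmon (Word xs))" if "set xs \<subseteq> X" for xs
    using that by (induction xs) (simp_all add: assms(4,5) hmon_Cons)
  ultimately have "\<phi> (hmon (Word (letters w))) = \<psi> (hmon (Word (letters w)))"
    by blast
  then show "\<phi> (hmon w) = \<psi> (hmon w)"
    by simp
qed

lemma fcar_UNIV: "a \<in> fcar UNIV"
  by (simp add: fcar_iff)

text \<open>
  The coefficient of \<^term>\<open>gen q\<close> in \<open>x \<triangleright>\<close> \<^term>\<open>gen p\<close>, as a function of \<open>\<Delta>(x)\<close>.
\<close>

definition acoef :: "nat \<Rightarrow> lgen \<Rightarrow> lgen \<Rightarrow> (ugen word \<times> ugen word) hser \<Rightarrow> complex fps"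
  where "acoef n p q = cext (\<lambda>(u, v). rho n (antipode (hmon u)) (fst p) (fst q) * rho n (hmon v) (snd q) (snd p))"

definition acoef' :: "nat \<Rightarrow> lgen \<Rightarrow> lgen \<Rightarrow> (ugen word \<times> ugen word) hser \<Rightarrow> lgen word hser"
  where "acoef' n p q Z = hscal (acoef n p q Z)"

lemma acoef'_eq: "acoef' n p q = hext (\<lambda>(u, v).
    rho' n (fst p) (fst q) (antipode (hmon u)) * rho' n (snd q) (snd p) (hmon v))"
  by (intro ext) (simp add: acoef'_def acoef_def hscal_cext rho'_def hscal_mult case_prod_beta')

lemma hlin_acoef': "hlin (acoef' n p q)"
  unfolding acoef'_eq by (rule hlin_hext)

lemma acoef'_tensor:
  "acoef' n p q (x \<otimes>\<^sub>h y) = rho' n (fst p) (fst q) (antipode x) * rho' n (snd q) (snd p) y"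
  unfolding acoef'_eq
  by (rule hext_tensor[where B = "\<lambda>x y. rho' n (fst p) (fst q) (antipode x) * rho' n (snd q) (snd p) y"])
    (intro hlin_rmult hlin_lmult hlin_comp[OF hlin_rho' hlin_antipode] hlin_rho')+

lemma finite_lgens [simp]: "finite (lgens n)"
  by (simp add: lgens_def)

text \<open>The factors appear in reversed order because \<open>y\<close> acts first in
  \<open>x \<triangleright> (y \<triangleright> L)\<close>. The antipode reverses products in the
  left leg, and in the right leg the column index of \<open>p\<close> stands at the far end, so both
  legs agree.\<close>

lemma acoef'_mult:
  assumes p: "p \<in> lgens n" and q: "q \<in> lgens n"
  shows "acoef' n p q (X * Y) = (\<Sum>t\<in>lgens n. acoef' n p t Y * acoef' n t q X)"
proof -
  have 1: "acoef' n p q (hmon (u, v) * hmon (u', v'))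
      = (\<Sum>t\<in>lgens n. acoef' n p t (hmon (u', v')) * acoef' n t q (hmon (u, v)))" for u v u' v'
  proof -
    let ?I = "{1..n}"
    have "acoef' n p q (hmon (u, v) * hmon (u', v'))
        = (\<Sum>s\<in>?I. rho' n (fst p) s (antipode (hmon u')) * rho' n s (fst q) (antipode (hmon u)))
          * (\<Sum>t\<in>?I. rho' n (snd q) t (hmon v) * rho' n t (snd p) (hmon v'))"
      using p q by (auto simp: acoef'_eq lgens_def antipode_mult rho'_mult simp flip: hmon_add)
        (simp add: hmon_add antipode_mult rho'_mult)
    also have "\<dots> = (\<Sum>s\<in>?I. \<Sum>t\<in>?I. (rho' n (fst p) s (antipode (hmon u')) * rho' n s (fst q) (antipode (hmon u)))
          * (rho' n (snd q) t (hmon v) * rho' n t (snd p) (hmon v')))"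
      by (rule sum_product)
    also have "\<dots> = (\<Sum>s\<in>?I. \<Sum>t\<in>?I. (rho' n (fst p) s (antipode (hmon u')) * rho' n t (snd p) (hmon v'))
          * (rho' n s (fst q) (antipode (hmon u)) * rho' n (snd q) t (hmon v)))"
      \<comment> \<open>All four factors are scalars; below \<open>hscal\<close> they can be
        permuted freely.\<close>
      unfolding rho'_def hscal_mult[symmetric]
      by (intro sum.cong refl arg_cong[where f = hscal]) (simp only: mult_ac)
    also have "\<dots> = (\<Sum>t\<in>lgens n. acoef' n p t (hmon (u', v')) * acoef' n t q (hmon (u, v)))"
      by (simp add: lgens_def sum.cartesian_product acoef'_eq case_prod_beta)
    finally show ?thesis .
  qed
  have 2: "acoef' n p q (X * hmon (u', v'))
      = (\<Sum>t\<in>lgens n. acoef' n p t (hmon (u', v')) * acoef' n t q X)" for u' v'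
    by (rule hlin_pair_eqI[where \<phi> = "\<lambda>X. acoef' n p q (X * hmon (u', v'))"
          and \<psi> = "\<lambda>X. (\<Sum>t\<in>lgens n. acoef' n p t (hmon (u', v')) * acoef' n t q X)"])
      (rule hlin_comp[OF hlin_acoef' hlin_rmult[OF hlin_id]] hlin_sumf hlin_lmult hlin_acoef' 1)+
  show ?thesis
    by (rule hlin_pair_eqI[where \<phi> = "\<lambda>Y. acoef' n p q (X * Y)"
          and \<psi> = "\<lambda>Y. (\<Sum>t\<in>lgens n. acoef' n p t Y * acoef' n t q X)"])
      (rule hlin_comp[OF hlin_acoef' hlin_lmult[OF hlin_id]] hlin_sumf hlin_rmult hlin_acoef' 2)+
qed

text \<open>Exhibits the action on a generator as a linear function of the coproduct alone, so that
  an explicit formula for the coproduct can be inserted.\<close>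

lemma act_gen_eq: "act_gen n x p = (\<Sum>q\<in>lgens n. acoef' n p q (coprod x) * gen q)"
proof -
  obtain r c where p: "p = (r, c)"
    by (cases p)
  define F where "F = (\<lambda>(u, v). mmul {1..n} (mmul {1..n} (hscalm (rho n (antipode (hmon u)))) Lmat)
             (hscalm (rho n (hmon v))) r c)"
  have F: "F (u, v) = (\<Sum>q\<in>lgens n. acoef' n p q (hmon (u, v)) * gen q)" for u v
  proof -
    have "F (u, v) = (\<Sum>t\<in>{1..n}. \<Sum>s\<in>{1..n}. rho' n r s (antipode (hmon u)) * gen (s, t) * rho' n t c (hmon v))"
      by (simp add: F_def mmul_def hscalm_def Lmat_def rho'_def sum_distrib_right)
    also have "\<dots> = (\<Sum>s\<in>{1..n}. \<Sum>t\<in>{1..n}. rho' n r s (antipode (hmon u)) * gen (s, t) * rho' n t c (hmon v))"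
      by (rule sum.swap)
    also have "\<dots> = (\<Sum>q\<in>lgens n. acoef' n p q (hmon (u, v)) * gen q)"
      unfolding lgens_def sum.cartesian_product
      by (intro sum.cong) (auto simp: acoef'_eq p rho'_def hscal_commute[of "gen _"] mult.assoc)
    finally show ?thesis .
  qed
  have "hext F Z = (\<Sum>q\<in>lgens n. acoef' n p q Z * gen q)" for Z
    by (rule hlin_pair_eqI[where \<phi> = "hext F" and \<psi> = "\<lambda>Z. (\<Sum>q\<in>lgens n. acoef' n p q Z * gen q)"])
      (auto intro!: hlin_hext hlin_sumf hlin_rmult hlin_acoef' simp: F)
  then show ?thesis
    by (simp add: act_gen_def p F_def)
qed

lemma hlin_act_gen: "hlin (\<lambda>x. act_gen n x p)"
  unfolding act_gen_eq by (intro hlin_sumf hlin_rmult hlin_comp[OF hlin_acoef' hlin_coprod])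

lemma act_gen_mult:
  assumes "p \<in> lgens n"
  shows "act_gen n (x * y) p = (\<Sum>t\<in>lgens n. acoef' n p t (coprod y) * act_gen n x t)"
proof -
  have "act_gen n (x * y) p
      = (\<Sum>q\<in>lgens n. \<Sum>t\<in>lgens n. acoef' n p t (coprod y) * acoef' n t q (coprod x) * gen q)"
    using assms by (simp add: act_gen_eq coprod_mult acoef'_mult sum_distrib_right)
  also have "\<dots> = (\<Sum>t\<in>lgens n. \<Sum>q\<in>lgens n. acoef' n p t (coprod y) * acoef' n t q (coprod x) * gen q)"
    by (rule sum.swap)
  finally show ?thesis
    by (simp add: act_gen_eq sum_distrib_left mult.assoc)
qed

lemma fcar_act_gen: "act_gen n x p \<in> fcar (lgens n)"
  unfolding act_gen_eq acoef'_def by (intro fcar_intros) auto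

lemma hlin_act: "hlin (act_free n x)"
  unfolding act_free_def by (rule hlin_hext)

lemma act_1: "act_free n x 1 = counit' x"
  by (simp add: act_free_def counit'_def)

lemma act_hscal: "act_free n x (hscal c) = hscal c * counit' x"
  by (simp add: hlin_hscal[OF hlin_act] act_1)

lemma hlin_act_word: "hlin (act_word n xs)"
proof (cases xs)
  case Nil
  then have "act_word n xs = counit'"
    by (auto simp: counit'_def)
  then show ?thesis
    by (simp add: hlin_counit')
next
  case (Cons g gs)
  then have "act_word n xs
      = (\<lambda>x. hext (\<lambda>(u, v). act_gen n (hmon u) g * act_word n gs (hmon v)) (coprod x))"
    by (intro ext) simp
  then show ?thesis
    by (simp add: hlin_comp[OF hlin_hext hlin_coprod])
qed

lemma hlin_act_left: "hlin (\<lambda>x. act_free n x a)"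
  unfolding act_free_def by (rule hlin_hext_param[OF hlin_act_word])

lemma act_gen_mult_left:
  "act_free n x (gen p * b)
    = hext (\<lambda>(u, v). act_gen n (hmon u) p * act_free n (hmon v) b) (coprod x)"
proof (rule hlin_eqI[where u = b])
  show "hlin (\<lambda>b. act_free n x (gen p * b))"
    by (rule hlin_comp[OF hlin_act hlin_lmult[OF hlin_id]])
  show "hlin (\<lambda>b. hext (\<lambda>(u, v). act_gen n (hmon u) p * act_free n (hmon v) b) (coprod x))"
    by (rule hlin_hext_param) (auto simp: case_prod_beta intro!: hlin_lmult hlin_act)
  fix w
  have "gen p * hmon w = hmon (Word (p # letters w))"
    by (simp add: hmon_Cons)
  then show "act_free n x (gen p * hmon w)
      = hext (\<lambda>(u, v). act_gen n (hmon u) p * act_free n (hmon v) (hmon w)) (coprod x)"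
    by (simp add: act_free_def)
qed

lemma act_gen_mult_left_tensor:
  "hext (\<lambda>(u, v). act_gen n (hmon u) p * act_free n (hmon v) b) (x \<otimes>\<^sub>h y)
    = act_gen n x p * act_free n y b"
  by (rule hext_tensor[where B = "\<lambda>x y. act_gen n x p * act_free n y b"])
    (intro hlin_rmult hlin_lmult hlin_act_gen hlin_act_left)+

text \<open>True for every \<open>a\<close>: the action on any letter is by construction a
  combination of letters in \<open>lgens n\<close>.\<close>

lemma fcar_act: "act_free n x a \<in> fcar (lgens n)"
proof -
  have "act_word n xs x \<in> fcar (lgens n)" for xs x
  proof (induction xs arbitrary: x)
    case (Cons g gs)
    have "hext (\<lambda>(u, v). act_gen n (hmon u) g * act_word n gs (hmon v)) Z \<in> fcar (lgens n)" for Z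
      by (rule hlin_mem[OF hlin_hext hclosed_fcar fcar_0 fcar_add fcar_scal])
        (auto simp: Cons intro!: fcar_mult fcar_act_gen)
    then show ?case
      by simp
  qed simp
  then have "act_free n x (hmon w) \<in> fcar (lgens n)" for w
    by (simp add: act_free_def)
  then show ?thesis
    using hlin_fcar[OF hlin_act fcar_UNIV] by blast
qed

text \<open>The module axiom on the free algebra; it reduces the action of a word to successive
  actions of its letters.\<close>

lemma act_mult:
  assumes "a \<in> fcar (lgens n)"
  shows "act_free n (x * y) a = act_free n x (act_free n y a)"
proof -
  have word: "act_free n (x * y) (hmon (Word ps)) = act_free n x (act_free n y (hmon (Word ps)))"
    if "set ps \<subseteq> lgens n" for ps x y
    using that
  proof (induction ps arbitrary: x y)
    case Nil
    then show ?case
      by (simp add: act_1 counit'_mult) (simp add: counit'_def act_hscal mult.commute flip: hscal_mult)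
  next
    case (Cons p ps)
    let ?b = "hmon (Word ps)"
    define F where "F p b = (\<lambda>(u, v). act_gen n (hmon u) p * act_free n (hmon v) b)" for p b
    have F: "act_free n x (gen q * b) = hext (F q b) (coprod x)" for x q b
      by (simp add: F_def act_gen_mult_left)
    have p: "p \<in> lgens n"
      using Cons.prems by simp
    \<comment> \<open>The two coproducts are replaced by arbitrary tensors, one at a time, so that
      the identity can be tested on pairs of words.\<close>
    have 1: "hext (F p ?b) (X * hmon (u', v')) = (\<Sum>q\<in>lgens n.
        acoef' n p q (coprod (hmon u')) * hext (F q (act_free n (hmon v') ?b)) X)" for X u' v'
    proof (rule hlin_pair_eqI[where x = X])
      show "hlin (\<lambda>X. hext (F p ?b) (X * hmon (u', v')))"
        by (rule hlin_comp[OF hlin_hext hlin_rmult[OF hlin_id]])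
      show "hlin (\<lambda>X. \<Sum>q\<in>lgens n.
        acoef' n p q (coprod (hmon u')) * hext (F q (act_free n (hmon v') ?b)) X)"
        by (intro hlin_sumf hlin_lmult hlin_hext)
      fix u v
      have "hext (F p ?b) (hmon (u, v) * hmon (u', v'))
          = act_gen n (hmon u * hmon u') p * act_free n (hmon v * hmon v') ?b"
        by (simp add: F_def flip: hmon_add)
      also have "\<dots> = (\<Sum>q\<in>lgens n. acoef' n p q (coprod (hmon u')) * act_gen n (hmon u) q)
          * act_free n (hmon v) (act_free n (hmon v') ?b)"
        using Cons by (simp add: act_gen_mult)
      finally show "hext (F p ?b) (hmon (u, v) * hmon (u', v')) = (\<Sum>q\<in>lgens n.
        acoef' n p q (coprod (hmon u')) * hext (F q (act_free n (hmon v') ?b)) (hmon (u, v)))"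
        by (simp add: F_def sum_distrib_right mult.assoc)
    qed
    have 2: "hext (F p ?b) (coprod x * Y) = act_free n x (hext (F p ?b) Y)" for Y
    proof (rule hlin_pair_eqI[where x = Y])
      show "hlin (\<lambda>Y. hext (F p ?b) (coprod x * Y))"
        by (rule hlin_comp[OF hlin_hext hlin_lmult[OF hlin_id]])
      show "hlin (\<lambda>Y. act_free n x (hext (F p ?b) Y))"
        by (rule hlin_comp[OF hlin_act hlin_hext])
      fix u' v'
      have "act_free n x (hext (F p ?b) (hmon (u', v')))
          = (\<Sum>q\<in>lgens n. act_free n x (acoef' n p q (coprod (hmon u')) * (gen q * act_free n (hmon v') ?b)))"
        by (simp add: F_def act_gen_eq[of n "hmon u'"] sum_distrib_right mult.assoc hlin_sum[OF hlin_act])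
      also have "\<dots> = (\<Sum>q\<in>lgens n.
          acoef' n p q (coprod (hmon u')) * hext (F q (act_free n (hmon v') ?b)) (coprod x))"
        by (simp add: acoef'_def hlin_scal[OF hlin_act] F)
      finally show "hext (F p ?b) (coprod x * hmon (u', v')) = act_free n x (hext (F p ?b) (hmon (u', v')))"
        by (simp only: 1)
    qed
    show ?case
      by (simp add: hmon_Cons F coprod_mult 2)
  qed
  show ?thesis
  proof (rule hlin_eqI_supp[where u = a])
    show "hlin (act_free n (x * y))"
      by (rule hlin_act)
    show "hlin (\<lambda>a. act_free n x (act_free n y a))"
      by (rule hlin_comp[OF hlin_act hlin_act])
    fix N w
    assume "w \<in> Poly_Mapping.keys (fps_nth a N)"
    then have "set (letters w) \<subseteq> lgens n"
      using assms by (auto simp: fcar_iff)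
    then show "act_free n (x * y) (hmon w) = act_free n x (act_free n y (hmon w))"
      using word[of "letters w"] by simp
  qed
qed

section \<open>Group-like elements act by homomorphisms, generators by skew derivations\<close>

definition grouplike :: "ugen word hser \<Rightarrow> bool"
  where "grouplike k \<longleftrightarrow> coprod k = k \<otimes>\<^sub>h k \<and> counit k = 1"

lemma grouplike_uK: "grouplike (uK s i)"
  using counit'_uK[of s i, where 'a = nat]
  by (simp add: grouplike_def coprod_uK counit'_def) (metis hscal_1 hscal_inject)

lemma grouplike_counit': "grouplike k \<Longrightarrow> counit' k = 1"
  by (simp add: grouplike_def counit'_def)

lemma act_grouplike_gen:
  assumes "grouplike k"
  shows "act_free n k (gen p * b) = act_gen n k p * act_free n k b"
  using assms by (simp add: act_gen_mult_left grouplike_def act_gen_mult_left_tensor)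

lemma act_grouplike_mult:
  assumes "grouplike k"
  shows "act_free n k (a * b) = act_free n k a * act_free n k b"
proof (rule hlin_eqI_fcar[OF fcar_UNIV, where \<phi> = "\<lambda>a. act_free n k (a * b)"])
  show "hlin (\<lambda>a. act_free n k (a * b))"
    by (rule hlin_comp[OF hlin_act hlin_rmult[OF hlin_id]])
  show "hlin (\<lambda>a. act_free n k a * act_free n k b)"
    by (rule hlin_rmult[OF hlin_act])
qed (simp_all add: act_1 grouplike_counit'[OF assms] act_grouplike_gen[OF assms] mult.assoc)

lemma act_twisted_gen:
  assumes "coprod x = x \<otimes>\<^sub>h k + l \<otimes>\<^sub>h x"
  shows "act_free n x (gen p * b) = act_gen n x p * act_free n k b + act_gen n l p * act_free n x b"
  using assms by (simp add: act_gen_mult_left hlin_add[OF hlin_hext] act_gen_mult_left_tensor)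

text \<open>A skew Leibniz rule, by induction on the words of \<open>a\<close>. Prefixing a letter
  requires \<open>k\<close> to be distributed over the rest of \<open>a\<close> times
  \<open>b\<close>, and \<open>l\<close> over the letter times the rest of \<open>a\<close>; both
  are possible because they are group-like.\<close>

lemma act_twisted_mult:
  assumes x: "coprod x = x \<otimes>\<^sub>h k + l \<otimes>\<^sub>h x" "counit x = 0" and k: "grouplike k" and l: "grouplike l"
  shows "act_free n x (a * b) = act_free n x a * act_free n k b + act_free n l a * act_free n x b"
proof (rule hlin_eqI_fcar[OF fcar_UNIV, where \<phi> = "\<lambda>a. act_free n x (a * b)"])
  show "hlin (\<lambda>a. act_free n x (a * b))"
    by (rule hlin_comp[OF hlin_act hlin_rmult[OF hlin_id]])
  show "hlin (\<lambda>a. act_free n x a * act_free n k b + act_free n l a * act_free n x b)"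
    by (intro hlin_plus hlin_rmult hlin_act)
  show "act_free n x (1 * b) = act_free n x 1 * act_free n k b + act_free n l 1 * act_free n x b"
    using x(2) by (simp add: act_1 grouplike_counit'[OF l]) (simp add: counit'_def)
qed (simp add: act_twisted_gen[OF x(1)] act_grouplike_mult[OF k] act_grouplike_gen[OF l] algebra_simps)

lemma counit_gen: "counit (gen g) = 0"
  using counit'_gen[of g, where 'a = nat] by (simp add: counit'_def) (metis hscal_0 hscal_inject)

lemmas act_ugen_mult = act_twisted_mult[OF coprod_gen_twisted counit_gen grouplike_uK grouplike_uK]
lemmas act_uK_mult = act_grouplike_mult[OF grouplike_uK]

lemma act_uK_gen: "act_free n (uK s i) (gen p) = act_gen n (uK s i) p"
  using act_grouplike_gen[OF grouplike_uK, of n s i p 1]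
  by (simp add: act_1 grouplike_counit'[OF grouplike_uK])

lemma act_ugen_gen: "act_free n (gen g) (gen p) = act_gen n (gen g) p"
  using act_twisted_gen[OF coprod_gen_twisted, of n g p 1]
  by (simp add: act_1 grouplike_counit'[OF grouplike_uK] counit'_gen)

lemma act_uK_entry:
  assumes "r \<in> {1..n}" "c \<in> {1..n}"
  shows "act_free n (uK s i) (gen (r, c)) = hscal (kap (- s) i r * kap s i c) * gen (r, c)"
proof -
  have "acoef' n (r, c) q (uK s i \<otimes>\<^sub>h uK s i) * gen q
      = (if q = (r, c) then hscal (kap (- s) i r * kap s i c) * gen (r, c) else 0)" if "q \<in> lgens n" for q
    using that assms
    by (cases q) (auto simp: acoef'_tensor antipode_uK rho'_uK lgens_def idm_def hscal_mult)
  then show ?thesis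
    using assms by (simp add: act_uK_gen act_gen_eq coprod_uK lgens_def)
qed

lemma sum_single_term:
  fixes f :: "'i \<Rightarrow> 'a :: comm_monoid_add"
  assumes "finite I" "i \<in> I" "\<And>j. j \<in> I \<Longrightarrow> j \<noteq> i \<Longrightarrow> f j = 0"
  shows "sum f I = f i"
  using assms by (simp add: sum.remove[of I i])

lemma rho'_antipode_gen:
  assumes "r \<in> {1..n}" "c \<in> {1..n}"
  shows "rho' n r c (antipode (gen g))
    = - hscal (kap (- lwt g) (gidx g) r * rho_gen g r c * kap (- rwt g) (gidx g) c)"
proof -
  have 1: "rho' n r s (uK (- lwt g) (gidx g) * gen g) = hscal (kap (- lwt g) (gidx g) r * rho_gen g r s)"
    if "s \<in> {1..n}" for s
    using that assms
    by (simp add: rho'_mult rho'_uK rho'_gen)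
      (subst sum_single_term[of _ r], auto simp: idm_def hscal_mult)
  show ?thesis
    using assms
    by (simp add: antipode_gen_twisted hlin_uminus[OF hlin_rho'] rho'_mult[of r n c _ "uK _ _"] rho'_uK 1)
      (subst sum_single_term[of _ c], auto simp: idm_def hscal_mult)
qed

text \<open>With \<open>l\<close> and \<open>r\<close> the weights of \<open>g\<close>, the first
  sum stems from \<open>K^l \<otimes> g\<close>. The second stems from
  \<open>g \<otimes> K^r\<close>; its sign and its inner weight come from the antipode of
  \<open>g\<close>.\<close>

lemma act_ugen_entry:
  assumes "r \<in> {1..n}" "c \<in> {1..n}"
  shows "act_free n (gen g) (gen (r, c))
    = (\<Sum>s\<in>{1..n}. hscal (rho_gen g s c * kap (- lwt g) (gidx g) r) * gen (r, s))
    - (\<Sum>s\<in>{1..n}. hscal (kap (- lwt g) (gidx g) r * rho_gen g r s * kap (- rwt g) (gidx g) s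
        * kap (rwt g) (gidx g) c) * gen (s, c))"
proof -
  let ?k = "uK (rwt g) (gidx g)" and ?l = "uK (lwt g) (gidx g)"
  have 1: "(\<Sum>q\<in>lgens n. acoef' n (r, c) q (gen g \<otimes>\<^sub>h ?k) * gen q)
      = (\<Sum>s\<in>{1..n}. - (hscal (kap (- lwt g) (gidx g) r * rho_gen g r s * kap (- rwt g) (gidx g) s
        * kap (rwt g) (gidx g) c) * gen (s, c)))"
    unfolding lgens_def sum.cartesian_product'
  proof (rule sum.cong)
    fix s
    assume "s \<in> {1..n}"
    then show "(\<Sum>t\<in>{1..n}. acoef' n (r, c) (s, t) (gen g \<otimes>\<^sub>h ?k) * gen (s, t))
      = - (hscal (kap (- lwt g) (gidx g) r * rho_gen g r s * kap (- rwt g) (gidx g) s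
        * kap (rwt g) (gidx g) c) * gen (s, c))"
      using assms
      by (subst sum_single_term[of _ c])
        (auto simp: acoef'_tensor rho'_antipode_gen rho'_uK idm_def hscal_mult)
  qed simp
  have 2: "(\<Sum>q\<in>lgens n. acoef' n (r, c) q (?l \<otimes>\<^sub>h gen g) * gen q)
      = (\<Sum>s\<in>{1..n}. hscal (rho_gen g s c * kap (- lwt g) (gidx g) r) * gen (r, s))"
    unfolding lgens_def sum.cartesian_product'
    using assms
    by (subst sum_single_term[of _ r])
      (auto simp: acoef'_tensor antipode_uK rho'_gen rho'_uK idm_def mult.commute simp flip: hscal_mult
        intro!: sum.cong)
  show ?thesis
    unfolding act_ugen_gen act_gen_eq coprod_gen_twisted hlin_add[OF hlin_acoef'] distrib_right sum.distrib 1 2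
    by (simp add: sum_negf)
qed

section \<open>Covariant matrices\<close>

text \<open>Abstract in the index set because covariance is needed twice: for matrices on the vector
  representation and, for the reflection equation, on its tensor square.\<close>

locale weights =
  fixes n :: nat and I :: "'i set" and K :: "int \<Rightarrow> nat \<Rightarrow> 'i \<Rightarrow> complex fps"
    and G :: "ugen \<Rightarrow> ('i, complex fps) matr"
  assumes finite_I: "finite I"
    and K_inv: "r \<in> I \<Longrightarrow> K s i r * K (- s) i r = 1"
begin

text \<open>
  The rule \<open>x \<triangleright> A = \<rho>(\<gamma>(x\<^sub>(\<^sub>1\<^sub>))) A \<rho>(x\<^sub>(\<^sub>2\<^sub>))\<close> on the group-like elements and the generators, for a
  representation in which \<open>K\<^sub>i\<^sup>s\<close> is the diagonal matrix \<^term>\<open>K s i\<close> and \<open>g\<close> the matrix \<^term>\<open>G g\<close>.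
\<close>

definition covariant :: "('i, lgen word hser) matr \<Rightarrow> bool"
  where "covariant A \<longleftrightarrow> (\<forall>r\<in>I. \<forall>c\<in>I.
    (\<forall>s i. act_free n (uK s i) (A r c) = hscal (K (- s) i r * K s i c) * A r c)
    \<and> (\<forall>g. act_free n (gen g) (A r c)
        = (\<Sum>s\<in>I. hscal (G g s c * K (- lwt g) (gidx g) r) * A r s)
        - (\<Sum>s\<in>I. hscal (K (- lwt g) (gidx g) r * G g r s * K (- rwt g) (gidx g) s * K (rwt g) (gidx g) c)
            * A s c)))"

lemma covariantI:
  assumes "\<And>r c s i. r \<in> I \<Longrightarrow> c \<in> I \<Longrightarrow>
      act_free n (uK s i) (A r c) = hscal (K (- s) i r * K s i c) * A r c"
    and "\<And>r c g. r \<in> I \<Longrightarrow> c \<in> I \<Longrightarrow> act_free n (gen g) (A r c)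
        = (\<Sum>s\<in>I. hscal (G g s c * K (- lwt g) (gidx g) r) * A r s)
        - (\<Sum>s\<in>I. hscal (K (- lwt g) (gidx g) r * G g r s * K (- rwt g) (gidx g) s * K (rwt g) (gidx g) c)
            * A s c)"
  shows "covariant A"
  using assms by (simp add: covariant_def)

lemma covariant_uK:
  "covariant A \<Longrightarrow> r \<in> I \<Longrightarrow> c \<in> I \<Longrightarrow>
    act_free n (uK s i) (A r c) = hscal (K (- s) i r * K s i c) * A r c"
  by (simp add: covariant_def)

lemma covariant_ugen:
  "covariant A \<Longrightarrow> r \<in> I \<Longrightarrow> c \<in> I \<Longrightarrow> act_free n (gen g) (A r c)
        = (\<Sum>s\<in>I. hscal (G g s c * K (- lwt g) (gidx g) r) * A r s)
        - (\<Sum>s\<in>I. hscal (K (- lwt g) (gidx g) r * G g r s * K (- rwt g) (gidx g) s * K (rwt g) (gidx g) c)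
            * A s c)"
  by (simp add: covariant_def)

lemma hscal_mult_mult: "(hscal a * x) * (hscal b * y) = hscal (a * b) * (x * y)"
  by (simp add: hscal_mult mult.assoc hscal_left_commute[of x])

lemma K_inv': "r \<in> I \<Longrightarrow> K (- s) i r * K s i r = 1"
  using K_inv by (simp add: mult.commute)

text \<open>In \<open>\<rho>(\<gamma>(x_(1))) A \<rho>(x_(2)) \<rho>(\<gamma>(x_(3))) B
  \<rho>(x_(4))\<close> the inner two factors cancel by the antipode axiom.\<close>

lemma covariant_mmul:
  assumes A: "covariant A" and B: "covariant B"
  shows "covariant (mmul I A B)"
proof (rule covariantI)
  fix r c s i
  assume rc: "r \<in> I" "c \<in> I"
  have "act_free n (uK s i) (A r t * B t c) = hscal (K (- s) i r * K s i c) * (A r t * B t c)"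
    if "t \<in> I" for t
  proof -
    have "K (- s) i r * K s i t * (K (- s) i t * K s i c) = K (- s) i r * K s i c * (K s i t * K (- s) i t)"
      by (simp only: mult_ac)
    also have "\<dots> = K (- s) i r * K s i c"
      by (simp only: K_inv[OF that] mult_1_right)
    finally show ?thesis
      using that rc
      by (simp only: act_uK_mult covariant_uK[OF A] covariant_uK[OF B] hscal_mult_mult)
  qed
  then show "act_free n (uK s i) (mmul I A B r c) = hscal (K (- s) i r * K s i c) * mmul I A B r c"
    by (simp add: mmul_def hlin_sum[OF hlin_act] sum_distrib_left)
next
  fix r c g
  assume rc: "r \<in> I" "c \<in> I"
  define l where "l = K (- lwt g) (gidx g)"
  define l' where "l' = K (lwt g) (gidx g)"
  define k where "k = K (rwt g) (gidx g)"
  define k' where "k' = K (- rwt g) (gidx g)"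
  have ll: "l' t * l t = 1" and kk: "k t * k' t = 1" if "t \<in> I" for t
    using that K_inv by (simp_all add: l_def l'_def k_def k'_def)
  \<comment> \<open>\<open>T1\<close> arises twice with opposite signs, from the action on the
    columns of \<open>A\<close> and on the rows of \<open>B\<close>. \<open>T2\<close> and
    \<open>T3\<close> are the outer actions, which survive.\<close>
  define T1 where "T1 s t = hscal (l r * G g t s * k' s * k c) * (A r t * B s c)" for s t
  define T2 where "T2 s t = hscal (l r * G g r t * k' t * k c) * (A t s * B s c)" for s t
  define T3 where "T3 s t = hscal (G g t c * l r) * (A r s * B s t)" for s t
  have *: "act_free n (gen g) (A r s * B s c)
      = (\<Sum>t\<in>I. T1 s t) - (\<Sum>t\<in>I. T2 s t) + (\<Sum>t\<in>I. T3 s t) - (\<Sum>t\<in>I. T1 t s)"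
    if s: "s \<in> I" for s
  proof -
    have 1: "(\<Sum>t\<in>I. hscal (G g t s * l r) * A r t) * (hscal (k' s * k c) * B s c) = (\<Sum>t\<in>I. T1 s t)"
      unfolding sum_distrib_right hscal_mult_mult T1_def by (intro sum.cong refl) (simp add: mult_ac)
    have 2: "(\<Sum>t\<in>I. hscal (l r * G g r t * k' t * k s) * A t s) * (hscal (k' s * k c) * B s c)
        = (\<Sum>t\<in>I. T2 s t)"
      unfolding sum_distrib_right hscal_mult_mult T2_def
    proof (intro sum.cong refl)
      fix t
      have "l r * G g r t * k' t * k s * (k' s * k c) = l r * G g r t * k' t * k c * (k s * k' s)"
        by (simp only: mult_ac)
      also have "\<dots> = l r * G g r t * k' t * k c"
        by (simp only: kk[OF s] mult_1_right)
      finally show "hscal (l r * G g r t * k' t * k s * (k' s * k c)) * (A t s * B s c)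
        = hscal (l r * G g r t * k' t * k c) * (A t s * B s c)"
        by (simp only:)
    qed
    have 3: "hscal (l r * l' s) * A r s * (\<Sum>t\<in>I. hscal (G g t c * l s) * B s t) = (\<Sum>t\<in>I. T3 s t)"
      unfolding sum_distrib_left hscal_mult_mult T3_def
    proof (intro sum.cong refl)
      fix t
      have "l r * l' s * (G g t c * l s) = G g t c * l r * (l' s * l s)"
        by (simp only: mult_ac)
      also have "\<dots> = G g t c * l r"
        by (simp only: ll[OF s] mult_1_right)
      finally show "hscal (l r * l' s * (G g t c * l s)) * (A r s * B s t)
        = hscal (G g t c * l r) * (A r s * B s t)"
        by (simp only:)
    qed
    have 4: "hscal (l r * l' s) * A r s * (\<Sum>t\<in>I. hscal (l s * G g s t * k' t * k c) * B t c)
        = (\<Sum>t\<in>I. T1 t s)"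
      unfolding sum_distrib_left hscal_mult_mult T1_def
    proof (intro sum.cong refl)
      fix t
      have "l r * l' s * (l s * G g s t * k' t * k c) = l r * G g s t * k' t * k c * (l' s * l s)"
        by (simp only: mult_ac)
      also have "\<dots> = l r * G g s t * k' t * k c"
        by (simp only: ll[OF s] mult_1_right)
      finally show "hscal (l r * l' s * (l s * G g s t * k' t * k c)) * (A r s * B t c)
        = hscal (l r * G g s t * k' t * k c) * (A r s * B t c)"
        by (simp only:)
    qed
    have "act_free n (gen g) (A r s * B s c)
      = ((\<Sum>t\<in>I. hscal (G g t s * l r) * A r t) - (\<Sum>t\<in>I. hscal (l r * G g r t * k' t * k s) * A t s))
          * (hscal (k' s * k c) * B s c)
        + hscal (l r * l' s) * A r s
          * ((\<Sum>t\<in>I. hscal (G g t c * l s) * B s t) - (\<Sum>t\<in>I. hscal (l s * G g s t * k' t * k c) * B t c))"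
      using rc s
      by (simp add: act_ugen_mult covariant_ugen[OF A] covariant_ugen[OF B]
          covariant_uK[OF A] covariant_uK[OF B] l_def l'_def k_def k'_def)
    then show ?thesis
      by (simp only: left_diff_distrib right_diff_distrib 1 2 3 4) simp
  qed
  have "act_free n (gen g) (mmul I A B r c)
      = (\<Sum>s\<in>I. \<Sum>t\<in>I. T1 s t) - (\<Sum>s\<in>I. \<Sum>t\<in>I. T2 s t) + (\<Sum>s\<in>I. \<Sum>t\<in>I. T3 s t)
        - (\<Sum>s\<in>I. \<Sum>t\<in>I. T1 t s)"
    by (simp add: mmul_def hlin_sum[OF hlin_act] * sum.distrib sum_subtractf)
  \<comment> \<open>Exchanging the two summation indices makes the contributions of
    \<open>T1\<close> cancel.\<close>
  also have "(\<Sum>s\<in>I. \<Sum>t\<in>I. T1 t s) = (\<Sum>s\<in>I. \<Sum>t\<in>I. T1 s t)"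
    by (rule sum.swap)
  also have "(\<Sum>s\<in>I. \<Sum>t\<in>I. T2 s t) = (\<Sum>t\<in>I. hscal (l r * G g r t * k' t * k c) * mmul I A B t c)"
    unfolding mmul_def sum_distrib_left T2_def by (rule sum.swap)
  also have "(\<Sum>s\<in>I. \<Sum>t\<in>I. T3 s t) = (\<Sum>t\<in>I. hscal (G g t c * l r) * mmul I A B r t)"
    unfolding mmul_def sum_distrib_left T3_def by (rule sum.swap)
  finally show "act_free n (gen g) (mmul I A B r c)
        = (\<Sum>s\<in>I. hscal (G g s c * K (- lwt g) (gidx g) r) * mmul I A B r s)
        - (\<Sum>s\<in>I. hscal (K (- lwt g) (gidx g) r * G g r s * K (- rwt g) (gidx g) s * K (rwt g) (gidx g) c)
            * mmul I A B s c)"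
    by (simp add: l_def k_def k'_def)
qed

lemma covariant_diff:
  assumes "covariant A" "covariant B"
  shows "covariant (\<lambda>r c. A r c - B r c)"
  by (rule covariantI)
    (simp_all add: hlin_diff[OF hlin_act] covariant_uK[OF assms(1)] covariant_uK[OF assms(2)]
      covariant_ugen[OF assms(1)] covariant_ugen[OF assms(2)] right_diff_distrib sum_subtractf)

lemma covariant_scal:
  assumes "covariant A"
  shows "covariant (\<lambda>r c. hscal z * A r c)"
  by (rule covariantI)
    (simp_all add: hlin_scal[OF hlin_act] covariant_uK[OF assms] covariant_ugen[OF assms]
      right_diff_distrib sum_distrib_left hscal_left_commute[of "hscal _" z])

text \<open>Scalars are acted on through the counit, so a scalar matrix is covariant when it
  intertwines the representation. The assumption \<open>wt\<close> is the commutation with the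
  diagonal matrices of \<open>K_i^s\<close>.\<close>

lemma covariant_hscalm:
  assumes wt: "\<And>r c s i. r \<in> I \<Longrightarrow> c \<in> I \<Longrightarrow> S r c \<noteq> 0 \<Longrightarrow> K s i r = K s i c"
    and comm: "\<And>g r c. r \<in> I \<Longrightarrow> c \<in> I \<Longrightarrow> mmul I (G g) S r c = mmul I S (G g) r c"
  shows "covariant (hscalm S)"
proof (rule covariantI)
  fix r c s i
  assume rc: "r \<in> I" "c \<in> I"
  show "act_free n (uK s i) (hscalm S r c) = hscal (K (- s) i r * K s i c) * hscalm S r c"
  proof (cases "S r c = 0")
    case True
    then show ?thesis
      by (simp add: hscalm_def hlin_0[OF hlin_act])
  next
    case False
    then have "K (- s) i r * K s i c = 1"
      using wt[OF rc] K_inv' rc by metis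
    then show ?thesis
      by (simp add: hscalm_def act_hscal counit'_uK)
  qed
next
  fix r c g
  assume rc: "r \<in> I" "c \<in> I"
  let ?l = "K (- lwt g) (gidx g) r"
  have "(\<Sum>s\<in>I. hscal (?l * G g r s * K (- rwt g) (gidx g) s * K (rwt g) (gidx g) c) * hscalm S s c)
      = (\<Sum>s\<in>I. hscal (?l * (G g r s * S s c)))"
  proof (intro sum.cong refl)
    fix s
    assume s: "s \<in> I"
    show "hscal (?l * G g r s * K (- rwt g) (gidx g) s * K (rwt g) (gidx g) c) * hscalm S s c
        = hscal (?l * (G g r s * S s c))"
    proof (cases "S s c = 0")
      case False
      then have "K (- rwt g) (gidx g) s * K (rwt g) (gidx g) c = 1"
        using wt[OF s rc(2)] K_inv' s by metis
      then show ?thesis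
        by (simp add: hscalm_def mult.assoc flip: hscal_mult)
    qed (simp add: hscalm_def)
  qed
  also have "\<dots> = hscal (?l * mmul I (G g) S r c)"
    by (simp add: mmul_def sum_distrib_left hscal_sum)
  also have "\<dots> = hscal (?l * mmul I S (G g) r c)"
    using comm rc by simp
  also have "\<dots> = (\<Sum>s\<in>I. hscal (G g s c * ?l) * hscalm S r s)"
    by (simp add: mmul_def sum_distrib_left hscal_sum hscalm_def mult_ac flip: hscal_mult)
  finally have *: "(\<Sum>s\<in>I. hscal (?l * G g r s * K (- rwt g) (gidx g) s * K (rwt g) (gidx g) c) * hscalm S s c)
      = (\<Sum>s\<in>I. hscal (G g s c * ?l) * hscalm S r s)" .
  show "act_free n (gen g) (hscalm S r c)
        = (\<Sum>s\<in>I. hscal (G g s c * ?l) * hscalm S r s)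
        - (\<Sum>s\<in>I. hscal (?l * G g r s * K (- rwt g) (gidx g) s * K (rwt g) (gidx g) c) * hscalm S s c)"
    unfolding * by (simp add: hscalm_def act_hscal counit'_gen)
qed

lemma covariant_idm: "covariant (hscalm idm)"
  by (rule covariant_hscalm) (auto simp: idm_def mmul_def finite_I if_distrib[of "\<lambda>x. x * _"]
      if_distrib[of "\<lambda>x. _ * x"] cong: if_cong split: if_splits)

end

lemma kap_inv: "kap s i r * kap (- s) i r = 1"
  by (simp add: kap_def flip: qpow_add)

interpretation vec: weights n "{1..n}" kap rho_gen for n
  by unfold_locales (simp_all add: kap_inv)

definition kap2 :: "int \<Rightarrow> nat \<Rightarrow> nat \<times> nat \<Rightarrow> complex fps"
  where "kap2 s i r = kap s i (fst r) * kap s i (snd r)"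

text \<open>The image of a generator under \<open>(\<rho> \<otimes> \<rho>) \<Delta>\<close>.\<close>

definition rho2_gen :: "ugen \<Rightarrow> (nat \<times> nat, complex fps) matr"
  where "rho2_gen g r c
    = rho_gen g (fst r) (fst c) * (idm (snd r) (snd c) * kap (rwt g) (gidx g) (snd r))
    + idm (fst r) (fst c) * kap (lwt g) (gidx g) (fst r) * rho_gen g (snd r) (snd c)"

interpretation ten: weights n "{1..n} \<times> {1..n}" kap2 rho2_gen for n
proof
  fix r s i
  have "kap2 s i r * kap2 (- s) i r = (kap s i (fst r) * kap (- s) i (fst r)) * (kap s i (snd r) * kap (- s) i (snd r))"
    by (simp only: kap2_def mult_ac)
  then show "kap2 s i r * kap2 (- s) i r = 1"
    by (simp only: kap_inv) simp
qed simp

lemma covariant_Lmat: "vec.covariant n Lmat"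
  by (rule vec.covariantI) (simp_all only: Lmat_def act_uK_entry act_ugen_entry)

lemma covariant_shiftm: "vec.covariant n A \<Longrightarrow> vec.covariant n (shiftm A z)"
proof -
  assume A: "vec.covariant n A"
  have "shiftm A z = (\<lambda>r c. A r c - hscal (fps_const z) * hscalm idm r c)"
    by (intro ext) (simp add: shiftm_def hscalm_def idm_def)
  then show ?thesis
    using vec.covariant_diff[OF A vec.covariant_scal[OF vec.covariant_idm]] by (simp only:)
qed

lemma kron_idm: "kron idm A r c = (if fst r = fst c then A (snd r) (snd c) else (0 :: 'a :: semiring_1))"
  by (simp add: kron_def idm_def case_prod_beta)

text \<open>In the first tensor factor \<open>1 \<otimes> A\<close> is the identity, on which the
  action is trivial; in the second the covariance of \<open>A\<close> applies.\<close>

lemma covariant_kron_idm: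
  assumes A: "vec.covariant n A"
  shows "ten.covariant n (kron idm A)"
proof (rule ten.covariantI)
  fix r c :: "nat \<times> nat" and s i
  assume "r \<in> {1..n} \<times> {1..n}" "c \<in> {1..n} \<times> {1..n}"
  then have rc: "snd r \<in> {1..n}" "snd c \<in> {1..n}"
    by auto
  have "kap (- s) i r1 * kap (- s) i r2 * (kap s i r1 * kap s i c2)
      = kap (- s) i r2 * kap s i c2 * (kap s i r1 * kap (- s) i r1)" for r1 r2 c2
    by (simp only: mult_ac)
  then have *: "kap (- s) i r1 * kap (- s) i r2 * (kap s i r1 * kap s i c2) = kap (- s) i r2 * kap s i c2" for r1 r2 c2
    by (simp only: kap_inv mult_1_right)
  show "act_free n (uK s i) (kron idm A r c) = hscal (kap2 (- s) i r * kap2 s i c) * kron idm A r c"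
    using rc by (simp add: kron_idm vec.covariant_uK[OF A] hlin_0[OF hlin_act] kap2_def *)
next
  fix r c :: "nat \<times> nat" and g
  assume rc: "r \<in> {1..n} \<times> {1..n}" "c \<in> {1..n} \<times> {1..n}"
  obtain r1 r2 c1 c2 where rc12: "r = (r1, r2)" "c = (c1, c2)"
    by (metis surj_pair)
  then have in_n: "r1 \<in> {1..n}" "r2 \<in> {1..n}" "c1 \<in> {1..n}" "c2 \<in> {1..n}"
    using rc by auto
  define l where "l = kap (- lwt g) (gidx g)"
  define l' where "l' = kap (lwt g) (gidx g)"
  define k where "k = kap (rwt g) (gidx g)"
  define k' where "k' = kap (- rwt g) (gidx g)"
  have ll: "l t * l' t = 1" and kk: "k t * k' t = 1" for t
    using kap_inv[of "lwt g" "gidx g" t] kap_inv[of "rwt g" "gidx g" t]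
    by (simp_all add: l_def l'_def k_def k'_def mult.commute)
  \<comment> \<open>The contribution of \<open>g\<close> in the first tensor factor. It occurs in
    both sums and drops out of their difference.\<close>
  define M where "M = hscal (l r1 * l r2 * rho_gen g r1 c1 * k c2) * A r2 c2"
  have 1: "(\<Sum>s\<in>{1..n} \<times> {1..n}. hscal (rho2_gen g s c * kap2 (- lwt g) (gidx g) r) * kron idm A r s)
      = M + (if r1 = c1 then \<Sum>s\<in>{1..n}. hscal (rho_gen g s c2 * l r2) * A r2 s else 0)"
    (is "?L = _")
  proof -
    have "?L = (\<Sum>t\<in>{1..n}. hscal (rho2_gen g (r1, t) (c1, c2) * (l r1 * l r2)) * A r2 t)"
      unfolding sum.cartesian_product' using in_n
      by (subst sum_single_term[of _ r1]) (auto simp: kron_idm rc12 kap2_def l_def)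
    also have "\<dots> = (\<Sum>t\<in>{1..n}. if t = c2 then M else 0)
        + (\<Sum>t\<in>{1..n}. if r1 = c1 then hscal (rho_gen g t c2 * l r2) * A r2 t else 0)"
      unfolding sum.distrib[symmetric]
    proof (intro sum.cong refl)
      fix t
      have "rho2_gen g (r1, t) (c1, c2) * (l r1 * l r2)
          = rho_gen g r1 c1 * (idm t c2 * k t) * (l r1 * l r2) + idm r1 c1 * l' r1 * rho_gen g t c2 * (l r1 * l r2)"
        by (simp add: rho2_gen_def k_def[symmetric] l'_def[symmetric] distrib_right)
      also have "rho_gen g r1 c1 * (idm t c2 * k t) * (l r1 * l r2)
          = idm t c2 * (l r1 * l r2 * rho_gen g r1 c1 * k t)"
        by (simp only: mult_ac)
      also have "idm r1 c1 * l' r1 * rho_gen g t c2 * (l r1 * l r2)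
          = idm r1 c1 * (rho_gen g t c2 * l r2) * (l r1 * l' r1)"
        by (simp only: mult_ac)
      finally have "rho2_gen g (r1, t) (c1, c2) * (l r1 * l r2)
          = idm t c2 * (l r1 * l r2 * rho_gen g r1 c1 * k t) + idm r1 c1 * (rho_gen g t c2 * l r2)"
        by (simp only: ll mult_1_right)
      then show "hscal (rho2_gen g (r1, t) (c1, c2) * (l r1 * l r2)) * A r2 t
          = (if t = c2 then M else 0)
          + (if r1 = c1 then hscal (rho_gen g t c2 * l r2) * A r2 t else 0)"
        by (auto simp: idm_def M_def distrib_right hscal_add)
    qed
    finally show ?thesis
      using in_n by simp
  qed
  have 2: "(\<Sum>s\<in>{1..n} \<times> {1..n}. hscal (kap2 (- lwt g) (gidx g) r * rho2_gen g r s
        * kap2 (- rwt g) (gidx g) s * kap2 (rwt g) (gidx g) c) * kron idm A s c)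
      = M + (if r1 = c1 then \<Sum>s\<in>{1..n}. hscal (l r2 * rho_gen g r2 s * k' s * k c2) * A s c2 else 0)"
    (is "?L = _")
  proof -
    have "?L = (\<Sum>t\<in>{1..n}. hscal (l r1 * l r2 * rho2_gen g (r1, r2) (c1, t)
        * (k' c1 * k' t) * (k c1 * k c2)) * A t c2)"
      unfolding sum.cartesian_product' using in_n
      by (subst sum_single_term[of _ c1]) (auto simp: kron_idm rc12 kap2_def l_def k_def k'_def)
    also have "\<dots> = (\<Sum>t\<in>{1..n}. if t = r2 then M else 0)
        + (\<Sum>t\<in>{1..n}. if r1 = c1 then hscal (l r2 * rho_gen g r2 t * k' t * k c2) * A t c2 else 0)"
      unfolding sum.distrib[symmetric]
    proof (intro sum.cong refl)
      fix t
      have "l r1 * l r2 * rho2_gen g (r1, r2) (c1, t) * (k' c1 * k' t) * (k c1 * k c2)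
          = l r1 * l r2 * rho2_gen g (r1, r2) (c1, t) * k' t * k c2 * (k c1 * k' c1)"
        by (simp only: mult_ac)
      also have "\<dots> = l r1 * l r2 * (rho_gen g r1 c1 * (idm r2 t * k r2)) * k' t * k c2
          + l r1 * l r2 * (idm r1 c1 * l' r1 * rho_gen g r2 t) * k' t * k c2"
        by (simp add: kk rho2_gen_def k_def[symmetric] l'_def[symmetric] distrib_left distrib_right)
      also have "l r1 * l r2 * (rho_gen g r1 c1 * (idm r2 t * k r2)) * k' t * k c2
          = idm r2 t * (l r1 * l r2 * rho_gen g r1 c1 * k c2) * (k r2 * k' t)"
        by (simp only: mult_ac)
      also have "l r1 * l r2 * (idm r1 c1 * l' r1 * rho_gen g r2 t) * k' t * k c2
          = idm r1 c1 * (l r2 * rho_gen g r2 t * k' t * k c2) * (l r1 * l' r1)"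
        by (simp only: mult_ac)
      finally have "l r1 * l r2 * rho2_gen g (r1, r2) (c1, t) * (k' c1 * k' t) * (k c1 * k c2)
          = idm r2 t * (l r1 * l r2 * rho_gen g r1 c1 * k c2) * (k r2 * k' t)
          + idm r1 c1 * (l r2 * rho_gen g r2 t * k' t * k c2)"
        by (simp add: ll)
      then show "hscal (l r1 * l r2 * rho2_gen g (r1, r2) (c1, t) * (k' c1 * k' t) * (k c1 * k c2)) * A t c2
          = (if t = r2 then M else 0)
          + (if r1 = c1 then hscal (l r2 * rho_gen g r2 t * k' t * k c2) * A t c2 else 0)"
        by (auto simp: idm_def M_def kk distrib_right hscal_add)
    qed
    finally show ?thesis
      using in_n by simp
  qed
  show "act_free n (gen g) (kron idm A r c)
      = (\<Sum>s\<in>{1..n} \<times> {1..n}. hscal (rho2_gen g s c * kap2 (- lwt g) (gidx g) r) * kron idm A r s)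
      - (\<Sum>s\<in>{1..n} \<times> {1..n}. hscal (kap2 (- lwt g) (gidx g) r * rho2_gen g r s
        * kap2 (- rwt g) (gidx g) s * kap2 (rwt g) (gidx g) c) * kron idm A s c)"
    unfolding 1 2 using in_n
    by (simp add: rc12 kron_idm vec.covariant_ugen[OF A] hlin_0[OF hlin_act] l_def k_def k'_def)
qed

section \<open>The matrix \<open>S\<close>: entries, Hecke relation and commutation with the quantum
  group\<close>

text \<open>\<open>S\<close> maps \<open>v\<^sub>r\<close> into the span of \<open>v\<^sub>r\<close> and its flip; these are the two coefficients.\<close>

definition Sdiag :: "nat \<times> nat \<Rightarrow> complex fps"
  where "Sdiag r = (if fst r = snd r then qpow 1 else if fst r < snd r then qpow 1 - qpow (- 1) else 0)"

definition Soff :: "nat \<times> nat \<Rightarrow> complex fps"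
  where "Soff r = (if fst r = snd r then 0 else 1)"

lemma Rmat_entry:
  assumes "r1 \<in> {1..n}" "r2 \<in> {1..n}"
  shows "Rmat n (r1, r2) c = (if c = (r2, r1) then Sdiag (r2, r1) else 0)
    + (if c = (r1, r2) then Soff (r1, r2) else 0)"
proof -
  obtain c1 c2 where c: "c = (c1, c2)"
    by (cases c)
  have 1: "(\<Sum>i\<in>{1..n}. kron (munit i i) (munit i i) (r1, r2) (c1, c2))
      = (if r1 = r2 \<and> c1 = r1 \<and> c2 = r1 then 1 else (0 :: complex fps))"
    using assms by (subst sum_single_term[of _ r1]) (auto simp: kron_def munit_def)
  have "(\<Sum>j\<in>{1..n} - {i}. kron (munit i i) (munit j j) (r1, r2) (c1, c2))
      = (if i = r1 then if r1 \<noteq> r2 \<and> c1 = r1 \<and> c2 = r2 then 1 else 0 else (0 :: complex fps))" for i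
  proof -
    have "(\<Sum>j\<in>{1..n} - {i}. kron (munit i i) (munit j j) (r1, r2) (c1, c2))
        = (\<Sum>j\<in>{1..n} - {i}. if j = r2 then if i = r1 \<and> c1 = r1 \<and> c2 = r2 then 1 else 0 else (0 :: complex fps))"
      by (intro sum.cong refl) (auto simp: kron_def munit_def)
    then show ?thesis
      using assms by auto
  qed
  then have 2: "(\<Sum>i\<in>{1..n}. \<Sum>j\<in>{1..n} - {i}. kron (munit i i) (munit j j) (r1, r2) (c1, c2))
      = (if r1 \<noteq> r2 \<and> c1 = r1 \<and> c2 = r2 then 1 else (0 :: complex fps))"
    using assms by simp
  have "(\<Sum>k\<in>{i<..n}. kron (munit k i) (munit i k) (r1, r2) (c1, c2))
      = (if i = r2 then if r2 < r1 \<and> c1 = r2 \<and> c2 = r1 then 1 else 0 else (0 :: complex fps))" for i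
  proof -
    have "(\<Sum>k\<in>{i<..n}. kron (munit k i) (munit i k) (r1, r2) (c1, c2))
        = (\<Sum>k\<in>{i<..n}. if k = r1 then if i = r2 \<and> c1 = r2 \<and> c2 = r1 then 1 else 0 else (0 :: complex fps))"
      by (intro sum.cong refl) (auto simp: kron_def munit_def)
    then show ?thesis
      using assms by auto
  qed
  then have 3: "(\<Sum>i\<in>{1..n}. \<Sum>k\<in>{i<..n}. kron (munit k i) (munit i k) (r1, r2) (c1, c2))
      = (if r2 < r1 \<and> c1 = r2 \<and> c2 = r1 then 1 else (0 :: complex fps))"
    using assms by simp
  show ?thesis
    unfolding Rmat_def c 1 2 3 by (cases r1 r2 rule: linorder_cases) (simp_all add: Sdiag_def Soff_def)
qed

text \<open>If both components of \<open>r\<close> agree, the two alternatives coincide, and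
  \<open>Soff r = 0\<close> prevents counting the entry twice.\<close>

lemma Smat_entry:
  assumes "r \<in> {1..n} \<times> {1..n}"
  shows "Smat n r c = (if c = r then Sdiag r else 0) + (if c = prod.swap r then Soff r else 0)"
proof -
  obtain r1 r2 where r: "r = (r1, r2)" "r1 \<in> {1..n}" "r2 \<in> {1..n}"
    using assms by auto
  have P: "Pmat n (r1, r2) s = (if s = (r2, r1) then 1 else 0)" for s
  proof -
    have "kron (munit i j) (munit j i) (r1, r2) s
        = (if i = r1 then 1 else 0) * (if j = r2 then if s = (r2, r1) then 1 else 0 else (0 :: complex fps))" for i j
      by (cases s) (auto simp: kron_def munit_def)
    then have "Pmat n (r1, r2) s = (\<Sum>i\<in>{1..n}. if i = r1 then 1 else 0)
        * (\<Sum>j\<in>{1..n}. if j = r2 then if s = (r2, r1) then 1 else 0 else 0)"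
      unfolding Pmat_def by (simp only: sum_product)
    then show ?thesis
      using r by simp
  qed
  have "Smat n r c = (\<Sum>s\<in>{1..n} \<times> {1..n}. if s = (r2, r1) then Rmat n s c else 0)"
    unfolding Smat_def mmul_def r(1) P by (intro sum.cong) auto
  also have "\<dots> = Rmat n (r2, r1) c"
    using r by simp
  finally have "Smat n r c = Rmat n (r2, r1) c" .
  moreover have "Soff (r2, r1) = Soff (r1, r2)"
    by (auto simp: Soff_def)
  ultimately show ?thesis
    by (simp only: r(1) swap_simp Rmat_entry[OF r(3,2)])
qed

lemma sum_two_terms:
  fixes f g :: "'i \<Rightarrow> 'a :: comm_monoid_add"
  assumes "finite I" "i \<in> I" "j \<in> I"
  shows "(\<Sum>s\<in>I. (if s = i then f s else 0) + (if s = j then g s else 0)) = f i + g j"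
  using assms by (simp add: sum.distrib)

lemma Smat_mmul:
  assumes "r \<in> {1..n} \<times> {1..n}"
  shows "mmul ({1..n} \<times> {1..n}) (Smat n) X r c = Sdiag r * X r c + Soff r * X (prod.swap r) c"
proof -
  have "mmul ({1..n} \<times> {1..n}) (Smat n) X r c
      = (\<Sum>s\<in>{1..n} \<times> {1..n}. (if s = r then Sdiag r * X s c else 0) + (if s = prod.swap r then Soff r * X s c else 0))"
    unfolding mmul_def using assms by (intro sum.cong) (auto simp: Smat_entry distrib_right)
  then show ?thesis
    using assms by (subst (asm) sum_two_terms) auto
qed

lemma mmul_Smat:
  assumes "c \<in> {1..n} \<times> {1..n}"
  shows "mmul ({1..n} \<times> {1..n}) X (Smat n) r c = X r c * Sdiag c + X r (prod.swap c) * Soff c"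
proof -
  have "mmul ({1..n} \<times> {1..n}) X (Smat n) r c
      = (\<Sum>s\<in>{1..n} \<times> {1..n}. (if s = c then X r s * Sdiag c else 0) + (if s = prod.swap c then X r s * Soff c else 0))"
    unfolding mmul_def using assms
    by (intro sum.cong) (auto simp: Smat_entry distrib_left Soff_def)
  then show ?thesis
    using assms by (subst (asm) sum_two_terms) auto
qed

lemma qpow_1_mult: "qpow 1 * qpow (- 1) = 1" "qpow (- 1) * qpow 1 = 1"
  by (simp_all flip: qpow_add)

text \<open>\<open>S\<close> consists of blocks \<open>q\<close> of size one and blocks of size two
  with diagonal \<open>q - q^(-1)\<close>, \<open>0\<close> and off-diagonal entries 1. Each block
  satisfies \<open>x^2 = 1 + (q - q^(-1)) x\<close>.\<close>

lemma Smat_Hecke: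
  assumes "r \<in> {1..n} \<times> {1..n}"
  shows "mmul ({1..n} \<times> {1..n}) (Smat n) (Smat n) r c
    = idm r c + (qpow 1 - qpow (- 1)) * Smat n r c"
proof -
  have r': "prod.swap r \<in> {1..n} \<times> {1..n}"
    using assms by auto
  have *: "mmul ({1..n} \<times> {1..n}) (Smat n) (Smat n) r c
      = Sdiag r * ((if c = r then Sdiag r else 0) + (if c = prod.swap r then Soff r else 0))
      + Soff r * ((if c = prod.swap r then Sdiag (prod.swap r) else 0) + (if c = r then Soff (prod.swap r) else 0))"
    by (simp only: Smat_mmul[OF assms] Smat_entry[OF assms] Smat_entry[OF r'] swap_swap)
  have idm: "idm r c = (if c = r then 1 else 0)"
    by (simp add: idm_def eq_commute)
  show ?thesis
  proof (cases "fst r = snd r")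
    case True
    then have "prod.swap r = r" "Soff r = 0" "Sdiag r = qpow 1"
      by (simp_all add: Soff_def Sdiag_def prod_eq_iff)
    then show ?thesis
      unfolding * Smat_entry[OF assms] idm by (cases "c = r") (simp_all add: left_diff_distrib qpow_1_mult del: One_nat_def)
  next
    case False
    then have ne: "prod.swap r \<noteq> r"
      by (auto simp: prod_eq_iff)
    have off: "Soff r = 1" "Soff (prod.swap r) = 1"
      using False by (simp_all add: Soff_def)
    have d: "Sdiag r + Sdiag (prod.swap r) = qpow 1 - qpow (- 1)"
      "Sdiag r * Sdiag r = (qpow 1 - qpow (- 1)) * Sdiag r"
      using False by (auto simp: Sdiag_def)
    consider "c = r" | "c = prod.swap r" "c \<noteq> r" | "c \<noteq> r" "c \<noteq> prod.swap r"
      by blast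
    then show ?thesis
    proof cases
      case 1
      then show ?thesis
        using ne ne[symmetric] unfolding * Smat_entry[OF assms] idm by (simp add: off d)
    next
      case 2
      then show ?thesis
        using ne unfolding * Smat_entry[OF assms] idm by (simp add: off d)
    next
      case 3
      then show ?thesis
        unfolding * Smat_entry[OF assms] idm by simp
    qed
  qed
qed

text \<open>A generator of index \<open>i\<close> treats all positions other than \<open>i\<close>
  and \<open>Suc i\<close> alike, so its commutation with \<open>S\<close> is a finite
  check.\<close>

lemma eq_or_eq_Suc_cases:
  fixes x i :: nat
  assumes "x = i \<Longrightarrow> P" "x = Suc i \<Longrightarrow> P" "x \<noteq> i \<Longrightarrow> x \<noteq> Suc i \<Longrightarrow> P"
  shows P
  using assms by blast

lemma Smat_rho2_UH:
  "Sdiag (r1, r2) * rho2_gen (UH i) (r1, r2) (c1, c2) + Soff (r1, r2) * rho2_gen (UH i) (r2, r1) (c1, c2)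
    = rho2_gen (UH i) (r1, r2) (c1, c2) * Sdiag (c1, c2) + rho2_gen (UH i) (r1, r2) (c2, c1) * Soff (c1, c2)"
  by (rule eq_or_eq_Suc_cases[of r1 i]; rule eq_or_eq_Suc_cases[of r2 i];
      rule eq_or_eq_Suc_cases[of c1 i]; rule eq_or_eq_Suc_cases[of c2 i];
      simp add: rho2_gen_def Sdiag_def Soff_def munit_def idm_def kap_def qpow_1_mult
        left_diff_distrib right_diff_distrib less_Suc_eq)

lemma Smat_rho2_UE:
  "Sdiag (r1, r2) * rho2_gen (UE i) (r1, r2) (c1, c2) + Soff (r1, r2) * rho2_gen (UE i) (r2, r1) (c1, c2)
    = rho2_gen (UE i) (r1, r2) (c1, c2) * Sdiag (c1, c2) + rho2_gen (UE i) (r1, r2) (c2, c1) * Soff (c1, c2)"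
  by (rule eq_or_eq_Suc_cases[of r1 i]; rule eq_or_eq_Suc_cases[of r2 i];
      rule eq_or_eq_Suc_cases[of c1 i]; rule eq_or_eq_Suc_cases[of c2 i];
      simp add: rho2_gen_def Sdiag_def Soff_def munit_def idm_def kap_def qpow_1_mult
        left_diff_distrib right_diff_distrib less_Suc_eq)

lemma Smat_rho2_UF:
  "Sdiag (r1, r2) * rho2_gen (UF i) (r1, r2) (c1, c2) + Soff (r1, r2) * rho2_gen (UF i) (r2, r1) (c1, c2)
    = rho2_gen (UF i) (r1, r2) (c1, c2) * Sdiag (c1, c2) + rho2_gen (UF i) (r1, r2) (c2, c1) * Soff (c1, c2)"
  by (rule eq_or_eq_Suc_cases[of r1 i]; rule eq_or_eq_Suc_cases[of r2 i];
      rule eq_or_eq_Suc_cases[of c1 i]; rule eq_or_eq_Suc_cases[of c2 i];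
      simp add: rho2_gen_def Sdiag_def Soff_def munit_def idm_def kap_def qpow_1_mult
        left_diff_distrib right_diff_distrib less_Suc_eq)

text \<open>Since \<open>S = P R\<close>, this is the relation
  \<open>R \<Delta>(x) = \<Delta>^op(x) R\<close> after multiplication by the flip.\<close>

lemma Smat_rho2_gen:
  assumes "r \<in> {1..n} \<times> {1..n}" "c \<in> {1..n} \<times> {1..n}"
  shows "mmul ({1..n} \<times> {1..n}) (rho2_gen g) (Smat n) r c = mmul ({1..n} \<times> {1..n}) (Smat n) (rho2_gen g) r c"
  unfolding Smat_mmul[OF assms(1)] mmul_Smat[OF assms(2)]
  using Smat_rho2_UH Smat_rho2_UE Smat_rho2_UF by (cases g; cases r; cases c) (simp_all only: swap_simp)

lemma covariant_Smat: "ten.covariant n (hscalm (Smat n))"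
proof (rule ten.covariant_hscalm[OF _ Smat_rho2_gen])
  fix r c s i
  assume "r \<in> {1..n} \<times> {1..n}" "Smat n r c \<noteq> 0"
  then have "c = r \<or> c = prod.swap r"
    by (auto simp: Smat_entry split: if_splits)
  then show "kap2 s i r = kap2 s i c"
    by (auto simp: kap2_def mult.commute)
qed

section \<open>Invariance of the quantum trace\<close>

lemma covariant_qtrace_uK:
  assumes "vec.covariant n A"
  shows "act_free n (uK s i) (qtrace n A) = qtrace n A"
  by (simp add: qtrace_def hlin_sum[OF hlin_act] hlin_scal[OF hlin_act] vec.covariant_uK[OF assms]
      kap_inv mult.commute[of "kap (- s) i _"])

lemma covariant_qtrace_ugen:
  assumes "vec.covariant n A"
  shows "act_free n (gen g) (qtrace n A) = 0"
proof -
  define l where "l = kap (- lwt g) (gidx g)"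
  define k where "k = kap (rwt g) (gidx g)"
  define k' where "k' = kap (- rwt g) (gidx g)"
  define d where "d i = qpow (- 2 * int i + 2)" for i :: nat
  \<comment> \<open>Where the trace weights enter: \<open>q^(-2)\<close> between neighbouring
    positions is exactly what balances the \<open>K\<close> factors, the matrix form of
    \<open>\<gamma>^2(x) = D^(-1) x D\<close>.\<close>
  have wt: "d r * (rho_gen g s r * l r) = d s * (l s * rho_gen g s r * k' r * k s)" for r s
    by (cases g) (auto simp: munit_def l_def k_def k'_def d_def kap_def algebra_simps simp flip: qpow_add)
  have "act_free n (gen g) (qtrace n A)
      = (\<Sum>r\<in>{1..n}. \<Sum>s\<in>{1..n}. hscal (d r * (rho_gen g s r * l r)) * A r s)
      - (\<Sum>r\<in>{1..n}. \<Sum>s\<in>{1..n}. hscal (d r * (l r * rho_gen g r s * k' s * k r)) * A s r)"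
    by (simp add: qtrace_def hlin_sum[OF hlin_act] hlin_scal[OF hlin_act] vec.covariant_ugen[OF assms]
        d_def l_def k_def k'_def right_diff_distrib sum_subtractf sum_distrib_left hscal_mult mult.assoc)
  also have "(\<Sum>r\<in>{1..n}. \<Sum>s\<in>{1..n}. hscal (d r * (l r * rho_gen g r s * k' s * k r)) * A s r)
      = (\<Sum>s\<in>{1..n}. \<Sum>r\<in>{1..n}. hscal (d r * (l r * rho_gen g r s * k' s * k r)) * A s r)"
    by (rule sum.swap)
  finally show ?thesis
    by (simp add: wt)
qed

section \<open>Closed ideals and induced morphisms\<close>

lemma free_alg_simps [simp]:
  "x \<otimes>\<^bsub>free_alg X\<^esub> y = x * y" "x \<oplus>\<^bsub>free_alg X\<^esub> y = x + y"
  "\<one>\<^bsub>free_alg X\<^esub> = 1" "\<zero>\<^bsub>free_alg X\<^esub> = 0"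
  by (simp_all add: free_alg_def)

lemma ring_free_alg: "ring (free_alg X)"
proof (rule ringI)
  show "abelian_group (free_alg X)"
  proof (rule abelian_groupI)
    fix x
    assume "x \<in> fcar X"
    then show "\<exists>y\<in>fcar X. y \<oplus>\<^bsub>free_alg X\<^esub> x = \<zero>\<^bsub>free_alg X\<^esub>"
      by (intro bexI[of _ "- x"]) (simp_all add: fcar_uminus)
  qed (simp_all add: fcar_add add.assoc add.commute)
  show "monoid (free_alg X)"
    by (rule monoidI) (simp_all add: fcar_mult mult.assoc)
qed (simp_all add: distrib_left distrib_right)

lemma a_inv_free_alg:
  assumes "x \<in> fcar X"
  shows "inv\<^bsub>add_monoid (free_alg X)\<^esub> x = - x"
proof -
  interpret ring "free_alg X"
    by (rule ring_free_alg)
  show ?thesis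
    using minus_equality[of "- x" x] assms by (simp add: fcar_uminus a_inv_def)
qed

lemma ideal_free_algI:
  assumes "I \<subseteq> fcar X" "0 \<in> I" "\<And>a b. a \<in> I \<Longrightarrow> b \<in> I \<Longrightarrow> a + b \<in> I"
    and "\<And>a x. a \<in> I \<Longrightarrow> x \<in> fcar X \<Longrightarrow> x * a \<in> I" "\<And>a x. a \<in> I \<Longrightarrow> x \<in> fcar X \<Longrightarrow> a * x \<in> I"
  shows "ideal I (free_alg X)"
proof (rule idealI[OF ring_free_alg])
  show "subgroup I (add_monoid (free_alg X))"
  proof (rule subgroup.intro)
    fix a
    assume a: "a \<in> I"
    then have "- a \<in> I"
      using assms(4)[of a "- 1"] by (simp add: fcar_uminus)
    then show "inv\<^bsub>add_monoid (free_alg X)\<^esub> a \<in> I"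
      using a assms(1) by (subst a_inv_free_alg) auto
  qed (use assms(1-3) in auto)
qed (use assms(4,5) in auto)

lemma ideal_free_algE:
  assumes "ideal I (free_alg X)"
  shows "I \<subseteq> fcar X" "0 \<in> I" "\<And>a b. a \<in> I \<Longrightarrow> b \<in> I \<Longrightarrow> a + b \<in> I"
    "\<And>a x. a \<in> I \<Longrightarrow> x \<in> fcar X \<Longrightarrow> x * a \<in> I" "\<And>a x. a \<in> I \<Longrightarrow> x \<in> fcar X \<Longrightarrow> a * x \<in> I"
    "\<And>a. a \<in> I \<Longrightarrow> - a \<in> I" "\<And>a b. a \<in> I \<Longrightarrow> b \<in> I \<Longrightarrow> a - b \<in> I"
    "\<And>a c. a \<in> I \<Longrightarrow> hscal c * a \<in> I"
    "\<And>f A. (\<And>i. i \<in> A \<Longrightarrow> f i \<in> I) \<Longrightarrow> sum f A \<in> I"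
proof -
  interpret ideal I "free_alg X"
    by fact
  show 1: "I \<subseteq> fcar X" "0 \<in> I" and 2: "\<And>a b. a \<in> I \<Longrightarrow> b \<in> I \<Longrightarrow> a + b \<in> I"
    using a_subset additive_subgroup.a_closed[OF additive_subgroup_axioms]
      additive_subgroup.zero_closed[OF additive_subgroup_axioms] by simp_all
  show 3: "\<And>a x. a \<in> I \<Longrightarrow> x \<in> fcar X \<Longrightarrow> x * a \<in> I" "\<And>a x. a \<in> I \<Longrightarrow> x \<in> fcar X \<Longrightarrow> a * x \<in> I"
    using I_l_closed I_r_closed by simp_all
  show 4: "\<And>a. a \<in> I \<Longrightarrow> - a \<in> I"
    using 3(1)[of _ "- 1"] by (simp add: fcar_uminus)
  show "a - b \<in> I" if "a \<in> I" "b \<in> I" for a b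
    using 2[OF that(1) 4[OF that(2)]] by simp
  show "\<And>a c. a \<in> I \<Longrightarrow> hscal c * a \<in> I"
    using 3(1) by simp
  show "sum f A \<in> I" if "\<And>i. i \<in> A \<Longrightarrow> f i \<in> I" for f A
    using that by (induction A rule: infinite_finite_induct) (simp_all add: 1(2) 2)
qed

lemma hlin_closure:
  assumes "hlin \<phi>" "hclosed J" "\<And>a. a \<in> A \<Longrightarrow> \<phi> a \<in> J" "a \<in> closure A"
  shows "\<phi> a \<in> J"
proof -
  have "\<exists>j\<in>J. \<exists>v. \<phi> a = j + hscal (fps_X ^ k) * v" for k
  proof -
    obtain b v where "b \<in> A" "a = b + hscal (fps_X ^ k) * v"
      using assms(4) unfolding closure_hser_iff by blast
    then have "\<phi> a = \<phi> b + hscal (fps_X ^ k) * \<phi> v" "\<phi> b \<in> J"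
      using assms(3) by (simp_all add: hlin_add[OF assms(1)] hlin_scal[OF assms(1)])
    then show ?thesis
      by blast
  qed
  then show ?thesis
    using assms(2) unfolding hclosed_def by blast
qed

text \<open>One-sided multiplications are linear, hence continuous, so they carry the closure of the
  ideal into itself.\<close>

lemma ideal_closed_ideal:
  assumes "S \<subseteq> fcar X"
  shows "ideal (closed_ideal X S) (free_alg X)"
proof -
  let ?I = "Idl\<^bsub>free_alg X\<^esub> S"
  have I: "ideal ?I (free_alg X)"
    by (rule ring.genideal_ideal[OF ring_free_alg assms])
  have cl: "?I \<subseteq> closed_ideal X S"
    unfolding closed_ideal_def by (rule closure_subset)
  have hcl: "hclosed (closed_ideal X S)"
    unfolding closed_ideal_def by (rule hclosed_closure)
  show ?thesis
  proof (rule ideal_free_algI)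
    show "closed_ideal X S \<subseteq> fcar X"
      unfolding closed_ideal_def by (rule closure_hclosed[OF hclosed_fcar ideal_free_algE(1)[OF I]])
    show "0 \<in> closed_ideal X S"
      using ideal_free_algE(2)[OF I] cl by blast
    fix a
    assume a: "a \<in> closed_ideal X S"
    show "x * a \<in> closed_ideal X S" if "x \<in> fcar X" for x
    proof (rule hlin_closure[OF hlin_lmult[OF hlin_id] hcl])
      show "a \<in> closure ?I"
        using a by (simp add: closed_ideal_def)
    qed (use ideal_free_algE(4)[OF I _ that] cl in blast)
    show "a * x \<in> closed_ideal X S" if "x \<in> fcar X" for x
    proof (rule hlin_closure[OF hlin_rmult[OF hlin_id] hcl])
      show "a \<in> closure ?I"
        using a by (simp add: closed_ideal_def)
    qed (use ideal_free_algE(5)[OF I _ that] cl in blast)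
    fix b
    assume b: "b \<in> closed_ideal X S"
    show "a + b \<in> closed_ideal X S"
      unfolding closed_ideal_def closure_hser_iff
    proof
      fix k
      obtain a' v b' w where "a' \<in> ?I" "a = a' + hscal (fps_X ^ k) * v" "b' \<in> ?I" "b = b' + hscal (fps_X ^ k) * w"
        using a b unfolding closed_ideal_def closure_hser_iff by meson
      then have "a' + b' \<in> ?I" "a + b = (a' + b') + hscal (fps_X ^ k) * (v + w)"
        using ideal_free_algE(3)[OF I] by (simp_all add: distrib_left)
      then show "\<exists>j\<in>?I. \<exists>v. a + b = j + hscal (fps_X ^ k) * v"
        by blast
    qed
  qed
qed

lemma hclosed_closed_ideal: "hclosed (closed_ideal X S)"
  unfolding closed_ideal_def by (rule hclosed_closure)

lemma subset_closed_ideal: "S \<subseteq> fcar X \<Longrightarrow> S \<subseteq> closed_ideal X S"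
  unfolding closed_ideal_def
  using ring.genideal_self[OF ring_free_alg] closure_subset by blast

text \<open>Reduces a claim about the closed ideal to finding any ideal that contains the relations
  and is mapped into a closed set.\<close>

lemma hlin_closed_ideal:
  assumes "hlin \<phi>" "hclosed J" "ideal I (free_alg X)" "S \<subseteq> I" "\<And>a. a \<in> I \<Longrightarrow> \<phi> a \<in> J"
    and "a \<in> closed_ideal X S"
  shows "\<phi> a \<in> J"
proof (rule hlin_closure[OF assms(1,2)])
  show "a \<in> closure (Idl\<^bsub>free_alg X\<^esub> S)"
    using assms(6) by (simp add: closed_ideal_def)
qed (use ring.genideal_minimal[OF ring_free_alg assms(3,4)] assms(5) in blast)

lemma act_closed_ideal:
  fixes n :: nat and S :: "lgen word hser set"
  defines "J \<equiv> closed_ideal (lgens n) S"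
  assumes S: "S \<subseteq> fcar (lgens n)"
    and gens: "\<And>g a. a \<in> S \<Longrightarrow> act_free n (gen g) a \<in> J"
    and uK: "\<And>s i a. a \<in> S \<Longrightarrow> act_free n (uK s i) a \<in> J"
    and a: "a \<in> J"
  shows "act_free n x a \<in> J"
proof -
  note J = ideal_free_algE[OF ideal_closed_ideal[OF S], folded J_def]
  \<comment> \<open>The skew Leibniz rule for a generator involves \<open>K_i^s\<close> acting on
    the other factor, so both stability conditions are imposed together to obtain an ideal.\<close>
  define I where "I = {a \<in> J. (\<forall>g. act_free n (gen g) a \<in> J) \<and> (\<forall>s i. act_free n (uK s i) a \<in> J)}"
  have I: "ideal I (free_alg (lgens n))"
  proof (rule ideal_free_algI)
    show "I \<subseteq> fcar (lgens n)"
      using J(1) by (auto simp: I_def)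
    show "0 \<in> I"
      using J(2) by (auto simp: I_def hlin_0[OF hlin_act])
    show "a + b \<in> I" if "a \<in> I" "b \<in> I" for a b
      using that J(3) by (auto simp: I_def hlin_add[OF hlin_act])
    show "x * a \<in> I" if "a \<in> I" "x \<in> fcar (lgens n)" for a x
      using that J(3,4) by (auto simp: I_def act_ugen_mult act_uK_mult fcar_act)
    show "a * x \<in> I" if "a \<in> I" "x \<in> fcar (lgens n)" for a x
      using that J(3,5) by (auto simp: I_def act_ugen_mult act_uK_mult fcar_act)
  qed
  have SI: "S \<subseteq> I"
    using gens uK subset_closed_ideal[OF S] by (auto simp: I_def J_def)
  have hJ: "hclosed J"
    unfolding J_def by (rule hclosed_closed_ideal)
  note lin = hlin_closed_ideal[OF hlin_act hJ I SI, folded J_def]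
  have gensJ: "act_free n (gen g) a \<in> J" if "a \<in> J" for g a
    by (rule lin[OF _ that]) (auto simp: I_def)
  have uKJ: "act_free n (uK s i) a \<in> J" if "a \<in> J" for s i a
    by (rule lin[OF _ that]) (auto simp: I_def)
  have word: "act_free n (hmon (Word gs)) a \<in> J" for gs
  proof (induction gs)
    case Nil
    then show ?case
      \<comment> \<open>The empty word is the unit, which is \<open>K_0^0\<close>.\<close>
      using uKJ[OF a, of 0 0] by simp
  next
    case (Cons g gs)
    then show ?case
      using J(1) a by (auto simp: hmon_Cons act_mult intro!: gensJ)
  qed
  show ?thesis
  proof (rule hlin_mem[OF hlin_act_left])
    show "act_free n (hmon w) a \<in> J" for w
      using word[of "letters w"] by simp
  qed (use J hJ in auto)
qed

section \<open>Classes modulo a closed ideal\<close>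

lemma cls_eq: "cls X S a = (\<lambda>j. j + a) ` closed_ideal X S"
  by (auto simp: cls_def a_r_coset_def')

lemma cls_eq_iff:
  assumes "S \<subseteq> fcar X"
  shows "cls X S a = cls X S b \<longleftrightarrow> a - b \<in> closed_ideal X S"
proof -
  note J = ideal_free_algE[OF ideal_closed_ideal[OF assms]]
  show ?thesis
  proof
    assume "cls X S a = cls X S b"
    then have "0 + a \<in> cls X S b"
      using J(2) unfolding cls_eq by blast
    then show "a - b \<in> closed_ideal X S"
      by (auto simp: cls_eq)
  next
    have sub: "cls X S a \<subseteq> cls X S b" if "a - b \<in> closed_ideal X S" for a b
    proof
      fix x
      assume "x \<in> cls X S a"
      then obtain j where "j \<in> closed_ideal X S" "x = j + a"
        by (auto simp: cls_eq)
      then have "j + (a - b) \<in> closed_ideal X S" "x = (j + (a - b)) + b"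
        using J(3) that by auto
      then show "x \<in> cls X S b"
        unfolding cls_eq by blast
    qed
    assume ab: "a - b \<in> closed_ideal X S"
    then have "b - a \<in> closed_ideal X S"
      using J(6) by fastforce
    with ab show "cls X S a = cls X S b"
      using sub by blast
  qed
qed

lemma mem_cls: "a \<in> cls X S b \<Longrightarrow> a - b \<in> closed_ideal X S"
  by (auto simp: cls_eq)

lemma self_mem_cls:
  assumes "S \<subseteq> fcar X"
  shows "a \<in> cls X S a"
  using ideal_free_algE(2)[OF ideal_closed_ideal[OF assms]] by (force simp: cls_eq)

lemma carrier_presented_alg: "carrier (presented_alg X S) = cls X S ` fcar X"
  by (auto simp: presented_alg_def FactRing_def A_RCOSETS_def' cls_def)

lemma cls_hom:
  assumes "S \<subseteq> fcar X"
  shows "cls X S \<in> ring_hom (free_alg X) (presented_alg X S)"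
  using ideal.rcos_ring_hom[OF ideal_closed_ideal[OF assms]]
  unfolding presented_alg_def cls_def[abs_def] by simp

lemma presented_alg_ops:
  assumes "S \<subseteq> fcar X" "a \<in> fcar X" "b \<in> fcar X"
  shows "cls X S a \<otimes>\<^bsub>presented_alg X S\<^esub> cls X S b = cls X S (a * b)"
    "cls X S a \<oplus>\<^bsub>presented_alg X S\<^esub> cls X S b = cls X S (a + b)"
    "\<one>\<^bsub>presented_alg X S\<^esub> = cls X S 1"
  using ring_hom_mult[OF cls_hom[OF assms(1)] assms(2,3)] ring_hom_add[OF cls_hom[OF assms(1)] assms(2,3)]
    ring_hom_one[OF cls_hom[OF assms(1)]] by simp_all

section \<open>Substitution of a matrix for the generators\<close>

definition subst :: "(nat, lgen word hser) matr \<Rightarrow> lgen word hser \<Rightarrow> lgen word hser"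
  where "subst F = hext (\<lambda>w. prod_list (map (\<lambda>(r, c). F r c) (letters w)))"

lemma hlin_subst: "hlin (subst F)"
  unfolding subst_def by (rule hlin_hext)

lemma subst_mult: "subst F (a * b) = subst F a * subst F b"
  unfolding subst_def by (rule hext_mult_words)

lemma subst_1 [simp]: "subst F 1 = 1"
  by (simp add: subst_def)

lemma subst_hscal: "subst F (hscal c) = hscal c"
  using hlin_hscal[OF hlin_subst] by simp

lemma subst_gen: "subst F (gen (r, c)) = F r c"
  by (simp add: subst_def)

lemma subst_fcar:
  assumes "\<And>r c. r \<in> {1..n} \<Longrightarrow> c \<in> {1..n} \<Longrightarrow> F r c \<in> fcar (lgens n)" "a \<in> fcar (lgens n)"
  shows "subst F a \<in> fcar (lgens n)"
proof (rule hlin_fcar[OF hlin_subst assms(2)])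
  have "prod_list (map (\<lambda>(r, c). F r c) ps) \<in> fcar (lgens n)" if "set ps \<subseteq> lgens n" for ps
    using that
  proof (induction ps)
    case (Cons p ps)
    then have "(case p of (r, c) \<Rightarrow> F r c) \<in> fcar (lgens n)"
      using assms(1) by (cases p) (simp add: lgens_def[of n])
    with Cons show ?case
      by (simp add: fcar_mult)
  qed simp
  then show "subst F (hmon w) \<in> fcar (lgens n)" if "set (letters w) \<subseteq> lgens n" for w
    using that by (simp add: subst_def)
qed

text \<open>Both sides are multiplicative in \<open>a\<close>; on generators the claim says that
  \<open>F\<close> transforms like \<open>Lmat\<close>.\<close>

lemma subst_act_uK:
  assumes "vec.covariant n F" "a \<in> fcar (lgens n)"
  shows "subst F (act_free n (uK s i) a) = act_free n (uK s i) (subst F a)"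
proof (rule hlin_eqI_fcar[OF assms(2) hlin_comp[OF hlin_subst hlin_act] hlin_comp[OF hlin_act hlin_subst]])
  show "subst F (act_free n (uK s i) 1) = act_free n (uK s i) (subst F 1)"
    by (simp add: act_1 counit'_uK)
  fix p w
  assume "p \<in> lgens n"
  then have "subst F (act_free n (uK s i) (gen p)) = act_free n (uK s i) (subst F (gen p))"
    by (cases p) (simp add: lgens_def act_uK_entry hlin_scal[OF hlin_subst] subst_gen vec.covariant_uK[OF assms(1)])
  moreover assume "subst F (act_free n (uK s i) (hmon w)) = act_free n (uK s i) (subst F (hmon w))"
  ultimately show "subst F (act_free n (uK s i) (gen p * hmon w)) = act_free n (uK s i) (subst F (gen p * hmon w))"
    by (simp add: act_uK_mult subst_mult)
qed

lemma subst_act_ugen: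
  assumes F: "vec.covariant n F" and a: "a \<in> fcar (lgens n)"
  shows "subst F (act_free n (gen g) a) = act_free n (gen g) (subst F a)"
proof (rule hlin_eqI_fcar[OF a hlin_comp[OF hlin_subst hlin_act] hlin_comp[OF hlin_act hlin_subst]])
  show "subst F (act_free n (gen g) 1) = act_free n (gen g) (subst F 1)"
    by (simp add: act_1 counit'_gen hlin_0[OF hlin_subst])
  fix p w
  assume p: "p \<in> lgens n" and w: "set (letters w) \<subseteq> lgens n"
  have "subst F (act_free n (gen g) (gen p)) = act_free n (gen g) (subst F (gen p))"
    using p by (cases p) (simp add: lgens_def act_ugen_entry hlin_diff[OF hlin_subst] hlin_sum[OF hlin_subst]
        hlin_scal[OF hlin_subst] subst_gen vec.covariant_ugen[OF F])
  moreover assume "subst F (act_free n (gen g) (hmon w)) = act_free n (gen g) (subst F (hmon w))"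
  moreover note subst_act_uK[OF F fcar_gen[OF p]] subst_act_uK[OF F fcar_hmon[OF w]]
  ultimately show "subst F (act_free n (gen g) (gen p * hmon w)) = act_free n (gen g) (subst F (gen p * hmon w))"
    by (simp add: act_ugen_mult subst_mult hlin_add[OF hlin_subst])
qed

lemma subst_act:
  assumes F: "vec.covariant n F" "\<And>r c. r \<in> {1..n} \<Longrightarrow> c \<in> {1..n} \<Longrightarrow> F r c \<in> fcar (lgens n)"
    and a: "a \<in> fcar (lgens n)"
  shows "subst F (act_free n x a) = act_free n x (subst F a)"
proof (rule hlin_eqI[OF hlin_comp[OF hlin_subst hlin_act_left] hlin_act_left])
  fix w
  have sa: "subst F a \<in> fcar (lgens n)"
    using F(2) a by (rule subst_fcar)
  have "subst F (act_free n (hmon (Word gs)) a) = act_free n (hmon (Word gs)) (subst F a)" for gs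
  proof (induction gs)
    case Nil
    then show ?case
      using subst_act_uK[OF F(1) a, of 0 0] by simp
  next
    case (Cons g gs)
    then show ?case
      using a sa by (simp add: hmon_Cons act_mult subst_act_ugen[OF F(1) fcar_act])
  qed
  from this[of "letters w"] show "subst F (act_free n (hmon w) a) = act_free n (hmon w) (subst F a)"
    by simp
qed

lemma equivariant_morphismI:
  assumes S: "S \<subseteq> fcar (lgens n)" and T: "T \<subseteq> fcar (lgens n)"
    and inv: "\<And>x a. a \<in> closed_ideal (lgens n) T \<Longrightarrow> act_free n x a \<in> closed_ideal (lgens n) T"
    and F: "vec.covariant n F" "\<And>r c. r \<in> {1..n} \<Longrightarrow> c \<in> {1..n} \<Longrightarrow> F r c \<in> fcar (lgens n)"
    and rel: "\<And>a. a \<in> S \<Longrightarrow> subst F a \<in> closed_ideal (lgens n) T"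
  shows "\<exists>\<pi>. equivariant_morphism n S T \<pi>
    \<and> (\<forall>i\<in>{1..n}. \<forall>j\<in>{1..n}. \<pi> (cls (lgens n) S (Lmat i j)) = cls (lgens n) T (F i j))"
proof -
  let ?X = "lgens n"
  let ?JS = "closed_ideal ?X S" and ?JT = "closed_ideal ?X T"
  note JS = ideal_free_algE[OF ideal_closed_ideal[OF S]]
  note JT = ideal_free_algE[OF ideal_closed_ideal[OF T]]
  have sf: "subst F a \<in> fcar ?X" if "a \<in> fcar ?X" for a
    using F(2) that by (rule subst_fcar)
  define I where "I = {a \<in> fcar ?X. subst F a \<in> ?JT}"
  have I: "ideal I (free_alg ?X)"
  proof (rule ideal_free_algI)
    show "0 \<in> I"
      using JT(2) by (simp add: I_def hlin_0[OF hlin_subst])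
    show "a + b \<in> I" if "a \<in> I" "b \<in> I" for a b
      using that JT(3) by (simp add: I_def hlin_add[OF hlin_subst] fcar_add)
    show "x * a \<in> I" if "a \<in> I" "x \<in> fcar ?X" for a x
      using that JT(4)[OF _ sf[OF that(2)]] by (simp add: I_def subst_mult fcar_mult)
    show "a * x \<in> I" if "a \<in> I" "x \<in> fcar ?X" for a x
      using that JT(5)[OF _ sf[OF that(2)]] by (simp add: I_def subst_mult fcar_mult)
  qed (auto simp: I_def)
  have subst_J: "subst F a \<in> ?JT" if "a \<in> ?JS" for a
    by (rule hlin_closed_ideal[OF hlin_subst hclosed_closed_ideal I _ _ that])
      (use S rel in \<open>auto simp: I_def\<close>)
  \<comment> \<open>The chosen representative is harmless: two of them differ by an element of the
    source ideal, which \<open>subst_J\<close> sends into the target ideal.\<close>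
  define \<pi> where "\<pi> C = cls ?X T (subst F (SOME a. a \<in> C))" for C
  have \<pi>: "\<pi> (cls ?X S a) = cls ?X T (subst F a)" for a
  proof -
    have "(SOME b. b \<in> cls ?X S a) \<in> cls ?X S a"
      using self_mem_cls[OF S] by (rule someI)
    then have "subst F ((SOME b. b \<in> cls ?X S a) - a) \<in> ?JT"
      by (intro subst_J mem_cls)
    then show ?thesis
      by (simp add: \<pi>_def cls_eq_iff[OF T] hlin_diff[OF hlin_subst])
  qed
  have hom: "\<pi> \<in> ring_hom (quot_alg n S) (quot_alg n T)"
  proof (rule ring_hom_memI)
    show "\<pi> C \<in> carrier (quot_alg n T)" if "C \<in> carrier (quot_alg n S)" for C
      using that sf by (auto simp: carrier_presented_alg \<pi>)
    show "\<pi> (C \<otimes>\<^bsub>quot_alg n S\<^esub> D) = \<pi> C \<otimes>\<^bsub>quot_alg n T\<^esub> \<pi> D"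
      if "C \<in> carrier (quot_alg n S)" "D \<in> carrier (quot_alg n S)" for C D
      using that sf by (auto simp: carrier_presented_alg \<pi> presented_alg_ops[OF S] presented_alg_ops[OF T] subst_mult)
    show "\<pi> (C \<oplus>\<^bsub>quot_alg n S\<^esub> D) = \<pi> C \<oplus>\<^bsub>quot_alg n T\<^esub> \<pi> D"
      if "C \<in> carrier (quot_alg n S)" "D \<in> carrier (quot_alg n S)" for C D
      using that sf by (auto simp: carrier_presented_alg \<pi> presented_alg_ops[OF S] presented_alg_ops[OF T]
          hlin_add[OF hlin_subst])
    show "\<pi> \<one>\<^bsub>quot_alg n S\<^esub> = \<one>\<^bsub>quot_alg n T\<^esub>"
      by (simp add: presented_alg_ops(3)[OF S fcar_1 fcar_1] presented_alg_ops(3)[OF T fcar_1 fcar_1] \<pi>)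
  qed
  have equiv: "\<pi> (uh_act n S X C) = uh_act n T X (\<pi> C)" if C: "C \<in> carrier (quot_alg n S)" for X C
  proof -
    \<comment> \<open>The same \<open>x\<close> serves both sides, whereas \<open>b\<close> and
      \<open>subst F a\<close> are two representatives of one class. Stability of the target ideal
      removes the difference.\<close>
    define x a b where "x = (SOME x. x \<in> X)" and "a = (SOME a. a \<in> C)" and "b = (SOME b. b \<in> \<pi> C)"
    obtain a' where a': "a' \<in> fcar ?X" "C = cls ?X S a'"
      using C by (auto simp: carrier_presented_alg)
    then have "a \<in> C"
      unfolding a_def using self_mem_cls[OF S] by (metis someI)
    then have "a - a' \<in> ?JS"
      using a' mem_cls by blast
    then have a: "a \<in> fcar ?X" "C = cls ?X S a"
      using JS(1) a' fcar_add[of "a - a'" ?X a'] cls_eq_iff[OF S, of a a'] by auto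
    have "b \<in> \<pi> C"
      unfolding b_def a(2) \<pi> using self_mem_cls[OF T] by (rule someI)
    then have "b - subst F a \<in> ?JT"
      unfolding a(2) \<pi> by (rule mem_cls)
    then have "act_free n x (b - subst F a) \<in> ?JT"
      by (rule inv)
    then have "cls ?X T (act_free n x b) = cls ?X T (act_free n x (subst F a))"
      by (simp add: cls_eq_iff[OF T] hlin_diff[OF hlin_act])
    moreover have "subst F (act_free n x a) = act_free n x (subst F a)"
      using F a(1) by (rule subst_act)
    ultimately show ?thesis
      by (simp add: uh_act_def \<pi> flip: x_def a_def b_def)
  qed
  have "equivariant_morphism n S T \<pi>"
    unfolding equivariant_morphism_def using hom equiv by (simp add: \<pi> subst_hscal)
  moreover have "\<pi> (cls ?X S (Lmat i j)) = cls ?X T (F i j)" for i j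
    by (simp add: \<pi> Lmat_def subst_gen)
  ultimately show ?thesis
    by blast
qed

section \<open>The reflection equation for the quadratic matrix\<close>

text \<open>Otherwise \<open>{1..n}\<close> is rewritten to \<open>{Suc 0..n}\<close> and stops
  matching the index sets in the rules.\<close>

declare One_nat_def [simp del]

text \<open>Named operations keep matrices as opaque terms, so noncommutative computations become
  rewriting with associativity and distributivity.\<close>

definition madd :: "('i, 'a :: plus) matr \<Rightarrow> ('i, 'a) matr \<Rightarrow> ('i, 'a) matr" (infixl \<open>\<boxplus>\<close> 65)
  where "A \<boxplus> B = (\<lambda>r c. A r c + B r c)"

definition mdiff :: "('i, 'a :: minus) matr \<Rightarrow> ('i, 'a) matr \<Rightarrow> ('i, 'a) matr" (infixl \<open>\<boxminus>\<close> 65)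
  where "A \<boxminus> B = (\<lambda>r c. A r c - B r c)"

definition mscal :: "complex fps \<Rightarrow> ('i, 'm :: monoid_add hser) matr \<Rightarrow> ('i, 'm hser) matr" (infixr \<open>\<odot>\<close> 75)
  where "z \<odot> A = (\<lambda>r c. hscal z * A r c)"

lemma mmul_madd:
  "mmul I (A \<boxplus> B) C = mmul I A C \<boxplus> mmul I B C" "mmul I C (A \<boxplus> B) = mmul I C A \<boxplus> mmul I C B"
  by (simp_all add: mmul_def madd_def distrib_right distrib_left sum.distrib)

lemma mmul_mdiff:
  fixes A B C :: "('i, 'a :: ring) matr"
  shows "mmul I (A \<boxminus> B) C = mmul I A C \<boxminus> mmul I B C" "mmul I C (A \<boxminus> B) = mmul I C A \<boxminus> mmul I C B"
  by (simp_all add: mmul_def mdiff_def left_diff_distrib right_diff_distrib sum_subtractf)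

lemma mmul_mscal: "mmul I (z \<odot> A) C = z \<odot> mmul I A C" "mmul I C (z \<odot> A) = z \<odot> mmul I C A"
  by (simp_all add: mmul_def mscal_def sum_distrib_left mult.assoc hscal_left_commute)

lemma mscal_madd: "z \<odot> (A \<boxplus> B) = z \<odot> A \<boxplus> z \<odot> B"
  by (simp add: mscal_def madd_def distrib_left)

lemma mscal_commute: "z \<odot> y \<odot> A = y \<odot> z \<odot> A"
  by (simp add: mscal_def mult.commute flip: mult.assoc hscal_mult)

text \<open>Matrix algebra modulo \<open>J\<close> without passing to cosets. Entries count only
  inside \<open>I\<close>, since matrices are total functions, and multiplication needs
  \<open>mcar\<close> because \<open>J\<close> absorbs only series over \<open>X\<close>.\<close>

locale matrix_congruence =
  fixes X :: "'x set" and J :: "'x word hser set" and I :: "'i set"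
  assumes J: "ideal J (free_alg X)" and finite_I: "finite I"
begin

abbreviation mmul_I :: "('i, 'x word hser) matr \<Rightarrow> ('i, 'x word hser) matr \<Rightarrow> ('i, 'x word hser) matr" (infixl \<open>\<star>\<close> 70)
  where "A \<star> B \<equiv> mmul I A B"

definition mcong :: "('i, 'x word hser) matr \<Rightarrow> ('i, 'x word hser) matr \<Rightarrow> bool" (infix \<open>\<bumpeq>\<close> 50)
  where "A \<bumpeq> B \<longleftrightarrow> (\<forall>r\<in>I. \<forall>c\<in>I. A r c - B r c \<in> J)"

definition mcar :: "('i, 'x word hser) matr \<Rightarrow> bool"
  where "mcar A \<longleftrightarrow> (\<forall>r\<in>I. \<forall>c\<in>I. A r c \<in> fcar X)"

lemmas J_rules = ideal_free_algE[OF J]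

lemma mcong_eqI: "(\<And>r c. r \<in> I \<Longrightarrow> c \<in> I \<Longrightarrow> A r c = B r c) \<Longrightarrow> A \<bumpeq> B"
  by (simp add: mcong_def J_rules(2))

lemma mcong_refl [simp]: "A \<bumpeq> A"
  by (rule mcong_eqI) simp

lemma mcong_sym: "A \<bumpeq> B \<Longrightarrow> B \<bumpeq> A"
  unfolding mcong_def using J_rules(6) by fastforce

lemma mcong_trans [trans]: "A \<bumpeq> B \<Longrightarrow> B \<bumpeq> C \<Longrightarrow> A \<bumpeq> C"
  unfolding mcong_def using J_rules(3) by fastforce

lemma mcong_madd: "A \<bumpeq> A' \<Longrightarrow> B \<bumpeq> B' \<Longrightarrow> A \<boxplus> B \<bumpeq> A' \<boxplus> B'"
  unfolding mcong_def madd_def using J_rules(3) by (fastforce simp: add_diff_add)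

lemma mcong_mdiff: "A \<bumpeq> A' \<Longrightarrow> B \<bumpeq> B' \<Longrightarrow> A \<boxminus> B \<bumpeq> A' \<boxminus> B'"
proof -
  assume "A \<bumpeq> A'" "B \<bumpeq> B'"
  then have "(A r c - A' r c) - (B r c - B' r c) \<in> J" if "r \<in> I" "c \<in> I" for r c
    using that by (simp add: mcong_def J_rules(7))
  then show ?thesis
    by (simp add: mcong_def mdiff_def algebra_simps)
qed

lemma mcong_mscal: "A \<bumpeq> B \<Longrightarrow> z \<odot> A \<bumpeq> z \<odot> B"
  by (simp add: mcong_def mscal_def J_rules(8) flip: right_diff_distrib)

lemma mcong_left: "mcar C \<Longrightarrow> A \<bumpeq> B \<Longrightarrow> C \<star> A \<bumpeq> C \<star> B"
  by (auto simp: mcong_def mcar_def mmul_def simp flip: sum_subtractf right_diff_distrib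
      intro!: J_rules(9) J_rules(4))

lemma mcong_right: "mcar C \<Longrightarrow> A \<bumpeq> B \<Longrightarrow> A \<star> C \<bumpeq> B \<star> C"
  by (auto simp: mcong_def mcar_def mmul_def simp flip: sum_subtractf left_diff_distrib
      intro!: J_rules(9) J_rules(5))

lemma mcar_mmul: "mcar A \<Longrightarrow> mcar B \<Longrightarrow> mcar (A \<star> B)"
  by (auto simp: mcar_def mmul_def intro!: fcar_sum fcar_mult)

lemma mcar_mdiff: "mcar A \<Longrightarrow> mcar B \<Longrightarrow> mcar (A \<boxminus> B)"
  by (auto simp: mcar_def mdiff_def intro!: fcar_diff)

lemma mcar_mscal: "mcar A \<Longrightarrow> mcar (z \<odot> A)"
  by (auto simp: mcar_def mscal_def intro!: fcar_scal)

lemma mcong_idm: "idm \<star> A \<bumpeq> A" "A \<star> idm \<bumpeq> A"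
  by (auto intro!: mcong_eqI simp: mmul_def idm_def finite_I if_distrib[of "\<lambda>x. x * _"]
      if_distrib[of "\<lambda>x. _ * x"] cong: if_cong)

text \<open>
  The square \<open>L\<^sup>2\<close> alone does not satisfy the reflection equation: by the Hecke relation
  \<open>[L\<^sup>2, S L\<^sup>2 S]\<close> leaves a term \<open>w [L\<^sup>2, S L S L S]\<close>. For \<open>F = L\<^sup>2 - a L\<close> with \<open>L F = c L = F L\<close> both
  \<open>F S L S L S\<close> and \<open>S L S L S F\<close> reduce to \<open>c L S L + w c S L S L\<close>.
\<close>

lemma reflection_equation_quadratic:
  assumes S: "mcar S" and L: "mcar L" and Hecke: "S \<star> S \<bumpeq> idm \<boxplus> w \<odot> S"
    and RE: "S \<star> L \<star> S \<star> L \<bumpeq> L \<star> S \<star> L \<star> S"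
    and F: "F = L \<star> L \<boxminus> a \<odot> L" and LF: "L \<star> F \<bumpeq> c \<odot> L" and FL: "F \<star> L \<bumpeq> c \<odot> L"
  shows "S \<star> F \<star> S \<star> F \<bumpeq> F \<star> S \<star> F \<star> S"
proof -
  note car = mcar_mmul S L
  have Fc: "mcar F"
    unfolding F by (intro mcar_mdiff mcar_mscal car)
  let ?M = "S \<star> L \<star> S"
  let ?K = "?M \<star> L \<star> S"
  note assoc = mmul_assoc[of I]
  \<comment> \<open>Read this way, the reflection equation says that \<open>S L S\<close> commutes
    with \<open>L\<close>, hence with every polynomial in \<open>L\<close>.\<close>
  have M_comm: "?M \<star> L \<bumpeq> L \<star> ?M"
    using RE by (simp only: assoc)
  have MF: "?M \<star> F \<bumpeq> F \<star> ?M"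
  proof -
    have "?M \<star> L \<star> L \<bumpeq> L \<star> ?M \<star> L"
      by (rule mcong_right[OF L M_comm])
    also have "L \<star> ?M \<star> L \<bumpeq> L \<star> (L \<star> ?M)"
      using mcong_left[OF L M_comm] by (simp only: assoc)
    finally have "?M \<star> L \<star> L \<boxminus> a \<odot> (?M \<star> L) \<bumpeq> L \<star> (L \<star> ?M) \<boxminus> a \<odot> (L \<star> ?M)"
      by (intro mcong_mdiff mcong_mscal M_comm)
    then show ?thesis
      by (simp only: F mmul_mdiff mmul_mscal assoc)
  qed
  have Hecke_in: "A \<star> (S \<star> S) \<star> B \<bumpeq> A \<star> B \<boxplus> w \<odot> (A \<star> S \<star> B)" if A: "mcar A" and B: "mcar B" for A B
  proof -
    have "A \<star> (S \<star> S) \<star> B \<bumpeq> A \<star> (idm \<boxplus> w \<odot> S) \<star> B"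
      by (intro mcong_right mcong_left A B Hecke)
    also have "A \<star> (idm \<boxplus> w \<odot> S) \<star> B = A \<star> idm \<star> B \<boxplus> w \<odot> (A \<star> S \<star> B)"
      by (simp only: mmul_madd mmul_mscal)
    also have "\<dots> \<bumpeq> A \<star> B \<boxplus> w \<odot> (A \<star> S \<star> B)"
      by (intro mcong_madd mcong_refl mcong_right[OF B mcong_idm(2)])
    finally show ?thesis .
  qed
  \<comment> \<open>Inserting \<open>S S\<close> between the two copies of \<open>L\<close> in
    \<open>S L L S\<close> completes it to \<open>?M \<star> ?M\<close>, at the price of the Hecke
    correction \<open>?K\<close>.\<close>
  have SFS: "S \<star> F \<star> S \<bumpeq> ?M \<star> ?M \<boxminus> w \<odot> ?K \<boxminus> a \<odot> ?M"
  proof -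
    have "?M \<star> ?M \<bumpeq> S \<star> L \<star> L \<star> S \<boxplus> w \<odot> ?K"
      using Hecke_in[OF car(1)[OF S L] car(1)[OF L S]] by (simp only: assoc)
    then have "?M \<star> ?M \<boxminus> w \<odot> ?K \<bumpeq> S \<star> L \<star> L \<star> S \<boxplus> w \<odot> ?K \<boxminus> w \<odot> ?K"
      by (intro mcong_mdiff mcong_refl)
    also have "S \<star> L \<star> L \<star> S \<boxplus> w \<odot> ?K \<boxminus> w \<odot> ?K = S \<star> L \<star> L \<star> S"
      by (simp add: madd_def mdiff_def)
    finally have "S \<star> L \<star> L \<star> S \<boxminus> a \<odot> ?M \<bumpeq> ?M \<star> ?M \<boxminus> w \<odot> ?K \<boxminus> a \<odot> ?M"
      by (intro mcong_mdiff mcong_refl) (rule mcong_sym)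
    then show ?thesis
      by (simp only: F mmul_mdiff mmul_mscal assoc)
  qed
  \<comment> \<open>Common normal form of \<open>?K \<star> F\<close> and
    \<open>F \<star> ?K\<close>; it is reached because \<open>L\<close> absorbs \<open>F\<close>
    from either side.\<close>
  let ?N = "c \<odot> (L \<star> S \<star> L) \<boxplus> w \<odot> c \<odot> (S \<star> L \<star> S \<star> L)"
  have KF: "?K \<star> F \<bumpeq> ?N"
  proof -
    have "S \<star> L \<star> S \<star> L \<star> S \<star> F \<bumpeq> L \<star> S \<star> L \<star> S \<star> S \<star> F"
      by (intro mcong_right RE S Fc)
    also have "L \<star> S \<star> L \<star> S \<star> S \<star> F \<bumpeq> L \<star> S \<star> L \<star> F \<boxplus> w \<odot> (L \<star> S \<star> L \<star> S \<star> F)"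
      using Hecke_in[of "L \<star> S \<star> L" F] car Fc by (simp only: assoc)
    also have "\<dots> \<bumpeq> ?N"
    proof (intro mcong_madd mcong_mscal)
      show "L \<star> S \<star> L \<star> F \<bumpeq> c \<odot> (L \<star> S \<star> L)"
        using mcong_left[OF car(1)[OF L S] LF] by (simp only: assoc mmul_mscal)
      have "L \<star> S \<star> L \<star> S \<star> F \<bumpeq> S \<star> L \<star> S \<star> L \<star> F"
        by (intro mcong_right Fc mcong_sym[OF RE])
      also have "\<dots> \<bumpeq> c \<odot> (S \<star> L \<star> S \<star> L)"
        using mcong_left[OF car(1)[OF car(1)[OF S L] S] LF] by (simp only: assoc mmul_mscal)
      finally show "L \<star> S \<star> L \<star> S \<star> F \<bumpeq> c \<odot> (S \<star> L \<star> S \<star> L)" .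
    qed
    finally show ?thesis .
  qed
  have FK: "F \<star> ?K \<bumpeq> ?N"
  proof -
    have "F \<star> (S \<star> L \<star> S \<star> L) \<star> S \<bumpeq> F \<star> (L \<star> S \<star> L \<star> S) \<star> S"
      by (intro mcong_right mcong_left RE S Fc)
    also have "F \<star> (L \<star> S \<star> L \<star> S) \<star> S \<bumpeq> c \<odot> (L \<star> S \<star> L \<star> (S \<star> S))"
      using mcong_right[OF _ FL, of "S \<star> L \<star> S \<star> S"] car by (simp only: assoc mmul_mscal)
    also have "\<dots> \<bumpeq> c \<odot> (L \<star> S \<star> L \<star> (idm \<boxplus> w \<odot> S))"
      by (intro mcong_mscal mcong_left Hecke car)
    also have "\<dots> = c \<odot> (L \<star> S \<star> L \<star> idm) \<boxplus> w \<odot> c \<odot> (L \<star> S \<star> L \<star> S)"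
      by (simp only: mmul_madd mmul_mscal mscal_madd mscal_commute[of c w])
    also have "\<dots> \<bumpeq> ?N"
      by (intro mcong_madd mcong_mscal mcong_idm mcong_sym[OF RE])
    finally show ?thesis
      by (simp only: assoc)
  qed
  \<comment> \<open>Each of \<open>?M \<star> ?M\<close>, \<open>?K\<close> and \<open>?M\<close>
    now commutes with \<open>F\<close>, therefore so does
    \<open>S \<star> F \<star> S\<close>.\<close>
  have "S \<star> F \<star> S \<star> F \<bumpeq> (?M \<star> ?M \<boxminus> w \<odot> ?K \<boxminus> a \<odot> ?M) \<star> F"
    by (rule mcong_right[OF Fc SFS])
  also have "\<dots> = ?M \<star> (?M \<star> F) \<boxminus> w \<odot> (?K \<star> F) \<boxminus> a \<odot> (?M \<star> F)"
    by (simp only: mmul_mdiff mmul_mscal assoc)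
  also have "\<dots> \<bumpeq> F \<star> ?M \<star> ?M \<boxminus> w \<odot> (F \<star> ?K) \<boxminus> a \<odot> (F \<star> ?M)"
  proof (intro mcong_mdiff mcong_mscal MF)
    have "?M \<star> (?M \<star> F) \<bumpeq> ?M \<star> F \<star> ?M"
      using mcong_left[OF car(1)[OF car(1)[OF S L] S] MF] by (simp only: assoc)
    also have "\<dots> \<bumpeq> F \<star> ?M \<star> ?M"
      by (intro mcong_right MF car)
    finally show "?M \<star> (?M \<star> F) \<bumpeq> F \<star> ?M \<star> ?M" .
    show "?K \<star> F \<bumpeq> F \<star> ?K"
      using KF mcong_sym[OF FK] by (rule mcong_trans)
  qed
  also have "\<dots> = F \<star> (?M \<star> ?M \<boxminus> w \<odot> ?K \<boxminus> a \<odot> ?M)"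
    by (simp only: mmul_mdiff mmul_mscal assoc)
  also have "\<dots> \<bumpeq> F \<star> (S \<star> F \<star> S)"
    by (rule mcong_left[OF Fc mcong_sym[OF SFS]])
  finally show ?thesis
    by (simp only: assoc)
qed

end

lemma kron_idm_mmul:
  fixes A B :: "(nat, 'a :: ring_1) matr"
  assumes "r \<in> {1..n} \<times> {1..n}" "c \<in> {1..n} \<times> {1..n}"
  shows "mmul ({1..n} \<times> {1..n}) (kron idm A) (kron idm B) r c = kron idm (mmul {1..n} A B) r (c :: nat \<times> nat)"
proof -
  have "mmul ({1..n} \<times> {1..n}) (kron idm A) (kron idm B) r c
      = (\<Sum>s\<in>{1..n}. \<Sum>t\<in>{1..n}. kron idm A r (s, t) * kron idm B (s, t) c)"
    unfolding mmul_def sum.cartesian_product' ..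
  also have "\<dots> = (\<Sum>t\<in>{1..n}. kron idm A r (fst r, t) * kron idm B (fst r, t) c)"
    using assms by (intro sum_single_term) (auto simp: kron_idm intro!: sum.neutral)
  also have "\<dots> = kron idm (mmul {1..n} A B) r c"
    by (simp add: kron_idm mmul_def)
  finally show ?thesis .
qed

text \<open>Formed for an arbitrary matrix, so that one set of lemmas covers the defining relations
  and their images under substitution.\<close>

definition re_matrix :: "nat \<Rightarrow> (nat, lgen word hser) matr \<Rightarrow> (nat \<times> nat, lgen word hser) matr"
  where "re_matrix n A = (let I = {1..n} \<times> {1..n}; SA = mmul I (hscalm (Smat n)) (kron idm A);
      AS = mmul I (kron idm A) (hscalm (Smat n)) in mmul I SA SA \<boxminus> mmul I AS AS)"

lemma re_rels_eq: "re_rels n = {re_matrix n Lmat r c | r c. r \<in> {1..n} \<times> {1..n} \<and> c \<in> {1..n} \<times> {1..n}}"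
  unfolding re_rels_def re_matrix_def Let_def mdiff_def ..

lemma covariant_re_matrix: "vec.covariant n A \<Longrightarrow> ten.covariant n (re_matrix n A)"
  unfolding re_matrix_def Let_def mdiff_def
  by (intro ten.covariant_diff ten.covariant_mmul covariant_Smat covariant_kron_idm)

text \<open>The action turns an entry of a covariant matrix into a combination of entries of the
  same matrix.\<close>

lemma (in weights) act_covariant_mem:
  assumes "covariant A" "ideal J (free_alg (lgens n))" "\<And>r c. r \<in> I \<Longrightarrow> c \<in> I \<Longrightarrow> A r c \<in> J"
    and "r \<in> I" "c \<in> I"
  shows "act_free n (gen g) (A r c) \<in> J" "act_free n (uK s i) (A r c) \<in> J"
  unfolding covariant_ugen[OF assms(1,4,5)] covariant_uK[OF assms(1,4,5)]
  using assms(3-5) by (auto intro!: ideal_free_algE(7-9)[OF assms(2)])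

lemma fcar_mmul:
  assumes "\<And>s. s \<in> I \<Longrightarrow> A r s \<in> fcar X" "\<And>s. s \<in> I \<Longrightarrow> B s c \<in> fcar X"
  shows "mmul I A B r c \<in> fcar X"
  using assms unfolding mmul_def by (intro fcar_sum fcar_mult)

lemma fcar_kron_idm:
  assumes "\<And>r c. r \<in> {1..n} \<Longrightarrow> c \<in> {1..n} \<Longrightarrow> A r c \<in> fcar X"
    and "r \<in> {1..n} \<times> {1..n}" "c \<in> {1..n} \<times> {1..n}"
  shows "kron idm A r c \<in> fcar X"
  using assms by (auto simp: kron_idm)

lemma fcar_re_matrix:
  assumes "\<And>r c. r \<in> {1..n} \<Longrightarrow> c \<in> {1..n} \<Longrightarrow> A r c \<in> fcar X"
    and "r \<in> {1..n} \<times> {1..n}" "c \<in> {1..n} \<times> {1..n}"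
  shows "re_matrix n A r c \<in> fcar X"
  unfolding re_matrix_def Let_def mdiff_def
  by (intro fcar_diff fcar_mmul fcar_kron_idm assms(1)) (use assms(2,3) in \<open>simp_all add: hscalm_def\<close>)

lemma fcar_Lmat: "r \<in> {1..n} \<Longrightarrow> c \<in> {1..n} \<Longrightarrow> Lmat r c \<in> fcar (lgens n)"
  unfolding Lmat_def by (rule fcar_gen) (simp add: lgens_def)

lemma fcar_shiftm: "A r c \<in> fcar X \<Longrightarrow> shiftm A z r c \<in> fcar X"
  by (simp add: shiftm_def fcar_diff idm_def)

lemma fcar_qtrace:
  assumes "\<And>r. r \<in> {1..n} \<Longrightarrow> A r r \<in> fcar X"
  shows "qtrace n A \<in> fcar X"
  unfolding qtrace_def using assms by (intro fcar_sum fcar_scal)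

lemma subst_mmul: "subst F (mmul I A B r c) = mmul I (\<lambda>r c. subst F (A r c)) (\<lambda>r c. subst F (B r c)) r c"
  by (simp add: mmul_def hlin_sum[OF hlin_subst] subst_mult)

lemma subst_re_matrix: "subst F (re_matrix n Lmat r c) = re_matrix n F r c"
proof -
  have "(\<lambda>(r :: nat \<times> nat) c. subst F (kron idm Lmat r c)) = kron idm F" for F :: "(nat, lgen word hser) matr"
    by (intro ext) (simp add: kron_idm Lmat_def subst_gen hlin_0[OF hlin_subst])
  moreover have "(\<lambda>r c. subst F (hscalm A r c)) = hscalm A" for F :: "(nat, lgen word hser) matr" and A :: "(nat \<times> nat, complex fps) matr"
    by (simp add: hscalm_def subst_hscal)
  ultimately show ?thesis
    by (simp add: re_matrix_def Let_def mdiff_def hlin_diff[OF hlin_subst] subst_mmul)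
qed

lemma subst_shiftm: "subst F (shiftm Lmat z r c) = shiftm F z r c"
  by (simp add: shiftm_def hlin_diff[OF hlin_subst] hlin_scal[OF hlin_subst] Lmat_def subst_gen idm_def
      hlin_0[OF hlin_subst])

lemma subst_qtrace: "subst F (qtrace n Lmat) = qtrace n F"
  by (simp add: qtrace_def hlin_sum[OF hlin_subst] hlin_scal[OF hlin_subst] Lmat_def subst_gen)

lemma mmul_shiftm:
  assumes "finite I" "c \<in> I"
  shows "mmul I A (shiftm B z) r c = mmul I A B r c - hscal (fps_const z) * A r c"
proof -
  have "mmul I A (shiftm B z) r c = (\<Sum>s\<in>I. A r s * B s c - (if s = c then hscal (fps_const z) * A r c else 0))"
    unfolding mmul_def shiftm_def
    by (intro sum.cong) (auto simp: idm_def right_diff_distrib hscal_commute[of "A _ _"])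
  then show ?thesis
    using assms by (simp add: sum_subtractf mmul_def)
qed

section \<open>Verification for the two quantized orbits\<close>

context
  fixes l m k n :: nat and lam mu nu :: complex and T :: "lgen word hser set" and F :: "(nat, lgen word hser) matr"
  defines "n \<equiv> l + m + k" and "T \<equiv> orbit3_rels l m k lam mu" and "nu \<equiv> - (lam * mu)"
    and "F \<equiv> (\<lambda>i j. mmul {1..n} Lmat Lmat i j - hscal (fps_const (lam + mu)) * Lmat i j)"
begin

private definition "J = closed_ideal (lgens n) T"

private definition "E3 = mmul {1..n} (mmul {1..n} Lmat (shiftm Lmat lam)) (shiftm Lmat mu)"

private definition "t = fps_const lam * qint l + fps_const mu * qint m"

private definition "t2 = fps_const (lam + mu) * t - fps_const (lam * mu) * qint (l + m)"

private lemma T_eq: "T = re_rels n \<union> {E3 r c | r c. r \<in> {1..n} \<and> c \<in> {1..n}}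
    \<union> {qtrace n Lmat - hscal t} \<union> {qtrace n (mmul {1..n} Lmat Lmat) - hscal t2}"
  unfolding T_def orbit3_rels_def E3_def t_def t2_def Let_def n_def ..

private lemma F_covariant: "vec.covariant n F"
  unfolding F_def
  by (intro vec.covariant_diff vec.covariant_scal vec.covariant_mmul covariant_Lmat)

private lemma F_fcar: "r \<in> {1..n} \<Longrightarrow> c \<in> {1..n} \<Longrightarrow> F r c \<in> fcar (lgens n)"
  unfolding F_def by (intro fcar_diff fcar_scal fcar_mmul fcar_Lmat)

private lemma T_fcar: "T \<subseteq> fcar (lgens n)"
  unfolding T_eq re_rels_eq E3_def
  by (auto intro!: fcar_re_matrix fcar_diff fcar_qtrace fcar_mmul fcar_shiftm fcar_Lmat simp del: One_nat_def)

private lemma J_ideal: "ideal J (free_alg (lgens n))"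
  unfolding J_def by (rule ideal_closed_ideal[OF T_fcar])

private lemma T_J: "T \<subseteq> J"
  unfolding J_def by (rule subset_closed_ideal[OF T_fcar])

private lemma E3_J: "r \<in> {1..n} \<Longrightarrow> c \<in> {1..n} \<Longrightarrow> E3 r c \<in> J"
  using T_J unfolding T_eq by blast

private lemma re_J: "r \<in> {1..n} \<times> {1..n} \<Longrightarrow> c \<in> {1..n} \<times> {1..n} \<Longrightarrow> re_matrix n Lmat r c \<in> J"
proof -
  assume "r \<in> {1..n} \<times> {1..n}" "c \<in> {1..n} \<times> {1..n}"
  then have "re_matrix n Lmat r c \<in> re_rels n"
    unfolding re_rels_eq by blast
  then show ?thesis
    by (intro subsetD[OF T_J]) (simp add: T_eq)
qed

private lemma trace_J: "qtrace n Lmat - hscal t \<in> J" "qtrace n (mmul {1..n} Lmat Lmat) - hscal t2 \<in> J"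
  using T_J unfolding T_eq by blast+

text \<open>Reflection and cubic relations are entries of covariant matrices. A trace relation is an
  invariant minus a scalar, so generators annihilate it and \<open>K_i^s\<close> fixes it.\<close>

private lemma act_T:
  assumes "a \<in> T"
  shows "act_free n (gen g) a \<in> J" "act_free n (uK s i) a \<in> J"
proof -
  note re = ten.act_covariant_mem[OF covariant_re_matrix[OF covariant_Lmat] J_ideal re_J]
  have "vec.covariant n E3"
    unfolding E3_def by (intro vec.covariant_mmul covariant_shiftm covariant_Lmat)
  note E3 = vec.act_covariant_mem[OF this J_ideal E3_J]
  have tr: "act_free n (gen g) (qtrace n A - hscal z) \<in> J \<and> act_free n (uK s i) (qtrace n A - hscal z) \<in> J"
    if "vec.covariant n A" "qtrace n A - hscal z \<in> J" for A z
    using that ideal_free_algE(2)[OF J_ideal]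
    by (simp add: hlin_diff[OF hlin_act] covariant_qtrace_ugen covariant_qtrace_uK act_hscal counit'_gen counit'_uK)
  note tr1 = tr[OF covariant_Lmat trace_J(1)] tr[OF vec.covariant_mmul[OF covariant_Lmat covariant_Lmat] trace_J(2)]
  consider r c where "a = re_matrix n Lmat r c" "r \<in> {1..n} \<times> {1..n}" "c \<in> {1..n} \<times> {1..n}"
    | r c where "a = E3 r c" "r \<in> {1..n}" "c \<in> {1..n}"
    | "a = qtrace n Lmat - hscal t" | "a = qtrace n (mmul {1..n} Lmat Lmat) - hscal t2"
    using assms unfolding T_eq re_rels_eq by (elim UnE CollectE exE conjE singletonE) metis+
  then have "act_free n (gen g) a \<in> J \<and> act_free n (uK s i) a \<in> J"
  proof cases
    case 1
    then show ?thesis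
      using re by (simp only:)
  next
    case 2
    then show ?thesis
      using E3 by (simp only:)
  qed (use tr1 in \<open>simp_all only:\<close>)
  then show "act_free n (gen g) a \<in> J" "act_free n (uK s i) a \<in> J"
    by simp_all
qed

private lemma act_J: "a \<in> J \<Longrightarrow> act_free n x a \<in> J"
  unfolding J_def by (rule act_closed_ideal[OF T_fcar act_T[unfolded J_def]])

interpretation V: matrix_congruence "lgens n" J "{1..n}"
  by (rule matrix_congruence.intro[OF J_ideal]) simp

interpretation W: matrix_congruence "lgens n" J "{1..n} \<times> {1..n}"
  by (rule matrix_congruence.intro[OF J_ideal]) simp

private lemma F_eq: "F = mmul {1..n} Lmat Lmat \<boxminus> fps_const (lam + mu) \<odot> Lmat"
  by (simp add: F_def mdiff_def mscal_def)

text \<open>Expansion of \<open>(E - lam)(E - mu) = F - nu\<close>, multiplied by \<open>E\<close>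
  from the left.\<close>

private lemma E3_eq:
  assumes "c \<in> {1..n}"
  shows "E3 r c = mmul {1..n} Lmat F r c - hscal (fps_const nu) * Lmat r c"
proof -
  have 1: "mmul {1..n} Lmat (shiftm Lmat lam) r c = mmul {1..n} Lmat Lmat r c - hscal (fps_const lam) * Lmat r c"
    if "c \<in> {1..n}" for r c
    using that by (simp add: mmul_shiftm)
  have "E3 r c = mmul {1..n} (mmul {1..n} Lmat (shiftm Lmat lam)) Lmat r c
      - hscal (fps_const mu) * mmul {1..n} Lmat (shiftm Lmat lam) r c"
    unfolding E3_def using assms by (simp add: mmul_shiftm)
  also have "mmul {1..n} (mmul {1..n} Lmat (shiftm Lmat lam)) Lmat r c
      = mmul {1..n} (mmul {1..n} Lmat Lmat \<boxminus> fps_const lam \<odot> Lmat) Lmat r c"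
    unfolding mmul_def[of _ "mmul _ _ (shiftm _ _)"] mmul_def[of _ "_ \<boxminus> _"]
    by (intro sum.cong refl) (simp add: 1 mdiff_def mscal_def)
  finally have "E3 r c = mmul {1..n} (mmul {1..n} Lmat Lmat \<boxminus> fps_const lam \<odot> Lmat) Lmat r c
      - hscal (fps_const mu) * (mmul {1..n} Lmat Lmat r c - hscal (fps_const lam) * Lmat r c)"
    by (simp only: 1[OF assms])
  moreover have "(hscal (fps_const (lam + mu)) :: lgen word hser) = hscal (fps_const lam) + hscal (fps_const mu)"
    by (simp flip: hscal_add)
  moreover have "(hscal (fps_const nu) :: lgen word hser) = - (hscal (fps_const mu) * hscal (fps_const lam))"
    by (simp add: nu_def mult.commute flip: hscal_mult hscal_uminus)
  ultimately show ?thesis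
    unfolding F_eq mmul_mdiff mmul_mscal mmul_assoc by (simp add: mdiff_def mscal_def algebra_simps)
qed

private lemma LF: "V.mcong (mmul {1..n} Lmat F) (fps_const nu \<odot> Lmat)"
  unfolding V.mcong_def mscal_def using E3_J E3_eq by simp

private lemma FL: "V.mcong (mmul {1..n} F Lmat) (fps_const nu \<odot> Lmat)"
proof -
  have "mmul {1..n} F Lmat = mmul {1..n} Lmat F"
    by (simp only: F_eq mmul_mdiff mmul_mscal mmul_assoc)
  then show ?thesis
    using LF by simp
qed

text \<open>One factor \<open>F\<close> is expanded as a polynomial in \<open>Lmat\<close>, and each
  term absorbs the other factor by \<open>LF\<close>.\<close>

private lemma FF: "V.mcong (mmul {1..n} F F) (fps_const nu \<odot> F)"
proof -
  have L: "V.mcar Lmat"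
    unfolding V.mcar_def using fcar_Lmat by blast
  let ?a = "fps_const (lam + mu)"
  have "mmul {1..n} F F = mmul {1..n} Lmat (mmul {1..n} Lmat F) \<boxminus> ?a \<odot> mmul {1..n} Lmat F"
    by (subst (1) F_eq) (simp only: mmul_mdiff mmul_mscal mmul_assoc)
  moreover have "V.mcong \<dots> (mmul {1..n} Lmat (fps_const nu \<odot> Lmat) \<boxminus> ?a \<odot> fps_const nu \<odot> Lmat)"
    by (intro V.mcong_mdiff V.mcong_mscal V.mcong_left L LF)
  moreover have "mmul {1..n} Lmat (fps_const nu \<odot> Lmat) \<boxminus> ?a \<odot> fps_const nu \<odot> Lmat = fps_const nu \<odot> F"
    unfolding F_eq mmul_mscal mscal_commute[of ?a] by (simp add: mscal_def mdiff_def right_diff_distrib)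
  ultimately show ?thesis
    by simp
qed

private lemma kron_mcong:
  assumes "V.mcong A B"
  shows "W.mcong (kron idm A) (kron idm B)"
  using assms ideal_free_algE(2)[OF J_ideal] by (auto simp: V.mcong_def W.mcong_def kron_idm)

private lemma kron_mmul: "W.mcong (mmul ({1..n} \<times> {1..n}) (kron idm A) (kron idm B)) (kron idm (mmul {1..n} A B))"
  by (rule W.mcong_eqI) (rule kron_idm_mmul)

private lemma re_F:
  assumes "r \<in> {1..n} \<times> {1..n}" "c \<in> {1..n} \<times> {1..n}"
  shows "re_matrix n F r c \<in> J"
proof -
  let ?I = "{1..n} \<times> {1..n}"
  let ?S = "hscalm (Smat n) :: (nat \<times> nat, lgen word hser) matr"
  let ?L = "kron idm Lmat :: (nat \<times> nat, lgen word hser) matr"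
  let ?F = "kron idm F"
  let ?a = "fps_const (lam + mu)"
  \<comment> \<open>The quadratic expression formed on the tensor square agrees with
    \<open>kron idm F\<close> only on the index set. The reflection equation is proved for
    \<open>F'\<close> and then transported along the congruence.\<close>
  define F' where "F' = mmul ?I ?L ?L \<boxminus> ?a \<odot> ?L"
  have S: "W.mcar ?S"
    by (simp add: W.mcar_def hscalm_def)
  have L: "W.mcar ?L"
    unfolding W.mcar_def using fcar_kron_idm fcar_Lmat by blast
  have F: "W.mcar ?F"
    unfolding W.mcar_def using fcar_kron_idm F_fcar by blast
  have F'c: "W.mcar F'"
    unfolding F'_def by (intro W.mcar_mdiff W.mcar_mscal W.mcar_mmul L)
  have "kron idm F = kron idm (mmul {1..n} Lmat Lmat) \<boxminus> ?a \<odot> ?L"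
    by (intro ext) (simp add: kron_idm F_def mdiff_def mscal_def)
  then have F': "W.mcong F' ?F"
    unfolding F'_def by (auto intro: W.mcong_mdiff kron_mmul)
  have kL: "kron idm (fps_const nu \<odot> Lmat) = fps_const nu \<odot> ?L"
    by (intro ext) (simp add: kron_idm mscal_def)
  have LF': "W.mcong (mmul ?I ?L F') (fps_const nu \<odot> ?L)"
    using W.mcong_left[OF L F'] kron_mmul kron_mcong[OF LF] unfolding kL by (blast intro: W.mcong_trans)
  have FL': "W.mcong (mmul ?I F' ?L) (fps_const nu \<odot> ?L)"
    using W.mcong_right[OF L F'] kron_mmul kron_mcong[OF FL] unfolding kL by (blast intro: W.mcong_trans)
  have "W.mcong (mmul ?I ?S ?S) (idm \<boxplus> (qpow 1 - qpow (- 1)) \<odot> ?S)"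
  proof (rule W.mcong_eqI)
    fix r c :: "nat \<times> nat"
    assume "r \<in> ?I"
    from Smat_Hecke[OF this, of c]
    have "(hscal (mmul ?I (Smat n) (Smat n) r c) :: lgen word hser) = hscal (idm r c + (qpow 1 - qpow (- 1)) * Smat n r c)"
      by simp
    moreover have "hscal (idm r c) = (idm r c :: lgen word hser)"
      by (simp add: idm_def)
    ultimately show "mmul ?I ?S ?S r c = (idm \<boxplus> (qpow 1 - qpow (- 1)) \<odot> ?S) r c"
      by (simp add: mmul_def hscalm_def hscal_sum hscal_mult hscal_add madd_def mscal_def)
  qed
  moreover have "W.mcong (mmul ?I (mmul ?I (mmul ?I ?S ?L) ?S) ?L) (mmul ?I (mmul ?I (mmul ?I ?L ?S) ?L) ?S)"
    using re_J unfolding W.mcong_def re_matrix_def Let_def mdiff_def mmul_assoc by blast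
  ultimately have "W.mcong (mmul ?I (mmul ?I (mmul ?I ?S F') ?S) F') (mmul ?I (mmul ?I (mmul ?I F' ?S) F') ?S)"
    using LF' FL' by (rule W.reflection_equation_quadratic[OF S L _ _ F'_def])
  then have *: "W.mcong (mmul ?I (mmul ?I ?S F') (mmul ?I ?S F')) (mmul ?I (mmul ?I F' ?S) (mmul ?I F' ?S))"
    by (simp only: mmul_assoc)
  have SF: "W.mcong (mmul ?I ?S F') (mmul ?I ?S ?F)" and FS: "W.mcong (mmul ?I F' ?S) (mmul ?I ?F ?S)"
    by (rule W.mcong_left[OF S F'] W.mcong_right[OF S F'])+
  note car = W.mcar_mmul[OF S F] W.mcar_mmul[OF S F'c] W.mcar_mmul[OF F S] W.mcar_mmul[OF F'c S]
  have "W.mcong (mmul ?I (mmul ?I ?S ?F) (mmul ?I ?S ?F)) (mmul ?I (mmul ?I ?S F') (mmul ?I ?S F'))"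
    by (rule W.mcong_trans[OF W.mcong_left[OF car(1)] W.mcong_right[OF car(2)]]) (rule W.mcong_sym[OF SF])+
  also note *
  also have "W.mcong (mmul ?I (mmul ?I F' ?S) (mmul ?I F' ?S)) (mmul ?I (mmul ?I ?F ?S) (mmul ?I ?F ?S))"
    by (rule W.mcong_trans[OF W.mcong_left[OF car(4)] W.mcong_right[OF car(3)]]) (rule FS)+
  finally show ?thesis
    using assms unfolding W.mcong_def re_matrix_def Let_def mdiff_def by blast
qed

text \<open>In \<open>t2 - (lam + mu) t\<close> the terms with \<open>qint l\<close> and
  \<open>qint m\<close> cancel, leaving \<open>-lam mu\<close> times
  \<open>qint (l + m)\<close>.\<close>

private lemma trace_F: "qtrace n F - hscal (fps_const nu * qint (l + m)) \<in> J"
proof -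
  let ?a = "fps_const (lam + mu)"
  have "qtrace n F = qtrace n (mmul {1..n} Lmat Lmat) - hscal ?a * qtrace n Lmat"
    by (simp add: qtrace_def F_def right_diff_distrib sum_subtractf sum_distrib_left hscal_left_commute[of "hscal _" ?a])
  moreover have "(hscal (fps_const nu * qint (l + m)) :: lgen word hser) = hscal t2 - hscal ?a * hscal t"
    unfolding hscal_mult[symmetric] hscal_diff[symmetric]
    by (simp add: t2_def nu_def flip: fps_const_neg)
  ultimately have "qtrace n F - hscal (fps_const nu * qint (l + m))
      = (qtrace n (mmul {1..n} Lmat Lmat) - hscal t2) - hscal ?a * (qtrace n Lmat - hscal t)"
    by (simp add: right_diff_distrib)
  then show ?thesis
    using trace_J ideal_free_algE(7,8)[OF J_ideal] by simp
qed

private lemma S_eq: "orbit2_rels (l + m) k nu = re_rels n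
    \<union> {mmul {1..n} Lmat (shiftm Lmat nu) r c | r c. r \<in> {1..n} \<and> c \<in> {1..n}}
    \<union> {qtrace n Lmat - hscal (fps_const nu * qint (l + m))}"
  unfolding orbit2_rels_def Let_def n_def ..

private lemma S_fcar: "orbit2_rels (l + m) k nu \<subseteq> fcar (lgens n)"
  unfolding S_eq re_rels_eq
  by (auto intro!: fcar_re_matrix fcar_diff fcar_qtrace fcar_mmul fcar_shiftm fcar_Lmat simp del: One_nat_def)

private lemma subst_S:
  assumes "a \<in> orbit2_rels (l + m) k nu"
  shows "subst F a \<in> J"
proof -
  have "subst F (mmul {1..n} Lmat (shiftm Lmat nu) r c) \<in> J" if "r \<in> {1..n}" "c \<in> {1..n}" for r c
  proof -
    have "subst F (mmul {1..n} Lmat (shiftm Lmat nu) r c) = mmul {1..n} F (shiftm F nu) r c"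
      unfolding subst_mmul subst_shiftm by (simp add: Lmat_def subst_gen)
    also have "\<dots> \<in> J"
      using FF that by (simp add: mmul_shiftm V.mcong_def mscal_def)
    finally show ?thesis .
  qed
  moreover have "subst F (qtrace n Lmat - hscal (fps_const nu * qint (l + m))) \<in> J"
    using trace_F by (simp add: hlin_diff[OF hlin_subst] subst_qtrace subst_hscal)
  ultimately show ?thesis
    using assms re_F unfolding S_eq re_rels_eq by (auto simp: subst_re_matrix)
qed

lemma orbit_morphism:
  "\<exists>\<pi>. equivariant_morphism n (orbit2_rels (l + m) k nu) T \<pi>
    \<and> (\<forall>i\<in>{1..n}. \<forall>j\<in>{1..n}. \<pi> (cls (lgens n) (orbit2_rels (l + m) k nu) (Lmat i j)) = cls (lgens n) T (F i j))"
  by (rule equivariant_morphismI[OF S_fcar T_fcar act_J[unfolded J_def] F_covariant F_fcar subst_S[unfolded J_def]])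

end

theorem theorem4p15:
  fixes l m k n :: nat and lam mu :: complex
  assumes "l > 0" and "m > 0" and "k > 0" and "n = l + m + k"
    and "lam \<noteq> mu" and "lam \<noteq> 0" and "mu \<noteq> 0"
  shows "\<exists>\<pi>. equivariant_morphism n (orbit2_rels (l + m) k (- (lam * mu))) (orbit3_rels l m k lam mu) \<pi>
    \<and> (\<forall>i\<in>{1..n}. \<forall>j\<in>{1..n}.
          \<pi> (cls (lgens n) (orbit2_rels (l + m) k (- (lam * mu))) (Lmat i j))
          = cls (lgens n) (orbit3_rels l m k lam mu)
              (mmul {1..n} Lmat Lmat i j - hscal (fps_const (lam + mu)) * Lmat i j))"
  unfolding assms(4) by (rule orbit_morphism)

end
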